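(* Let $\Psi=\{\Omega_1,\dots,\Omega_L\}$ be a domain hierarchy on the $n$-dimensional cube $\Omega=(0,1)^n\subset\mathbb R^n$ generated by refinements of $(\vec p+\vec 1)$-boxes, i.e. each $\Omega_{\ell+1}$ is a union of closures of level-$\ell$ $(\vec p+\vec 1)$-boxes. Then the corresponding THB-spline de Rham complex $$\mathbb V_h^0\xrightarrow{\ d^0\ }\mathbb V_h^1\xrightarrow{\ d^1\ }\cdots\xrightarrow{\ d^{n-1}\ }\mathbb V_h^n$$ is exact, i.e. $\mathrm{image}(d^{k-1})=\mathrm{kernel}(d^k)$ for successive differential operators $d^{k-1},d^k$.
   Context: **B-splines.** $\Omega=(0,1)^n$. Fix a degree $\vec p$ with $p^i\ge1$ and interior knot multiplicities $\vec m$ with $1\le m^i\le p^i$, the same at all levels. For levels $\ell=1,\dots,L$ and directions $i=1,\dots,n$ there is a breakpoint sequence $0=\hat\xi^i_{0,\ell}<\hat\xi^i_{1,\ell}<\dots<1$; for $\ell>1$ the level-$\ell$ sequence is obtained by bisecting every interval of the level-$(\ell-1)$ one; ratios of neighbouring interval lengths lie in $[\eta^{-1},\eta]$ for a fixed $\eta\ge1$. For a degree vector $\vec s$ with $s^i\in\{p^i-1,p^i\}$, the level-$\ell$ knot vector in direction $i$ repeats $0$ and $1$ each $s^i+1$ times and each interior breakpoint $m^i$ times; $\mathcal B_{\ell,\vec s}$ is the set of the corresponding tensor-product B-splines of degree $\vec s$. Supports are regarded as open sets. **$(\vec p+\vec 1)$-boxes and hierarchy.** The number of level-$\ell$ intervals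 in direction $i$ is assumed to be a multiple of $p^i+1$. A level-$\ell$ $(\vec p+\vec1)$-box is a box $\prod_i(\hat\xi^i_{r^i(p^i+1),\ell},\hat\xi^i_{(r^i+1)(p^i+1),\ell})\subset\Omega$ with $r^i\in\mathbb N$. A domain hierarchy is $\Psi=\{\Omega_1,\dots,\Omega_L\}$ with closed sets $\Omega_L\subseteq\dots\subseteq\Omega_1=\overline\Omega$. **THB-splines.** For fixed $\vec s$ put $\mathcal B_{\ell,\vec s}^{\mathrm{in}}=\{B\in\mathcal B_{\ell,\vec s}:\mathrm{supp}\,B\subseteq\Omega_\ell\}$ and, for $f=\sum_{B\in\mathcal B_{\ell,\vec s}}\tau_BB$, $\mathrm{trunc}_\ell(f)=\sum_{B\in\mathcal B_{\ell,\vec s}\setminus\mathcal B_{\ell,\vec s}^{\mathrm{in}}}\tau_BB$. The THB-spline basis is $\mathcal T_L$ where $\mathcal T_1=\mathcal B_{1,\vec s}$ and $\mathcal T_\ell=\{\mathrm{trunc}_\ell(T):T\in\mathcal T_{\ell-1},\ \mathrm{supp}\,T\nsubseteq\Omega_\ell\}\cup\mathcal B_{\ell,\vec s}^{\mathrm{in}}$. Its span is $\mathbb T_{\Psi,\vec s}$ (all degrees use the same $\Psi$, i.e. the hierarchy built with $(\vec p+\vec 1)$-boxes). **The complex.** For $I\subseteq\{1,\dots,n\}$ let $\vec 1_I$ be the indicator vector of $I$. $\mathbb V_h^k$ is the space of differential $k$-forms $\sum_{|I|=k}f_I\,dx^I$ with $f_I\in\mathbb T_{\Psi,\vec p-\vec1_I}$,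 and $d^k$ is the exterior derivative. In vector-proxy form: for $n=2$ this is $\mathbb V_h^0=\mathbb T_{\Psi,[p^1,p^2]}$, $\mathbb V_h^1=\mathbb T_{\Psi,[p^1,p^2-1]}\times\mathbb T_{\Psi,[p^1-1,p^2]}$, $\mathbb V_h^2=\mathbb T_{\Psi,[p^1-1,p^2-1]}$ with $d^0=\mathrm{rot}$, $\mathrm{rot}(\sigma)=(\partial_y\sigma,-\partial_x\sigma)$, and $d^1=\mathrm{div}$; for $n=3$ the operators are $\mathrm{grad},\mathrm{curl},\mathrm{div}$ and $\mathbb V_h^1,\mathbb V_h^2$ are the products of the spaces above, with the degree reduced in direction $i$ for the $i$-th component of $\mathbb V_h^1$, and in the two directions other than $i$ for the $i$-th component of $\mathbb V_h^2$. *)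

theory Defs
  imports "HOL-Analysis.Analysis"
begin

text \<open>
  Coordinate directions are the elements of a finite linearly ordered index type \<open>'n\<close>, so that
  \<open>n = CARD('n)\<close> and \<open>\<Omega> = box 0 1\<close> in \<open>real ^ 'n\<close>.  Throughout, \<open>\<xi> l i\<close> is the list of
  breakpoints of level \<open>l\<close> in direction \<open>i\<close>; it has \<open>length (\<xi> l i) - 1\<close> intervals.
  The domain \<open>\<Omega>\<^sub>l\<close> is \<open>\<Psi> l\<close>.  Levels are \<open>1, ..., L\<close>; values at other levels are irrelevant.
\<close>

definition breakpoint_seq :: "real \<Rightarrow> real list \<Rightarrow> bool" where
  "breakpoint_seq \<eta> xs \<longleftrightarrow>
     2 \<le> length xs \<and> hd xs = 0 \<and> last xs = 1 \<and> sorted_wrt (<) xs \<and>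
     (\<forall>j. j + 2 < length xs \<longrightarrow>
        (xs ! (j + 2) - xs ! (j + 1)) / (xs ! (j + 1) - xs ! j) \<in> {1 / \<eta> .. \<eta>})"

definition bisected :: "real list \<Rightarrow> real list \<Rightarrow> bool" where
  "bisected xs ys \<longleftrightarrow>
     length ys = 2 * length xs - 1 \<and>
     (\<forall>j < length xs. ys ! (2 * j) = xs ! j) \<and>
     (\<forall>j. j + 1 < length xs \<longrightarrow> ys ! (2 * j + 1) = (xs ! j + xs ! (j + 1)) / 2)"

definition mesh_hierarchy ::
  "nat \<Rightarrow> real \<Rightarrow> ('n \<Rightarrow> nat) \<Rightarrow> (nat \<Rightarrow> 'n \<Rightarrow> real list) \<Rightarrow> bool" where
  "mesh_hierarchy L \<eta> p \<xi> \<longleftrightarrow>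
     (\<forall>l\<in>{1..L}. \<forall>i. breakpoint_seq \<eta> (\<xi> l i) \<and> (p i + 1) dvd (length (\<xi> l i) - 1)) \<and>
     (\<forall>l\<in>{1..<L}. \<forall>i. bisected (\<xi> l i) (\<xi> (l + 1) i))"

definition p1_boxes :: "('n::finite \<Rightarrow> nat) \<Rightarrow> ('n \<Rightarrow> real list) \<Rightarrow> (real ^ 'n) set set" where
  "p1_boxes p xs =
     {box (\<chi> i. xs i ! (r i * (p i + 1))) (\<chi> i. xs i ! ((r i + 1) * (p i + 1))) | r :: 'n \<Rightarrow> nat.
        \<forall>i. (r i + 1) * (p i + 1) \<le> length (xs i) - 1}"

definition domain_hierarchy ::
  "nat \<Rightarrow> ('n::finite \<Rightarrow> nat) \<Rightarrow> (nat \<Rightarrow> 'n \<Rightarrow> real list) \<Rightarrow> (nat \<Rightarrow> (real ^ 'n) set) \<Rightarrow> bool" where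
  "domain_hierarchy L p \<xi> \<Psi> \<longleftrightarrow>
     \<Psi> 1 = closure (box 0 1) \<and>
     (\<forall>l\<in>{1..L}. closed (\<Psi> l)) \<and>
     (\<forall>l\<in>{1..<L}. \<Psi> (l + 1) \<subseteq> \<Psi> l \<and> (\<exists>Q \<subseteq> p1_boxes p (\<xi> l). \<Psi> (l + 1) = \<Union> (closure ` Q)))"

definition knots :: "nat \<Rightarrow> nat \<Rightarrow> real list \<Rightarrow> real list" where
  "knots s m xs =
     replicate (s + 1) 0 @ concat (map (replicate m) (butlast (tl xs))) @ replicate (s + 1) 1"

text \<open>
  Cox--de Boor recursion: \<open>bspline t s j\<close> is the \<open>j\<close>-th B-spline (counted from 0) of degree \<open>s\<close> on the
  knots \<open>t\<close>.  Division by zero yields zero, which is the usual convention for repeated knots.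
  The half-open intervals make all B-splines right-continuous, so that identities such as knot
  insertion hold at every point, also if there are discontinuous B-splines.
\<close>

fun bspline :: "real list \<Rightarrow> nat \<Rightarrow> nat \<Rightarrow> real \<Rightarrow> real" where
  "bspline t 0 j x = (if t ! j \<le> x \<and> x < t ! (j + 1) then 1 else 0)"
| "bspline t (Suc s) j x =
     (x - t ! j) / (t ! (j + s + 1) - t ! j) * bspline t s j x +
     (t ! (j + s + 2) - x) / (t ! (j + s + 2) - t ! (j + 1)) * bspline t s (j + 1) x"

definition tp_bsplines ::
  "('n::finite \<Rightarrow> nat) \<Rightarrow> ('n \<Rightarrow> nat) \<Rightarrow> ('n \<Rightarrow> real list) \<Rightarrow> (real ^ 'n \<Rightarrow> real) set" where
  "tp_bsplines s m xs =
     {(\<lambda>x. \<Prod>i\<in>UNIV. bspline (knots (s i) (m i) (xs i)) (s i) (j i) (x $ i)) | j :: 'n \<Rightarrow> nat.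
        \<forall>i. j i < length (knots (s i) (m i) (xs i)) - (s i + 1)}"

text \<open>Supports are open: the interior of the usual closed support.\<close>

definition open_supp :: "('a::topological_space \<Rightarrow> real) \<Rightarrow> 'a set" where
  "open_supp f = interior (closure {x. f x \<noteq> 0})"

definition bsplines_in ::
  "('n::finite \<Rightarrow> nat) \<Rightarrow> ('n \<Rightarrow> nat) \<Rightarrow> ('n \<Rightarrow> real list) \<Rightarrow> (real ^ 'n) set \<Rightarrow>
     (real ^ 'n \<Rightarrow> real) set" where
  "bsplines_in s m xs D = {B \<in> tp_bsplines s m xs. open_supp B \<subseteq> D}"

text \<open>
  In \<open>trunc\<close>, the description is unique because the B-splines of one
  level are linearly independent; it is only applied to functions in their span.
\<close>

definition lin_comb :: "('a \<Rightarrow> real) set \<Rightarrow> (('a \<Rightarrow> real) \<Rightarrow> real) \<Rightarrow> 'a \<Rightarrow> real" where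
  "lin_comb S c = (\<lambda>x. \<Sum>B\<in>S. c B * B x)"

definition trunc ::
  "('n::finite \<Rightarrow> nat) \<Rightarrow> ('n \<Rightarrow> nat) \<Rightarrow> ('n \<Rightarrow> real list) \<Rightarrow> (real ^ 'n) set \<Rightarrow>
     (real ^ 'n \<Rightarrow> real) \<Rightarrow> real ^ 'n \<Rightarrow> real" where
  "trunc s m xs D f =
     (THE g. \<exists>\<tau>. f = lin_comb (tp_bsplines s m xs) \<tau> \<and>
                 g = lin_comb (tp_bsplines s m xs - bsplines_in s m xs D) \<tau>)"

fun thb_basis ::
  "('n::finite \<Rightarrow> nat) \<Rightarrow> ('n \<Rightarrow> nat) \<Rightarrow> (nat \<Rightarrow> 'n \<Rightarrow> real list) \<Rightarrow> (nat \<Rightarrow> (real ^ 'n) set) \<Rightarrow> nat \<Rightarrow>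
     (real ^ 'n \<Rightarrow> real) set" where
  "thb_basis s m \<xi> \<Psi> 0 = {}"
| "thb_basis s m \<xi> \<Psi> (Suc 0) = tp_bsplines s m (\<xi> 1)"
| "thb_basis s m \<xi> \<Psi> (Suc (Suc l)) =
     {trunc s m (\<xi> (l + 2)) (\<Psi> (l + 2)) T | T.
        T \<in> thb_basis s m \<xi> \<Psi> (Suc l) \<and> \<not> open_supp T \<subseteq> \<Psi> (l + 2)}
     \<union> bsplines_in s m (\<xi> (l + 2)) (\<Psi> (l + 2))"

definition thb_space ::
  "nat \<Rightarrow> ('n::finite \<Rightarrow> nat) \<Rightarrow> ('n \<Rightarrow> nat) \<Rightarrow> (nat \<Rightarrow> 'n \<Rightarrow> real list) \<Rightarrow> (nat \<Rightarrow> (real ^ 'n) set) \<Rightarrow>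
     (real ^ 'n \<Rightarrow> real) set" where
  "thb_space L s m \<xi> \<Psi> = range (lin_comb (thb_basis s m \<xi> \<Psi> L))"

text \<open>
  The form \<open>\<Sum>I. f\<^sub>I dx\<^sup>I\<close> is the family \<open>I \<mapsto> f\<^sub>I\<close>, where \<open>dx\<^sup>I\<close> is the wedge product of the
  \<open>dx\<^sup>i\<close>, \<open>i \<in> I\<close>, in increasing order.  A \<open>k\<close>-form has \<open>f\<^sub>I = 0\<close> unless \<open>card I = k\<close>.
\<close>

type_synonym 'n form = "'n set \<Rightarrow> real ^ 'n \<Rightarrow> real"

definition thb_forms ::
  "nat \<Rightarrow> ('n::finite \<Rightarrow> nat) \<Rightarrow> ('n \<Rightarrow> nat) \<Rightarrow> (nat \<Rightarrow> 'n \<Rightarrow> real list) \<Rightarrow> (nat \<Rightarrow> (real ^ 'n) set) \<Rightarrow>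
     nat \<Rightarrow> 'n form set" where
  "thb_forms L p m \<xi> \<Psi> k =
     {\<omega>. (\<forall>I. card I = k \<longrightarrow> \<omega> I \<in> thb_space L (\<lambda>i. p i - (if i \<in> I then 1 else 0)) m \<xi> \<Psi>) \<and>
         (\<forall>I. card I \<noteq> k \<longrightarrow> \<omega> I = (\<lambda>x. 0))}"

definition partial_deriv :: "'n::finite \<Rightarrow> (real ^ 'n \<Rightarrow> real) \<Rightarrow> real ^ 'n \<Rightarrow> real" where
  "partial_deriv i f x = deriv (\<lambda>t. f (x + t *\<^sub>R axis i 1)) 0"

definition ext_deriv :: "'n::{finite,linorder} form \<Rightarrow> 'n form" where
  "ext_deriv \<omega> = (\<lambda>J x. \<Sum>i\<in>J. (-1) ^ card {j\<in>J. j < i} * partial_deriv i (\<omega> (J - {i})) x)"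

text \<open>
  Splines are piecewise polynomial, possibly only continuous or even discontinuous across mesh
  faces, so derivatives exist and forms are compared almost everywhere in \<open>\<Omega>\<close>: a form is identified
  with its class.  Since \<open>m i \<le> p i\<close>, the coefficient \<open>f\<^sub>I\<close> of a THB-spline form is continuous in
  every direction \<open>i \<notin> I\<close>, and these are the only directions in which it is differentiated;
  hence the pointwise a.e. derivative represents the weak one.
\<close>

definition ae_class :: "'n::finite form \<Rightarrow> 'n form set" where
  "ae_class \<omega> = {\<eta>. \<forall>I. AE x in lebesgue. x \<in> box 0 1 \<longrightarrow> \<eta> I x = \<omega> I x}"

definition image_d :: "'n::{finite,linorder} form set \<Rightarrow> 'n form set set" where
  "image_d V = (\<lambda>\<sigma>. ae_class (ext_deriv \<sigma>)) ` V"

definition kernel_d :: "'n::{finite,linorder} form set \<Rightarrow> 'n form set set" where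
  "kernel_d V = ae_class ` {\<omega> \<in> V. ae_class (ext_deriv \<omega>) = ae_class (\<lambda>I x. 0)}"

end

theory Submission
  imports Defs
begin

text \<open>
  By local linear independence, \<open>\<T>\<^sub>L\<close> spans the sum over the levels \<open>l\<close> of the spaces of splines of
  level \<open>l\<close> that vanish outside \<open>\<Omega>\<^sub>l\<close>.  Exactness is proved by induction on the number of
  levels: if \<open>a + w\<close> is closed, with \<open>a\<close> in the hierarchical space up to level \<open>l\<close> and \<open>w\<close> of level
  \<open>l + 1\<close> vanishing outside \<open>\<Omega>\<^bsub>l+1\<^esub>\<close>, then \<open>dw = - da\<close> is of level \<open>l\<close>, and it suffices to write
  \<open>w = v + d\<beta>\<close> with \<open>v\<close> of level \<open>l\<close> and \<open>v\<close>, \<open>\<beta>\<close> vanishing outside \<open>\<Omega>\<^bsub>l+1\<^esub>\<close>.  This is done one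
  direction at a time with a univariate homotopy \<open>K\<close>, the primitive of \<open>M - \<phi>\<close> for every normalized
  fine B-spline \<open>M\<close> of degree \<open>p - 1\<close>, where \<open>\<phi>\<close> is a normalized coarse B-spline of degree \<open>p - 1\<close>
  in a macro interval of \<open>p + 1\<close> coarse intervals met by the support of \<open>M\<close>.  Then \<open>M - dKM\<close> is
  coarse, and \<open>K\<close> does not leave unions of macro intervals.  No commuting projection is needed.
\<close>

section \<open>Linear spans of real functions\<close>

text \<open>A primitive of a fine B-spline alone would run on to the right end of the unit interval
  and leave the refined domain; subtracting a coarse B-spline of equal integral makes the primitive
  stop where both supports stop. A coarse B-spline of degree \<open>p - 1\<close> spans at most
  \<open>p\<close> intervals, so every macro interval contains one, and coordinate lines meet the
  refined domain in unions of macro intervals. Making one direction coarse must not spoil the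
  others. The homotopy formula yields, besides \<open>f - D K f\<close> and
  \<open>f - K D f\<close>, a term \<open>K (dw)\<close>. It is harmless because \<open>dw\<close>
  is coarse in all directions at once and \<open>K\<close> maps coarse splines to coarse ones, a
  fine spline with coarse derivative being coarse up to a constant. The induction starts from an
  artificial level of constants whose forms of positive degree vanish, so that the complex of a
  single level is also obtained by a two-level step. B-splines are right-continuous and derivatives
  are taken from the right, so identities hold at every point and classes almost everywhere enter
  only in the final translation.\<close>

inductive_set lspan :: "('a \<Rightarrow> real) set \<Rightarrow> ('a \<Rightarrow> real) set" for S where
  zero: "(\<lambda>x. 0) \<in> lspan S"
| step: "f \<in> S \<Longrightarrow> g \<in> lspan S \<Longrightarrow> (\<lambda>x. c * f x + g x) \<in> lspan S"

definition lin_space :: "('a \<Rightarrow> real) set \<Rightarrow> bool" where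
  "lin_space V \<longleftrightarrow> (\<lambda>x. 0) \<in> V \<and> (\<forall>f\<in>V. \<forall>g\<in>V. (\<lambda>x. f x + g x) \<in> V) \<and>
     (\<forall>c. \<forall>f\<in>V. (\<lambda>x. c * f x) \<in> V)"

lemma lin_space_zero: "lin_space V \<Longrightarrow> (\<lambda>x. 0) \<in> V"
  and lin_space_add: "lin_space V \<Longrightarrow> f \<in> V \<Longrightarrow> g \<in> V \<Longrightarrow> (\<lambda>x. f x + g x) \<in> V"
  and lin_space_scale: "lin_space V \<Longrightarrow> f \<in> V \<Longrightarrow> (\<lambda>x. c * f x) \<in> V"
  by (auto simp: lin_space_def)

lemma lin_space_diff: "lin_space V \<Longrightarrow> f \<in> V \<Longrightarrow> g \<in> V \<Longrightarrow> (\<lambda>x. f x - g x) \<in> V"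
  using lin_space_add[of V f "\<lambda>x. (-1) * g x"] lin_space_scale[of V g "-1"] by simp

lemma lin_space_sum:
  assumes "lin_space V" "\<And>i. i \<in> A \<Longrightarrow> f i \<in> V"
  shows "(\<lambda>x. \<Sum>i\<in>A. f i x) \<in> V"
proof (cases "finite A")
  case True
  then show ?thesis using assms(2)
    by (induction A) (auto intro: lin_space_zero lin_space_add assms(1))
qed (simp add: lin_space_zero assms(1))

lemma lin_space_lspan: "lin_space (lspan S)"
proof -
  have add: "(\<lambda>x. f x + g x) \<in> lspan S" if "f \<in> lspan S" "g \<in> lspan S" for f g
    using that
  proof (induction f)
    case (step f h c)
    then show ?case using lspan.step[of f S "\<lambda>x. h x + g x" c] by (simp add: add.assoc)
  qed simp
  have "(\<lambda>x. c * f x) \<in> lspan S" if "f \<in> lspan S" for c f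
    using that
  proof (induction f)
    case (step f h d)
    then show ?case using lspan.step[of f S "\<lambda>x. c * h x" "c * d"] by (simp add: algebra_simps)
  qed (simp add: lspan.zero)
  then show ?thesis using add by (auto simp: lin_space_def lspan.zero)
qed

lemma lspan_base: "f \<in> S \<Longrightarrow> f \<in> lspan S"
  using lspan.step[OF _ lspan.zero, of f S 1] by simp

lemma lspan_minimal:
  assumes "lin_space V" "S \<subseteq> V"
  shows "lspan S \<subseteq> V"
proof
  fix f assume "f \<in> lspan S"
  then show "f \<in> V"
    by induction (use assms in \<open>auto intro!: lin_space_add lin_space_scale lin_space_zero\<close>)
qed

lemma lspan_subset: "S \<subseteq> lspan T \<Longrightarrow> lspan S \<subseteq> lspan T"
  by (rule lspan_minimal[OF lin_space_lspan])

lemma lin_comb_in_lspan: "lin_comb S c \<in> lspan S"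
  unfolding lin_comb_def
  by (intro lin_space_sum lin_space_scale lin_space_lspan) (rule lspan_base)

text \<open>Connects the inductive span, which supports induction over generators, with
  \<open>lin_comb\<close>, by which the spline spaces are defined. On an infinite set the sum in
  \<open>lin_comb\<close> would be 0.\<close>

lemma lspan_eq_lin_comb:
  assumes "finite S"
  shows "lspan S = range (lin_comb S)"
proof
  show "lspan S \<subseteq> range (lin_comb S)"
  proof
    fix f assume "f \<in> lspan S"
    then show "f \<in> range (lin_comb S)"
    proof induction
      case zero
      have "(\<lambda>x. 0) = lin_comb S (\<lambda>_. 0)" by (simp add: lin_comb_def)
      then show ?case by blast
    next
      case (step f g c)
      then obtain d where d: "g = lin_comb S d" by blast
      have "(\<lambda>x. c * f x + g x) = lin_comb S (d(f := d f + c))"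
        unfolding d lin_comb_def using \<open>finite S\<close> \<open>f \<in> S\<close>
        by (simp add: sum.remove[of S f] algebra_simps)
      then show ?case by blast
    qed
  qed
qed (use lin_comb_in_lspan in blast)

text \<open>Coefficients are indexed by position and not by function, so \<open>b\<close> need not
  be known to be injective.\<close>

lemma lspan_range_lessThan:
  fixes b :: "nat \<Rightarrow> 'a \<Rightarrow> real"
  assumes "\<And>j x. N \<le> j \<Longrightarrow> b j x = 0" and "f \<in> lspan (range b)"
  obtains c where "f = (\<lambda>x. \<Sum>j<N. c j * b j x)"
proof -
  have "\<exists>c. f = (\<lambda>x. \<Sum>j<N. c j * b j x)"
    using assms(2)
  proof induction
    case zero
    show ?case by (rule exI[of _ "\<lambda>_. 0"]) simp
  next
    case (step f g a)
    then obtain c j where c: "g = (\<lambda>x. \<Sum>j<N. c j * b j x)" and j: "f = b j" by blast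
    show ?case
    proof (cases "j < N")
      case True
      have "(\<lambda>x. a * f x + g x) = (\<lambda>x. \<Sum>i<N. (c(j := c j + a)) i * b i x)"
        unfolding c j using True by (simp add: sum.remove[of "{..<N}" j] algebra_simps)
      then show ?thesis by blast
    next
      case False
      then show ?thesis using c assms(1) j by auto
    qed
  qed
  then show ?thesis using that by blast
qed

section \<open>B-splines on a monotone knot sequence\<close>

text \<open>
  \<open>nbsp t s j\<close> has integral \<open>1 / (s + 1)\<close>; it vanishes when the knots
  \<open>t j, \<dots>, t (j + s + 1)\<close> coincide, because of \<open>x / 0 = 0\<close>.
\<close>

fun bsp :: "(nat \<Rightarrow> real) \<Rightarrow> nat \<Rightarrow> nat \<Rightarrow> real \<Rightarrow> real" where
  "bsp t 0 j x = (if t j \<le> x \<and> x < t (j + 1) then 1 else 0)"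
| "bsp t (Suc s) j x =
     (x - t j) * (bsp t s j x / (t (j + s + 1) - t j)) +
     (t (j + s + 2) - x) * (bsp t s (j + 1) x / (t (j + s + 2) - t (j + 1)))"

definition nbsp :: "(nat \<Rightarrow> real) \<Rightarrow> nat \<Rightarrow> nat \<Rightarrow> real \<Rightarrow> real" where
  "nbsp t s j x = bsp t s j x / (t (j + s + 1) - t j)"

lemma bsp_Suc:
  "bsp t (Suc s) j x = (x - t j) * nbsp t s j x + (t (j + s + 2) - x) * nbsp t s (Suc j) x"
  by (simp add: nbsp_def)

lemma bsp_nonzeroD:
  assumes "mono t" "bsp t s j x \<noteq> 0"
  shows "t j \<le> x" "x < t (j + s + 1)"
proof -
  have "t j \<le> x \<and> x < t (j + s + 1)" using assms(2)
  proof (induction s arbitrary: j)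
    case 0
    then show ?case by (auto split: if_splits)
  next
    case (Suc s)
    then have "bsp t s j x \<noteq> 0 \<or> bsp t s (Suc j) x \<noteq> 0" by auto
    then have "(t j \<le> x \<and> x < t (j + s + 1)) \<or> (t (Suc j) \<le> x \<and> x < t (Suc j + s + 1))"
      using Suc.IH by blast
    then show ?case
      using monoD[OF assms(1), of j "Suc j"] monoD[OF assms(1), of "j + s + 1" "j + Suc s + 1"]
      by auto
  qed
  then show "t j \<le> x" "x < t (j + s + 1)" by auto
qed

lemma bsp_degenerate:
  assumes "mono t" "t (j + s + 1) \<le> t j"
  shows "bsp t s j x = 0"
  using bsp_nonzeroD[OF assms(1), of s j x] assms(2) by force

lemma bsp_eq_nbsp:
  assumes "mono t"
  shows "bsp t s j x = (t (j + s + 1) - t j) * nbsp t s j x"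
  using bsp_degenerate[OF assms, of j s x] by (cases "t (j + s + 1) = t j") (auto simp: nbsp_def)

lemma nbsp_degenerate: "mono t \<Longrightarrow> t (j + s + 1) \<le> t j \<Longrightarrow> nbsp t s j x = 0"
  by (simp add: nbsp_def bsp_degenerate)

lemma nbsp_nonzeroD:
  assumes "mono t" "nbsp t s j x \<noteq> 0"
  shows "t j \<le> x" "x < t (j + s + 1)"
  using bsp_nonzeroD[OF assms(1), of s j x] assms(2) by (auto simp: nbsp_def)

lemma bspline_eq_bsp:
  "(\<And>i. i \<le> j + s + 1 \<Longrightarrow> ts ! i = t i) \<Longrightarrow> bspline ts s j x = bsp t s j x"
proof (induction s arbitrary: j)
  case (Suc s)
  have "bspline ts s j x = bsp t s j x" "bspline ts s (j + 1) x = bsp t s (j + 1) x"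
    using Suc.prems by (auto intro!: Suc.IH)
  then show ?case using Suc.prems by simp
qed simp

text \<open>The classical difference formula for the derivative of a B-spline, used as a definition
  at every point, knots included.\<close>

fun bsp_deriv :: "(nat \<Rightarrow> real) \<Rightarrow> nat \<Rightarrow> nat \<Rightarrow> real \<Rightarrow> real" where
  "bsp_deriv t 0 j x = 0"
| "bsp_deriv t (Suc s) j x = real (Suc s) * (nbsp t s j x - nbsp t s (Suc j) x)"

text \<open>The right-hand side is what the product rule makes of the Cox--de Boor recursion. Both
  middle terms contain the same lower-degree B-spline, which cancels; if a knot difference in a
  denominator is 0, the B-splines over it are 0 as well.\<close>

lemma bsp_deriv_step:
  assumes "mono t"
  shows "bsp_deriv t (Suc s) j x =
    nbsp t s j x + (x - t j) * (bsp_deriv t s j x / (t (j + s + 1) - t j)) -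
    nbsp t s (Suc j) x + (t (j + s + 2) - x) * (bsp_deriv t s (Suc j) x / (t (j + s + 2) - t (Suc j)))"
proof (cases s)
  case (Suc r)
  define a where "a = t (j + r + 2) - t j"
  define b where "b = t (j + r + 3) - t (Suc j)"
  define e where "e = t (j + r + 2) - t (Suc j)"
  define P where "P = nbsp t r j x"
  define Q where "Q = nbsp t r (Suc j) x"
  define R where "R = nbsp t r (Suc (Suc j)) x"
  have *: "t j \<le> t (Suc j)" "t (Suc j) \<le> t (j + r + 2)" "t (j + r + 2) \<le> t (j + r + 3)"
    by (rule monoD[OF assms]; simp)+
  have Ns: "nbsp t s j x = ((x - t j) * P + (t (j + r + 2) - x) * Q) / a"
    "nbsp t s (Suc j) x = ((x - t (Suc j)) * Q + (t (j + r + 3) - x) * R) / b"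
    unfolding Suc by (simp_all add: nbsp_def P_def Q_def R_def a_def b_def numeral_3_eq_3)
  have dd: "bsp_deriv t s j x = real s * (P - Q)" "bsp_deriv t s (Suc j) x = real s * (Q - R)"
    unfolding Suc by (simp_all add: P_def Q_def R_def)
  have P: "P = 0" if "a = 0"
    using that * unfolding P_def a_def by (intro nbsp_degenerate[OF assms])
      (use monoD[OF assms, of "j+r+1" "j+r+2"] in auto)
  have R: "R = 0" if "b = 0"
    using that * unfolding R_def b_def by (intro nbsp_degenerate[OF assms])
      (use monoD[OF assms, of "Suc j" "Suc (Suc j)"] in \<open>auto simp: numeral_3_eq_3\<close>)
  have Q: "Q = 0" if "a = 0 \<or> b = 0"
    unfolding Q_def by (intro nbsp_degenerate[OF assms]) (use that * in \<open>auto simp: a_def b_def\<close>)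
  have tt: "t (j + s + 1) - t j = a" "t (j + s + 2) - t (Suc j) = b" "t (j + s + 2) = t (j + r + 3)"
    by (simp_all add: Suc a_def b_def numeral_3_eq_3)
  \<comment> \<open>The term \<open>real s * Q\<close> occurs in both \<open>A\<close> and
    \<open>B\<close> and cancels in their difference.\<close>
  have A: "real s * nbsp t s j x = (x - t j) * (bsp_deriv t s j x / a) + real s * Q"
    using P Q unfolding Ns dd by (cases "a = 0") (auto simp: field_simps a_def)
  have B: "real s * nbsp t s (Suc j) x =
      real s * Q - (t (j + r + 3) - x) * (bsp_deriv t s (Suc j) x / b)"
    using R Q unfolding Ns dd by (cases "b = 0") (auto simp: field_simps b_def)
  have "bsp_deriv t (Suc s) j x = nbsp t s j x + real s * nbsp t s j x
      - nbsp t s (Suc j) x - real s * nbsp t s (Suc j) x"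
    by (simp add: algebra_simps)
  then show ?thesis unfolding tt(1,2) A B unfolding tt(3) by (simp add: algebra_simps)
qed (simp add: nbsp_def)

text \<open>Only degree 0 needs analysis; higher degrees follow by the product rule. Leaving
  \<open>S\<close> open gives right derivatives at every point and two-sided derivatives off the
  knots from one induction.\<close>

lemma bsp_has_derivative:
  assumes "mono t"
    and const: "\<And>j. eventually (\<lambda>y. bsp t 0 j y = bsp t 0 j x) (at x within S)"
  shows "(bsp t s j has_real_derivative bsp_deriv t s j x) (at x within S)"
proof (induction s arbitrary: j)
  case 0
  have "((\<lambda>_. bsp t 0 j x) has_real_derivative 0) (at x within S)" by simp
  then show ?case
    using DERIV_cong_ev const[of j]
    by (subst has_field_derivative_cong_eventually[where g = "\<lambda>_. bsp t 0 j x"]) auto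
next
  case (Suc s)
  have 1: "((\<lambda>x. x - t j) has_real_derivative 1) (at x within S)"
    and 2: "((\<lambda>x. t (j + s + 2) - x) has_real_derivative - 1) (at x within S)"
    by (auto intro!: derivative_eq_intros)
  show ?case
    unfolding bsp.simps(2) bsp_deriv_step[OF assms(1)] nbsp_def
    by (rule DERIV_cong[OF DERIV_add[OF DERIV_mult[OF 1 DERIV_cdivide[OF Suc.IH]]
          DERIV_mult[OF 2 DERIV_cdivide[OF Suc.IH]]]]) (simp add: mult.commute)
qed

lemma bsp_0_locally_const_right: "eventually (\<lambda>y. bsp t 0 j y = bsp t 0 j x) (at_right x)"
proof -
  have "eventually (\<lambda>y. y < (if x < t (j + 1) then (if x < t j then t j else t (j + 1)) else x + 1)) (at_right x)"
    by (rule order_tendstoD[OF tendsto_ident_at]) auto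
  moreover have "eventually (\<lambda>y. x < y) (at_right x)" by (simp add: eventually_at_right_less)
  ultimately show ?thesis by eventually_elim (auto split: if_splits)
qed

lemma bsp_0_locally_const:
  assumes "x \<notin> range t"
  shows "eventually (\<lambda>y. bsp t 0 j y = bsp t 0 j x) (at x)"
proof -
  have ev: "eventually (\<lambda>y. y < c \<longleftrightarrow> x < c) (at x)" if "x \<noteq> c" for c
  proof (cases "x < c")
    case True
    then show ?thesis
      by (auto intro: eventually_mono[OF order_tendstoD(2)[OF tendsto_ident_at[of x UNIV]]])
  next
    case False
    then have "c < x" using that by simp
    then show ?thesis
      by (auto intro: eventually_mono[OF order_tendstoD(1)[OF tendsto_ident_at[of x UNIV]]])
  qed
  have "x \<noteq> t j" "x \<noteq> t (j + 1)" using assms by auto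
  then have "eventually (\<lambda>y. y < t j \<longleftrightarrow> x < t j) (at x)"
    "eventually (\<lambda>y. y < t (j + 1) \<longleftrightarrow> x < t (j + 1)) (at x)" by (auto intro: ev)
  then show ?thesis by eventually_elim (auto simp: not_less)
qed

lemma bsp_deriv_right: "mono t \<Longrightarrow> (bsp t s j has_real_derivative bsp_deriv t s j x) (at_right x)"
  by (rule bsp_has_derivative[OF _ bsp_0_locally_const_right])

lemma bsp_deriv_at:
  "mono t \<Longrightarrow> x \<notin> range t \<Longrightarrow> (bsp t s j has_real_derivative bsp_deriv t s j x) (at x)"
  by (rule bsp_has_derivative[OF _ bsp_0_locally_const])

text \<open>Raising the degree redistributes each B-spline onto two neighbours with weights adding
  up to 1; the two boundary terms lost in the index shift vanish at \<open>x\<close>.\<close>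

lemma bsp_partition_of_unity:
  assumes "mono t" "t \<mu> \<le> x" "x < t (Suc \<mu>)" "s \<le> \<mu>"
  shows "(\<Sum>j\<le>\<mu>. bsp t s j x) = 1"
  using \<open>s \<le> \<mu>\<close>
proof (induction s)
  case 0
  have "bsp t 0 j x = of_bool (j = \<mu>)" if "j \<le> \<mu>" for j
    using assms monoD[OF \<open>mono t\<close>, of "j + 1" \<mu>] that by (cases "j = \<mu>") auto
  then show ?case by simp
next
  case (Suc s)
  \<comment> \<open>The two halves of \<open>bsp t s j\<close>: in the recursion \<open>a j\<close>
    goes to the B-spline of index \<open>j\<close> and \<open>b j\<close> to that of index
    \<open>j - 1\<close>.\<close>
  define a where "a j = (x - t j) * nbsp t s j x" for j
  define b where "b j = (t (j + s + 1) - x) * nbsp t s j x" for j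
  have ab: "a j + b j = bsp t s j x" for j
    unfolding a_def b_def bsp_eq_nbsp[OF assms(1)] by (simp add: algebra_simps)
  have 0: "nbsp t s 0 x = 0"
    using nbsp_nonzeroD(2)[OF assms(1), of s 0 x] monoD[OF \<open>mono t\<close>, of "0 + s + 1" \<mu>] assms Suc.prems
    by force
  have 1: "nbsp t s (Suc \<mu>) x = 0"
    using nbsp_nonzeroD(1)[OF assms(1), of s "Suc \<mu>" x] assms by force
  have "(\<Sum>j\<le>\<mu>. bsp t (Suc s) j x) = (\<Sum>j\<le>\<mu>. a j) + (\<Sum>j\<le>\<mu>. b (Suc j))"
    unfolding bsp_Suc a_def b_def by (simp add: sum.distrib)
  also have "(\<Sum>j\<le>\<mu>. b (Suc j)) = (\<Sum>j\<le>\<mu>. b j)"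
    using sum.atMost_Suc_shift[of b \<mu>] 0 1 by (simp add: b_def)
  finally show ?case using Suc.IH Suc.prems by (simp add: ab flip: sum.distrib)
qed

section \<open>Local linear independence\<close>

text \<open>Functionals that are finite combinations of point evaluations in \<open>X\<close>. They
  are defined and linear on all functions and see only the values on \<open>X\<close>, so locality
  of a dual functional is built into its type of construction.\<close>

definition evals :: "'a set \<Rightarrow> (('a \<Rightarrow> real) \<Rightarrow> real) set" where
  "evals X = lspan ((\<lambda>x f. f x) ` X)"

lemma evals_explicit:
  assumes "\<phi> \<in> evals X"
  obtains Y w where "finite Y" "Y \<subseteq> X" "\<And>f. \<phi> f = (\<Sum>y\<in>Y. w y * f y)"
proof -
  have "\<exists>Y w. finite Y \<and> Y \<subseteq> X \<and> (\<forall>f. \<phi> f = (\<Sum>y\<in>Y. w y * f y))"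
    using assms unfolding evals_def
  proof induction
    case zero
    show ?case by (rule exI[of _ "{}"]) simp
  next
    case (step e \<phi> c)
    then obtain Y w x where *: "finite Y" "Y \<subseteq> X" "\<forall>f. \<phi> f = (\<Sum>y\<in>Y. w y * f y)"
      "x \<in> X" "e = (\<lambda>f. f x)" by blast
    define w' where "w' y = (if y \<in> Y then w y else 0) + (if y = x then c else 0)" for y
    have "c * e f + \<phi> f = (\<Sum>y\<in>insert x Y. w' y * f y)" for f
    proof (cases "x \<in> Y")
      case True
      then show ?thesis using * by (simp add: insert_absorb w'_def sum.remove[of Y x] algebra_simps)
    next
      case False
      have "(\<Sum>y\<in>Y. w' y * f y) = (\<Sum>y\<in>Y. w y * f y)"
        using False by (intro sum.cong) (auto simp: w'_def)
      then show ?thesis using * False by (simp add: w'_def)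
    qed
    moreover have "insert x Y \<subseteq> X" "finite (insert x Y)" using * by auto
    ultimately show ?case by blast
  qed
  then show ?thesis using that by blast
qed

lemma evals_add: "\<phi> \<in> evals X \<Longrightarrow> \<phi> (\<lambda>x. f x + g x) = \<phi> f + \<phi> g"
  by (erule evals_explicit) (simp add: algebra_simps sum.distrib)

lemma evals_scale: "\<phi> \<in> evals X \<Longrightarrow> \<phi> (\<lambda>x. c * f x) = c * \<phi> f"
  by (erule evals_explicit) (simp add: algebra_simps sum_distrib_left)

lemma evals_sum:
  assumes "\<phi> \<in> evals X"
  shows "\<phi> (\<lambda>x. \<Sum>i\<in>A. c i * f i x) = (\<Sum>i\<in>A. c i * \<phi> (f i))"
proof -
  obtain Y w where "finite Y" "Y \<subseteq> X" "\<And>f. \<phi> f = (\<Sum>y\<in>Y. w y * f y)"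
    by (rule evals_explicit[OF assms]) blast
  then show ?thesis
    by (simp add: sum_distrib_left sum.swap[of _ A] algebra_simps)
qed

lemma evals_zero: "\<phi> \<in> evals X \<Longrightarrow> (\<And>x. x \<in> X \<Longrightarrow> f x = 0) \<Longrightarrow> \<phi> f = 0"
  by (erule evals_explicit) (auto intro!: sum.neutral)

lemma evals_mono: "X \<subseteq> Y \<Longrightarrow> evals X \<subseteq> evals Y"
  unfolding evals_def by (intro lspan_subset) (auto intro: lspan_base)

text \<open>Biorthogonalization: independence on \<open>X\<close> means that some point of
  \<open>X\<close> distinguishes a new function from its interpolant by the old ones, and evaluation
  there supplies the new functional.\<close>

lemma dual_evals:
  fixes b :: "'i \<Rightarrow> 'a \<Rightarrow> real"
  assumes "finite I"
    and "\<And>c. (\<And>x. x \<in> X \<Longrightarrow> (\<Sum>i\<in>I. c i * b i x) = 0) \<Longrightarrow> \<forall>i\<in>I. c i = 0"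
  shows "\<forall>j\<in>I. \<exists>\<phi>\<in>evals X. \<forall>i\<in>I. \<phi> (b i) = of_bool (i = j)"
  using assms
proof (induction I)
  case (insert k I)
  have "\<forall>i\<in>I. c i = 0" if "\<And>x. x \<in> X \<Longrightarrow> (\<Sum>i\<in>I. c i * b i x) = 0" for c
  proof -
    have "(\<Sum>i\<in>insert k I. (c(k := 0)) i * b i x) = (\<Sum>i\<in>I. c i * b i x)" for x
      using insert.hyps by (auto intro!: sum.cong)
    then have "\<forall>i\<in>insert k I. (c(k := 0)) i = 0"
      using that by (intro insert.prems) auto
    then show ?thesis using insert.hyps by (auto split: if_splits)
  qed
  then have "\<forall>j\<in>I. \<exists>\<phi>\<in>evals X. \<forall>i\<in>I. \<phi> (b i) = of_bool (i = j)"
    using insert.IH by blast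
  then obtain \<phi> where \<phi>: "\<And>j. j \<in> I \<Longrightarrow> \<phi> j \<in> evals X"
    "\<And>i j. i \<in> I \<Longrightarrow> j \<in> I \<Longrightarrow> \<phi> j (b i) = of_bool (i = j)" by metis
  \<comment> \<open>What is left of \<open>b k\<close> after subtracting the combination of the old
    functions on which all old dual functionals agree with \<open>b k\<close>.\<close>
  define r where "r x = b k x - (\<Sum>i\<in>I. \<phi> i (b k) * b i x)" for x
  have "\<exists>x\<in>X. r x \<noteq> 0"
  proof (rule ccontr)
    assume *: "\<not> (\<exists>x\<in>X. r x \<noteq> 0)"
    define c where "c i = (if i = k then 1 else - \<phi> i (b k))" for i
    have "(\<Sum>i\<in>insert k I. c i * b i x) = r x" for x
    proof -
      have "(\<Sum>i\<in>I. c i * b i x) = (\<Sum>i\<in>I. - (\<phi> i (b k) * b i x))"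
        using insert.hyps by (intro sum.cong) (auto simp: c_def)
      then show ?thesis using insert.hyps by (simp add: c_def r_def sum_negf)
    qed
    then have "\<forall>i\<in>insert k I. c i = 0" using * by (intro insert.prems) auto
    then show False by (simp add: c_def)
  qed
  then obtain x where x: "x \<in> X" "r x \<noteq> 0" by blast
  \<comment> \<open>Evaluation at \<open>x\<close>, corrected so as to annihilate the old functions
    and scaled to be 1 on \<open>b k\<close>.\<close>
  define \<psi> where "\<psi> f = (f x - (\<Sum>i\<in>I. b i x * \<phi> i f)) / r x" for f
  have ls: "lin_space (evals X)" unfolding evals_def by (rule lin_space_lspan)
  have "(\<lambda>f. f x) \<in> evals X" unfolding evals_def using x by (intro lspan_base) blast
  then have "(\<lambda>f. (1 / r x) * (f x - (\<Sum>i\<in>I. b i x * \<phi> i f))) \<in> evals X"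
    by (intro lin_space_scale[OF ls] lin_space_diff[OF ls] lin_space_sum[OF ls] \<phi>)
  then have \<psi>: "\<psi> \<in> evals X" by (simp add: \<psi>_def[abs_def])
  have \<psi>b: "\<psi> (b i) = of_bool (i = k)" if "i \<in> insert k I" for i
  proof (cases "i = k")
    case True
    then show ?thesis using x by (simp add: \<psi>_def r_def mult.commute)
  next
    case False
    then have "(\<Sum>j\<in>I. b j x * \<phi> j (b i)) = (\<Sum>j\<in>I. b j x * of_bool (i = j))"
      using that by (intro sum.cong) (auto simp: \<phi>)
    also have "\<dots> = b i x" using False that insert.hyps by simp
    finally show ?thesis using False by (simp add: \<psi>_def)
  qed
  show ?case
  proof
    fix j assume j: "j \<in> insert k I"
    show "\<exists>\<phi>\<in>evals X. \<forall>i\<in>insert k I. \<phi> (b i) = of_bool (i = j)"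
    proof (cases "j = k")
      case True
      then show ?thesis using \<psi> \<psi>b by blast
    next
      case False
      \<comment> \<open>The old functional is corrected by \<open>\<psi>\<close> so that it
        annihilates \<open>b k\<close> too.\<close>
      define \<phi>' where "\<phi>' f = \<phi> j f - \<phi> j (b k) * \<psi> f" for f
      have "\<phi>' \<in> evals X"
        unfolding \<phi>'_def[abs_def] using False j
        by (intro lin_space_diff[OF ls] lin_space_scale[OF ls] \<psi> \<phi>) auto
      moreover have "\<forall>i\<in>insert k I. \<phi>' (b i) = of_bool (i = j)"
        using False j \<psi>b insert.hyps by (auto simp: \<phi>'_def \<phi>)
      ultimately show ?thesis by blast
    qed
  qed
qed simp

lemma sum_diff_by_parts:
  fixes c N :: "nat \<Rightarrow> real"
  shows "(\<Sum>j\<le>n. c j * (N j - N (Suc j))) =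
    (\<Sum>j\<le>n. (c j - (if j = 0 then 0 else c (j - 1))) * N j) - c n * N (Suc n)"
  by (induction n) (simp_all add: algebra_simps)

text \<open>Differentiating a vanishing combination gives one of lower degree whose coefficients are
  scaled differences of neighbouring \<open>c j\<close>. By induction these differences vanish, so
  all coefficients active on the knot interval agree, and their common value is 0 by the partition
  of unity.\<close>

lemma bsp_independent:
  assumes "mono t" "s \<le> \<mu>" "t \<mu> \<le> a" "a < b" "b \<le> t (Suc \<mu>)"
    and "\<And>x. a < x \<Longrightarrow> x < b \<Longrightarrow> (\<Sum>j\<le>\<mu>. c j * bsp t s j x) = 0"
    and "\<mu> - s \<le> j" "j \<le> \<mu>"
  shows "c j = 0"
  using assms(2,6-)
proof (induction s arbitrary: c j)
  case 0
  define x where "x = (a + b) / 2"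
  have x: "a < x" "x < b" using assms by (auto simp: x_def)
  have "bsp t 0 j x = of_bool (j = \<mu>)" if "j \<le> \<mu>" for j
    using x assms monoD[OF \<open>mono t\<close>, of "j + 1" \<mu>] that by (cases "j = \<mu>") auto
  then have "(\<Sum>j\<le>\<mu>. c j * bsp t 0 j x) = (\<Sum>j\<le>\<mu>. c j * of_bool (j = \<mu>))"
    by (intro sum.cong) auto
  also have "\<dots> = c \<mu>" by simp
  finally show ?case using "0.prems" x by simp
next
  case (Suc s)
  define d where "d j = c j - (if j = 0 then 0 else c (j - 1))" for j
  define e where "e j = d j / (t (j + s + 1) - t j)" for j
  have e0: "(\<Sum>j\<le>\<mu>. e j * bsp t s j x) = 0" if x: "a < x" "x < b" for x
  proof -
    have "x \<notin> range t"
    proof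
      assume "x \<in> range t"
      then obtain i where i: "x = t i" by blast
      show False
        using monoD[OF \<open>mono t\<close>, of i \<mu>] monoD[OF \<open>mono t\<close>, of "Suc \<mu>" i] assms(3-5) x
        unfolding i by (cases "i \<le> \<mu>") auto
    qed
    then have "((\<lambda>x. \<Sum>j\<le>\<mu>. c j * bsp t (Suc s) j x) has_real_derivative
        (\<Sum>j\<le>\<mu>. c j * bsp_deriv t (Suc s) j x)) (at x)"
      by (intro DERIV_sum DERIV_cmult bsp_deriv_at assms)
    moreover have "((\<lambda>x. \<Sum>j\<le>\<mu>. c j * bsp t (Suc s) j x) has_real_derivative 0) (at x)"
      by (rule has_field_derivative_transform_within_open[of "\<lambda>_. 0" _ _ "{a<..<b}"])
        (use x Suc.prems in auto)
    ultimately have "(\<Sum>j\<le>\<mu>. c j * bsp_deriv t (Suc s) j x) = 0" by (rule DERIV_unique)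
    then have "real (Suc s) * (\<Sum>j\<le>\<mu>. c j * (nbsp t s j x - nbsp t s (Suc j) x)) = 0"
      by (simp add: sum_distrib_left mult_ac del: of_nat_Suc)
    then have "(\<Sum>j\<le>\<mu>. c j * (nbsp t s j x - nbsp t s (Suc j) x)) = 0" by auto
    moreover have "nbsp t s (Suc \<mu>) x = 0"
      using nbsp_nonzeroD(1)[OF assms(1), of s "Suc \<mu>" x] assms(5) x by force
    ultimately have "(\<Sum>j\<le>\<mu>. d j * nbsp t s j x) = 0"
      using sum_diff_by_parts[of c "\<lambda>j. nbsp t s j x" \<mu>] by (simp add: d_def)
    then show ?thesis by (simp add: e_def nbsp_def)
  qed
  have "e j = 0" if "\<mu> - s \<le> j" "j \<le> \<mu>" for j
    using Suc.IH[of e j] e0 that Suc.prems(1) by auto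
  moreover have "t j < t (j + s + 1)" if "\<mu> - s \<le> j" "j \<le> \<mu>" for j
  proof -
    have "t j \<le> t \<mu>" "t (Suc \<mu>) \<le> t (j + s + 1)" by (rule monoD[OF \<open>mono t\<close>]; use that in simp)+
    then show ?thesis using assms(3-5) by linarith
  qed
  ultimately have d0: "d j = 0" if "\<mu> - s \<le> j" "j \<le> \<mu>" for j
    using that unfolding e_def by (metis divide_eq_0_iff eq_iff_diff_eq_0 less_irrefl)
  have cstep: "c j = c (j - 1)" if "\<mu> - s \<le> j" "j \<le> \<mu>" for j
    using d0[OF that] that Suc.prems(1) by (simp add: d_def split: if_splits)
  have eq: "c j = c \<mu>" if "\<mu> - Suc s \<le> j" "j \<le> \<mu>" for j
    using that(2,1)
  proof (induction j rule: inc_induct)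
    case (step n)
    then show ?case using cstep[of "Suc n"] by auto
  qed simp
  define x where "x = (a + b) / 2"
  have x: "a < x" "x < b" using assms by (auto simp: x_def)
  have "c j * bsp t (Suc s) j x = c \<mu> * bsp t (Suc s) j x" if "j \<le> \<mu>" for j
  proof (cases "\<mu> - Suc s \<le> j")
    case False
    then have "bsp t (Suc s) j x = 0"
    proof -
      have "t (j + Suc s + 1) \<le> t \<mu>" by (rule monoD[OF \<open>mono t\<close>]) (use False in simp)
      then show ?thesis using bsp_nonzeroD(2)[OF assms(1), of "Suc s" j x] x assms(3) by linarith
    qed
    then show ?thesis by simp
  next
    case True
    then show ?thesis using eq[OF True that] by simp
  qed
  then have "(\<Sum>j\<le>\<mu>. c j * bsp t (Suc s) j x) = c \<mu> * (\<Sum>j\<le>\<mu>. bsp t (Suc s) j x)"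
    unfolding sum_distrib_left by (intro sum.cong) auto
  also have "(\<Sum>j\<le>\<mu>. bsp t (Suc s) j x) = 1"
    by (rule bsp_partition_of_unity) (use assms x Suc.prems in auto)
  finally have "c \<mu> = 0" using Suc.prems x by simp
  then show ?case using eq[OF Suc.prems(3,4)] by simp
qed

text \<open>The functional samples only just to the right of \<open>x\<close>, and \<open>x\<close>
  may be any point of the half-open support. B-splines inactive on the knot interval of
  \<open>x\<close> vanish at all sampled points, so duality holds against every index
  \<open>k\<close>.\<close>

lemma bsp_local_dual:
  assumes "mono t" "t s \<le> x" "t j \<le> x" "x < t (j + s + 1)" "0 < \<epsilon>"
  shows "\<exists>\<phi>\<in>evals {x<..<x + \<epsilon>}. \<forall>k. \<phi> (bsp t s k) = of_bool (k = j)"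
proof -
  \<comment> \<open>The knot interval from \<open>t \<mu>\<close> to \<open>t (Suc \<mu>)\<close>
    contains \<open>x\<close>. Searching up to \<open>j + s\<close> suffices because
    \<open>x < t (j + s + 1)\<close>; the hypothesis \<open>t s \<le> x\<close> gives
    \<open>s \<le> \<mu>\<close>, so that \<open>s + 1\<close> B-splines are active there.\<close>
  define \<mu> where "\<mu> = Max {i. i \<le> j + s \<and> t i \<le> x}"
  have fin: "finite {i. i \<le> j + s \<and> t i \<le> x}" by (rule finite_subset[of _ "{..j+s}"]) auto
  have "\<mu> \<in> {i. i \<le> j + s \<and> t i \<le> x}"
    unfolding \<mu>_def by (rule Max_in[OF fin]) (use assms in \<open>auto intro: exI[of _ j]\<close>)
  moreover have "j \<le> \<mu>" "s \<le> \<mu>"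
    unfolding \<mu>_def by (rule Max_ge[OF fin]; use assms in simp)+
  moreover have "x < t (Suc \<mu>)"
  proof (rule ccontr)
    assume *: "\<not> x < t (Suc \<mu>)"
    then have "Suc \<mu> \<le> j + s"
      using calculation(1) assms(4) by (cases "\<mu> = j + s") auto
    then have "Suc \<mu> \<le> \<mu>" using * unfolding \<mu>_def by (intro Max_ge[OF fin]) auto
    then show False by simp
  qed
  ultimately have \<mu>: "t \<mu> \<le> x" "x < t (Suc \<mu>)" "s \<le> \<mu>" "j \<le> \<mu>" "\<mu> \<le> j + s" by auto
  define b where "b = min (x + \<epsilon>) (t (Suc \<mu>))"
  have b: "x < b" using assms \<mu> by (simp add: b_def)
  have dual: "\<forall>j\<in>{\<mu>-s..\<mu>}. \<exists>\<phi>\<in>evals {x<..<b}. \<forall>i\<in>{\<mu>-s..\<mu>}. \<phi> (bsp t s i) = of_bool (i = j)"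
  proof (rule dual_evals)
    fix c assume *: "(\<Sum>i = \<mu>-s..\<mu>. c i * bsp t s i y) = 0" if "y \<in> {x<..<b}" for y
    show "\<forall>i\<in>{\<mu>-s..\<mu>}. c i = 0"
    proof
      fix i assume i: "i \<in> {\<mu>-s..\<mu>}"
      have "(if \<mu> - s \<le> i then c i else 0) = 0"
      proof (rule bsp_independent[where t = t and s = s and \<mu> = \<mu> and a = x and b = b])
        fix y assume y: "x < y" "y < b"
        have "(\<Sum>j\<le>\<mu>. (if \<mu> - s \<le> j then c j else 0) * bsp t s j y) = (\<Sum>i = \<mu>-s..\<mu>. c i * bsp t s i y)"
          by (rule sum.mono_neutral_cong_right) auto
        then show "(\<Sum>j\<le>\<mu>. (if \<mu> - s \<le> j then c j else 0) * bsp t s j y) = 0" using * y by simp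
      qed (use i \<mu> b assms in \<open>auto simp: b_def\<close>)
      then show "c i = 0" using i by simp
    qed
  qed simp
  have "j \<in> {\<mu>-s..\<mu>}" using \<mu> by auto
  then obtain \<phi> where \<phi>: "\<phi> \<in> evals {x<..<b}" "\<And>i. i \<in> {\<mu>-s..\<mu>} \<Longrightarrow> \<phi> (bsp t s i) = of_bool (i = j)"
    using dual by blast
  have "\<phi> (bsp t s k) = of_bool (k = j)" for k
  proof (cases "k \<in> {\<mu>-s..\<mu>}")
    case False
    have "bsp t s k y = 0" if "y \<in> {x<..<b}" for y
    proof (rule ccontr)
      assume "bsp t s k y \<noteq> 0"
      from bsp_nonzeroD[OF \<open>mono t\<close> this] have "t k < t (Suc \<mu>)" "t \<mu> < t (k + s + 1)"
        using that \<mu> by (auto simp: b_def)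
      then have "k < Suc \<mu>" "\<mu> < k + s + 1"
        using monoD[OF \<open>mono t\<close>] by (meson not_less)+
      then show False using False by auto
    qed
    then have "\<phi> (bsp t s k) = 0" by (rule evals_zero[OF \<phi>(1)])
    then show ?thesis using False \<open>j \<in> _\<close> by auto
  qed (rule \<phi>(2))
  moreover have "\<phi> \<in> evals {x<..<x+\<epsilon>}"
  proof -
    have "{x<..<b} \<subseteq> {x<..<x+\<epsilon>}" by (auto simp: b_def)
    then show ?thesis using \<phi>(1) evals_mono by blast
  qed
  ultimately show ?thesis by blast
qed

section \<open>Knot insertion\<close>

definition insert_knot :: "nat \<Rightarrow> real \<Rightarrow> (nat \<Rightarrow> real) \<Rightarrow> nat \<Rightarrow> real" where
  "insert_knot k u t i = (if i < k then t i else if i = k then u else t (i - 1))"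

lemma bsp_cong_knots:
  "(\<And>i. i \<le> s + 1 \<Longrightarrow> t (j + i) = t' (j' + i)) \<Longrightarrow> bsp t s j x = bsp t' s j' x"
proof (induction s arbitrary: j j')
  case 0
  then show ?case using "0.prems"[of 0] "0.prems"[of 1] by simp
next
  case (Suc s)
  have "bsp t s j x = bsp t' s j' x" using Suc.prems by (intro Suc.IH) auto
  moreover have "bsp t s (j + 1) x = bsp t' s (j' + 1) x"
    using Suc.prems[of "Suc i" for i] by (intro Suc.IH) auto
  moreover have "t j = t' j'" "t (j + 1) = t' (j' + 1)" "t (j + s + 1) = t' (j' + s + 1)"
    "t (j + s + 2) = t' (j' + s + 2)"
    using Suc.prems[of 0] Suc.prems[of 1] Suc.prems[of "s + 1"] Suc.prems[of "s + 2"]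
    by (simp_all add: add.assoc)
  ultimately show ?case unfolding bsp.simps by simp
qed

lemma bsp_insert_knot_left: "j + s + 2 \<le> k \<Longrightarrow> bsp t s j x = bsp (insert_knot k u t) s j x"
  by (rule bsp_cong_knots) (auto simp: insert_knot_def)

lemma bsp_insert_knot_right: "k \<le> j \<Longrightarrow> bsp t s j x = bsp (insert_knot k u t) s (Suc j) x"
  by (rule bsp_cong_knots) (auto simp: insert_knot_def)

text \<open>Boehm's knot insertion, in the normalization in which the two weights add up to the
  length of the old support. The induction on the degree compares coefficients of the three
  lower-degree B-splines \<open>P\<close>, \<open>Q\<close>, \<open>R\<close> on the refined knots;
  zero denominators are absorbed because the B-splines over them vanish.\<close>

lemma bsp_insert_knot:
  assumes "mono t" "mono (insert_knot k u t)" "j < k" "k \<le> j + s + 1"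
  shows "bsp t s j x = (u - t j) * nbsp (insert_knot k u t) s j x +
    (t (j + s + 1) - u) * nbsp (insert_knot k u t) s (Suc j) x"
  using assms(3,4)
proof (induction s arbitrary: j)
  case 0
  then have k: "k = Suc j" by simp
  have "t j \<le> u" "u \<le> t (Suc j)"
    using monoD[OF assms(2), of j k] monoD[OF assms(2), of k "Suc k"] k by (auto simp: insert_knot_def)
  then show ?case by (auto simp: nbsp_def insert_knot_def k)
next
  case (Suc s)
  define t' where "t' = insert_knot k u t"
  define a where "a = t j"
  define b where "b = t (Suc j)"
  define c where "c = t (j + s + 1)"
  define T where "T = t (j + s + 2)"
  define P where "P = nbsp t' s j x"
  define Q where "Q = nbsp t' s (Suc j) x"
  define R where "R = nbsp t' s (Suc (Suc j)) x"
  note m' = assms(2)[folded t'_def]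
  have ord: "a \<le> b" "b \<le> c" "c \<le> T" unfolding a_def b_def c_def T_def by (rule monoD[OF assms(1)]; simp)+
  have G: "t (j + Suc s + 1) = T" by (simp add: T_def)
  have t'j: "t' j = a" "t' (j + s + 3) = T"
    using Suc.prems by (auto simp: t'_def insert_knot_def a_def T_def numeral_3_eq_3)
  have deg: "t' (j + s + 1) \<le> t' j \<Longrightarrow> P = 0" "t' (j + s + 2) \<le> t' (Suc j) \<Longrightarrow> Q = 0"
    "t' (j + s + 3) \<le> t' (Suc (Suc j)) \<Longrightarrow> R = 0"
    unfolding P_def Q_def R_def by (auto intro!: nbsp_degenerate[OF m'] simp: numeral_3_eq_3)
  have N0: "nbsp t' (Suc s) j x = ((x - a) * P + (t' (j + s + 2) - x) * Q) / (t' (j + s + 2) - a)"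
    unfolding nbsp_def[of _ "Suc s"] bsp_Suc by (simp add: P_def Q_def t'j)
  have N1: "nbsp t' (Suc s) (Suc j) x =
      ((x - t' (Suc j)) * Q + (T - x) * R) / (T - t' (Suc j))"
    unfolding nbsp_def[of _ "Suc s"] bsp_Suc using t'j(2) by (simp add: Q_def R_def numeral_3_eq_3)
  have L: "bsp t (Suc s) j x = (x - a) * (bsp t s j x / (c - a)) + (T - x) * (bsp t s (Suc j) x / (T - b))"
    by (simp add: a_def b_def c_def T_def)
  \<comment> \<open>The new knot cuts only the left, both, or only the right of the two lower-degree
    B-splines; an uncut one is carried over with its index unchanged or shifted by one.\<close>
  consider "k = Suc j" | "Suc j < k" "k \<le> j + s + 1" | "k = j + s + 2" using Suc.prems by linarith
  then show ?case
  proof cases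
    case 1
    have t's: "t' (Suc j) = u" "t' (Suc (Suc j)) = b" "t' (j + s + 2) = c"
      using 1 by (auto simp: t'_def insert_knot_def b_def c_def)
    have u: "a \<le> u" "u \<le> b"
      using monoD[OF m', of j "Suc j"] monoD[OF m', of "Suc j" "Suc (Suc j)"] t's t'j by auto
    have "bsp t s j x = (u - a) * P + (c - u) * Q"
      using Suc.IH[of j] 1 by (simp add: a_def c_def P_def Q_def t'_def)
    moreover have "bsp t s (Suc j) x = (T - b) * R"
    proof -
      have "bsp t s (Suc j) x = bsp t' s (Suc (Suc j)) x"
        unfolding t'_def by (rule bsp_insert_knot_right) (use 1 in simp)
      also have "\<dots> = (T - b) * R"
        using bsp_eq_nbsp[OF m', of s "Suc (Suc j)" x] t's t'j by (simp add: R_def numeral_3_eq_3)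
      finally show ?thesis .
    qed
    ultimately have "bsp t (Suc s) j x = (x - a) * (((u - a) * P + (c - u) * Q) / (c - a)) + (T - x) * R"
      using L ord deg(3) t's t'j u by (cases "T = b") auto
    also have "\<dots> = (u - a) * (((x - a) * P + (c - x) * Q) / (c - a)) +
        (T - u) * (((x - u) * Q + (T - x) * R) / (T - u))"
    proof -
      have 1: "(T - u) * (((x - u) * Q + (T - x) * R) / (T - u)) = (x - u) * Q + (T - x) * R"
        using deg t's t'j u ord by (cases "T = u") auto
      have 2: "c = a \<Longrightarrow> Q = 0" using deg(2) t's u ord by auto
      show ?thesis unfolding 1
      proof (cases "c = a")
        case False
        then show "(x - a) * (((u - a) * P + (c - u) * Q) / (c - a)) + (T - x) * R =
          (u - a) * (((x - a) * P + (c - x) * Q) / (c - a)) + ((x - u) * Q + (T - x) * R)"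
          by (simp add: field_simps)
      qed (use 2 in simp)
    qed
    finally show ?thesis unfolding G t'_def[symmetric] N0 N1 t's a_def[symmetric] .
  next
    case 2
    have t's: "t' (Suc j) = b" "t' (j + s + 2) = c"
      using 2 by (auto simp: t'_def insert_knot_def b_def c_def)
    have u: "b \<le> u" "u \<le> c"
      using monoD[OF m', of "Suc j" k] monoD[OF m', of k "j + s + 2"] t's t'j 2
      by (auto simp: t'_def insert_knot_def)
    have "bsp t s j x = (u - a) * P + (c - u) * Q"
      using Suc.IH[of j] 2 by (simp add: a_def c_def P_def Q_def t'_def)
    moreover have "bsp t s (Suc j) x = (u - b) * Q + (T - u) * R"
      using Suc.IH[of "Suc j"] 2 by (simp add: b_def T_def Q_def R_def t'_def)
    ultimately have "bsp t (Suc s) j x = (x - a) * (((u - a) * P + (c - u) * Q) / (c - a)) +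
        (T - x) * (((u - b) * Q + (T - u) * R) / (T - b))"
      using L by simp
    also have "\<dots> = (u - a) * (((x - a) * P + (c - x) * Q) / (c - a)) +
        (T - u) * (((x - b) * Q + (T - x) * R) / (T - b))"
    proof -
      have Q: "c = a \<or> T = b \<Longrightarrow> Q = 0" using deg(2) t's ord by auto
      have "(x - a) * (((u - a) * P + (c - u) * Q) / (c - a)) =
          (u - a) * (((x - a) * P + (c - x) * Q) / (c - a)) + (x - u) * Q"
        using Q by (cases "c = a") (auto simp: field_simps)
      moreover have "(T - x) * (((u - b) * Q + (T - u) * R) / (T - b)) =
          (T - u) * (((x - b) * Q + (T - x) * R) / (T - b)) - (x - u) * Q"
        using Q by (cases "T = b") (auto simp: field_simps)
      ultimately show ?thesis by simp
    qed
    finally show ?thesis unfolding G t'_def[symmetric] N0 N1 t's a_def[symmetric] .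
  next
    case 3
    have t's: "t' (Suc j) = b" "t' (j + s + 2) = u" "t' (j + s + 1) = c"
      using 3 by (auto simp: t'_def insert_knot_def b_def c_def)
    have u: "c \<le> u" "u \<le> T"
      using monoD[OF m', of "j + s + 1" "j + s + 2"] monoD[OF m', of "j + s + 2" "j + s + 3"] t's t'j by auto
    have "bsp t s j x = (c - a) * P"
    proof -
      have "bsp t s j x = bsp t' s j x"
        unfolding t'_def by (rule bsp_insert_knot_left) (use 3 in simp)
      also have "\<dots> = (c - a) * P"
        using bsp_eq_nbsp[OF m', of s j x] t's t'j by (simp add: P_def)
      finally show ?thesis .
    qed
    moreover have "bsp t s (Suc j) x = (u - b) * Q + (T - u) * R"
      using Suc.IH[of "Suc j"] 3 by (simp add: b_def T_def Q_def R_def t'_def)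
    ultimately have "bsp t (Suc s) j x = (x - a) * P + (T - x) * (((u - b) * Q + (T - u) * R) / (T - b))"
      using L ord deg(1) t's t'j u by (cases "c = a") auto
    also have "\<dots> = (u - a) * (((x - a) * P + (u - x) * Q) / (u - a)) +
        (T - u) * (((x - b) * Q + (T - x) * R) / (T - b))"
    proof -
      have 1: "(u - a) * (((x - a) * P + (u - x) * Q) / (u - a)) = (x - a) * P + (u - x) * Q"
        using deg t's t'j u ord by (cases "u = a") auto
      have 2: "T = b \<Longrightarrow> Q = 0" using deg(2) t's u ord by auto
      have "(T - x) * (((u - b) * Q + (T - u) * R) / (T - b)) =
          (T - u) * (((x - b) * Q + (T - x) * R) / (T - b)) + (u - x) * Q"
        using 2 by (cases "T = b") (auto simp: field_simps)
      then show ?thesis unfolding 1 by simp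
    qed
    finally show ?thesis unfolding G t'_def[symmetric] N0 N1 t's a_def[symmetric] .
  qed
qed

declare bsp.simps(2) [simp del]

lemma sum_of_bool_mult:
  fixes g :: "'a \<Rightarrow> real"
  assumes "finite A" "j \<in> A"
  shows "(\<Sum>i\<in>A. of_bool (i = j) * g i) = g j"
proof -
  have "of_bool (i = j) * g i = (if i = j then g j else 0)" for i by simp
  then show ?thesis using assms by simp
qed

text \<open>The normalized B-splines of one degree all have the same integral, so the row sum 1
  expresses conservation of the integral. This would fail for coinciding knots, where
  \<open>nbsp\<close> is 0; hence the restriction to nondegenerate B-splines. The last clause gives
  locality and makes the refining B-splines nondegenerate, so that refinements can be
  composed.\<close>

definition refines ::
  "nat \<Rightarrow> (nat \<Rightarrow> real) \<Rightarrow> nat \<Rightarrow> (nat \<Rightarrow> real) \<Rightarrow> nat \<Rightarrow> (nat \<Rightarrow> nat \<Rightarrow> real) \<Rightarrow> bool" where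
  "refines s t n t' n' a \<longleftrightarrow>
    (\<forall>j<n. t j < t (j + s + 1) \<longrightarrow>
       (\<forall>x. nbsp t s j x = (\<Sum>i<n'. a j i * nbsp t' s i x)) \<and> (\<Sum>i<n'. a j i) = 1 \<and>
       (\<forall>i<n'. a j i \<noteq> 0 \<longrightarrow> t j \<le> t' i \<and> t' (i + s + 1) \<le> t (j + s + 1) \<and> t' i < t' (i + s + 1)))"

lemma refines_refl: "refines s t n t n (\<lambda>j i. of_bool (i = j))"
  unfolding refines_def
proof (intro allI impI)
  fix j assume j: "j < n" "t j < t (j + s + 1)"
  have "(\<Sum>i<n. of_bool (i = j) * g i) = g j" for g :: "nat \<Rightarrow> real"
    using j by (intro sum_of_bool_mult) auto
  from this this[of "\<lambda>_. 1"] show "(\<forall>x. nbsp t s j x = (\<Sum>i<n. of_bool (i = j) * nbsp t s i x)) \<and>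
      (\<Sum>i<n. of_bool (i = j)) = (1 :: real) \<and>
      (\<forall>i<n. of_bool (i = j) \<noteq> (0 :: real) \<longrightarrow> t j \<le> t i \<and> t (i + s + 1) \<le> t (j + s + 1) \<and> t i < t (i + s + 1))"
    using j by simp
qed

lemma refines_trans:
  assumes "refines s t n t' n' a" "refines s t' n' t'' n'' b"
  shows "refines s t n t'' n'' (\<lambda>j k. \<Sum>i<n'. a j i * b i k)"
  unfolding refines_def
proof (intro allI impI)
  fix j assume j: "j < n" "t j < t (j + s + 1)"
  note A = assms(1)[unfolded refines_def, rule_format, OF j]
  have A1: "nbsp t s j x = (\<Sum>i<n'. a j i * nbsp t' s i x)" for x using A by blast
  have A2: "t j \<le> t' i" "t' (i + s + 1) \<le> t (j + s + 1)" "t' i < t' (i + s + 1)" if "i < n'" "a j i \<noteq> 0" for i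
    using A that by blast+
  have B: "(\<forall>x. nbsp t' s i x = (\<Sum>k<n''. b i k * nbsp t'' s k x)) \<and> (\<Sum>k<n''. b i k) = 1 \<and>
       (\<forall>k<n''. b i k \<noteq> 0 \<longrightarrow> t' i \<le> t'' k \<and> t'' (k + s + 1) \<le> t' (i + s + 1) \<and> t'' k < t'' (k + s + 1))"
    if "i < n'" "a j i \<noteq> 0" for i
    using assms(2) A2(3)[OF that] that unfolding refines_def by blast
  have "a j i * nbsp t' s i x = (\<Sum>k<n''. a j i * b i k * nbsp t'' s k x)" if "i < n'" for i x
    using B[OF that] by (cases "a j i = 0") (simp_all add: sum_distrib_left mult.assoc)
  then have 1: "nbsp t s j x = (\<Sum>k<n''. (\<Sum>i<n'. a j i * b i k) * nbsp t'' s k x)" for x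
    unfolding A1 sum_distrib_right by (subst sum.swap) (auto intro!: sum.cong)
  have "(\<Sum>k<n''. \<Sum>i<n'. a j i * b i k) = (\<Sum>i<n'. a j i * (\<Sum>k<n''. b i k))"
    by (subst sum.swap) (simp add: sum_distrib_left)
  also have "\<dots> = (\<Sum>i<n'. a j i)"
    using B by (intro sum.cong refl) fastforce
  also have "\<dots> = 1" using A by blast
  finally have 2: "(\<Sum>k<n''. \<Sum>i<n'. a j i * b i k) = 1" .
  have 3: "t j \<le> t'' k \<and> t'' (k + s + 1) \<le> t (j + s + 1) \<and> t'' k < t'' (k + s + 1)"
    if k: "k < n''" "(\<Sum>i<n'. a j i * b i k) \<noteq> 0" for k
  proof -
    obtain i where i: "i < n'" "a j i * b i k \<noteq> 0"
      using sum.not_neutral_contains_not_neutral[OF k(2)] by auto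
    then show ?thesis using A2[of i] B[of i] k(1) by force
  qed
  show "(\<forall>x. nbsp t s j x = (\<Sum>k<n''. (\<Sum>i<n'. a j i * b i k) * nbsp t'' s k x)) \<and>
      (\<Sum>k<n''. \<Sum>i<n'. a j i * b i k) = 1 \<and>
      (\<forall>k<n''. (\<Sum>i<n'. a j i * b i k) \<noteq> 0 \<longrightarrow>
         t j \<le> t'' k \<and> t'' (k + s + 1) \<le> t (j + s + 1) \<and> t'' k < t'' (k + s + 1))"
    using 1 2 3 by blast
qed

lemma refines_insert_knot:
  assumes "mono t" "mono (insert_knot k u t)"
  shows "\<exists>a. refines s t n (insert_knot k u t) (Suc n) a"
proof -
  define t' where "t' = insert_knot k u t"
  note m' = assms(2)[folded t'_def]
  \<comment> \<open>An uncut B-spline is kept, possibly with shifted index; a cut one splits in the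
    proportion in which \<open>u\<close> divides its support.\<close>
  define a where "a j i = (if j + s + 2 \<le> k then of_bool (i = j) else if k \<le> j then of_bool (i = Suc j)
    else (if i = j then (u - t j) / (t (j + s + 1) - t j) else
          if i = Suc j then (t (j + s + 1) - u) / (t (j + s + 1) - t j) else 0))" for j i
  have "refines s t n t' (Suc n) a"
    unfolding refines_def
  proof (intro allI impI)
    fix j assume j: "j < n" "t j < t (j + s + 1)"
    have sum1: "(\<Sum>i<Suc n. of_bool (i = l) * g i) = g l" if "l \<le> n" for g :: "nat \<Rightarrow> real" and l
      using that by (intro sum_of_bool_mult) auto
    consider "j + s + 2 \<le> k" | "k \<le> j" | "j < k" "k \<le> j + s + 1" by linarith
    then show "(\<forall>x. nbsp t s j x = (\<Sum>i<Suc n. a j i * nbsp t' s i x)) \<and> (\<Sum>i<Suc n. a j i) = 1 \<and>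
       (\<forall>i<Suc n. a j i \<noteq> 0 \<longrightarrow> t j \<le> t' i \<and> t' (i + s + 1) \<le> t (j + s + 1) \<and> t' i < t' (i + s + 1))"
    proof cases
      case 1
      have aj: "a j = (\<lambda>i. of_bool (i = j))" using 1 by (simp add: a_def fun_eq_iff)
      have t': "t' j = t j" "t' (j + s + 1) = t (j + s + 1)" using 1 by (auto simp: t'_def insert_knot_def)
      then have "nbsp t s j x = nbsp t' s j x" for x
        using bsp_insert_knot_left[OF 1, of t x u] by (simp add: nbsp_def t'_def)
      then show ?thesis unfolding aj using sum1[of j] sum1[of j "\<lambda>_. 1"] j t' by auto
    next
      case 2
      have aj: "a j = (\<lambda>i. of_bool (i = Suc j))" using 2 by (simp add: a_def fun_eq_iff)
      have t': "t' (Suc j) = t j" "t' (Suc j + s + 1) = t (j + s + 1)"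
        using 2 by (auto simp: t'_def insert_knot_def)
      then have "nbsp t s j x = nbsp t' s (Suc j) x" for x
        using bsp_insert_knot_right[OF 2, of t s x u] by (simp add: nbsp_def t'_def)
      then show ?thesis unfolding aj using sum1[of "Suc j"] sum1[of "Suc j" "\<lambda>_. 1"] j t' by auto
    next
      case 3
      define w where "w = t (j + s + 1) - t j"
      have w: "w > 0" using j by (simp add: w_def)
      have aj: "a j = (\<lambda>i. of_bool (i = j) * ((u - t j) / w) + of_bool (i = Suc j) * ((t (j + s + 1) - u) / w))"
        using 3 by (auto simp: a_def fun_eq_iff w_def)
      have sum2: "(\<Sum>i<Suc n. a j i * g i) = (u - t j) / w * g j + (t (j + s + 1) - u) / w * g (Suc j)"
        for g :: "nat \<Rightarrow> real"
      proof -
        have "(\<Sum>i<Suc n. a j i * g i) = (\<Sum>i<Suc n. of_bool (i = j) * ((u - t j) / w * g i)) +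
           (\<Sum>i<Suc n. of_bool (i = Suc j) * ((t (j + s + 1) - u) / w * g i))"
          unfolding aj by (simp add: algebra_simps sum.distrib del: sum.lessThan_Suc)
        also have "\<dots> = (u - t j) / w * g j + (t (j + s + 1) - u) / w * g (Suc j)"
          using j by (subst sum1, simp)+ (rule refl)
        finally show ?thesis .
      qed
      have t': "t' j = t j" "t' (Suc j + s + 1) = t (j + s + 1)"
        using 3 by (auto simp: t'_def insert_knot_def)
      have "nbsp t s j x = (\<Sum>i<Suc n. a j i * nbsp t' s i x)" for x
        unfolding nbsp_def[of t] bsp_insert_knot[OF assms 3] sum2
        using w by (simp add: t'_def w_def add_divide_distrib)
      moreover have "(\<Sum>i<Suc n. a j i) = 1"
      proof -
        have "(\<Sum>i<Suc n. a j i) = (u - t j) / w + (t (j + s + 1) - u) / w"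
          using sum2[of "\<lambda>_. 1"] by (simp only: mult_1_right)
        also have "\<dots> = 1" unfolding add_divide_distrib[symmetric] using w by (simp add: w_def)
        finally show ?thesis .
      qed
      moreover have "t j \<le> t' i \<and> t' (i + s + 1) \<le> t (j + s + 1) \<and> t' i < t' (i + s + 1)"
        if i: "a j i \<noteq> 0" for i
      proof -
        have uk: "t' k = u" by (simp add: t'_def insert_knot_def)
        consider "i = j" "u \<noteq> t j" | "i = Suc j" "u \<noteq> t (j + s + 1)" using i unfolding aj
          by (cases "i = j"; cases "i = Suc j"; force)
        then show ?thesis
        proof cases
          case 1
          have "t' j \<le> t' k" "t' k \<le> t' (j + s + 1)" "t' (j + s + 1) \<le> t' (Suc j + s + 1)"
            by (rule monoD[OF m']; use 3 in simp)+
          then show ?thesis using 1 t' uk by auto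
        next
          case 2
          have "t' (Suc j) \<le> t' k" "t' k \<le> t' (Suc j + s + 1)" "t' j \<le> t' (Suc j)"
            by (rule monoD[OF m']; use 3 in simp)+
          then show ?thesis using 2 t' uk by auto
        qed
      qed
      ultimately show ?thesis by blast
    qed
  qed
  then show ?thesis unfolding t'_def by blast
qed

text \<open>Knot lists are continued by 1, so that the additional B-splines vanish.\<close>

definition knot_fun :: "real list \<Rightarrow> nat \<Rightarrow> real" where
  "knot_fun ts i = (if i < length ts then ts ! i else 1)"

lemma mono_knot_fun:
  assumes "sorted ts" "set ts \<subseteq> {..1}"
  shows "mono (knot_fun ts)"
proof (rule monoI)
  fix i j :: nat assume "i \<le> j"
  then show "knot_fun ts i \<le> knot_fun ts j"
    using assms subsetD[OF assms(2) nth_mem, of i] by (auto simp: knot_fun_def sorted_iff_nth_mono)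
qed

lemma insort_split: "\<exists>xs ys. ts = xs @ ys \<and> insort u ts = xs @ u # ys"
proof (induction ts)
  case (Cons v ts)
  then obtain xs ys where *: "ts = xs @ ys" "insort u ts = xs @ u # ys" by blast
  show ?case
  proof (cases "u \<le> v")
    case True
    then show ?thesis by (intro exI[of _ "[]"] exI[of _ "v # ts"]) simp
  next
    case False
    then show ?thesis using * by (intro exI[of _ "v # xs"] exI[of _ ys]) auto
  qed
qed simp

lemma knot_fun_insort: "\<exists>k. knot_fun (insort u ts) = insert_knot k u (knot_fun ts)"
proof -
  obtain xs ys where *: "ts = xs @ ys" "insort u ts = xs @ u # ys" using insort_split by blast
  have "knot_fun (xs @ u # ys) i = insert_knot (length xs) u (knot_fun (xs @ ys)) i" for i
  proof -
    consider "i < length xs" | "i = length xs" | "length xs < i" by linarith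
    then show ?thesis
    proof cases
      case 3
      then have "i - length xs = Suc (i - 1 - length xs)" by simp
      then show ?thesis using 3 by (auto simp: knot_fun_def insert_knot_def nth_append)
    qed (auto simp: knot_fun_def insert_knot_def nth_append)
  qed
  then show ?thesis unfolding *(2) unfolding *(1) by blast
qed

lemma refines_foldr_insort:
  assumes "sorted ts" "set ts \<subseteq> {..1}" "set us \<subseteq> {..1}"
  shows "sorted (foldr insort us ts) \<and> mset (foldr insort us ts) = mset us + mset ts \<and>
    (\<exists>a. refines s (knot_fun ts) (length ts) (knot_fun (foldr insort us ts)) (length us + length ts) a)"
  using assms(3)
proof (induction us)
  case Nil
  then show ?case using refines_refl assms(1) by auto
next
  case (Cons u us)
  let ?ts = "foldr insort us ts"
  from Cons obtain a where *: "sorted ?ts" "mset ?ts = mset us + mset ts"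
    "refines s (knot_fun ts) (length ts) (knot_fun ?ts) (length us + length ts) a" by auto
  have set: "set ?ts \<subseteq> {..1}" using arg_cong[OF *(2), of set_mset] Cons.prems assms by auto
  obtain k where k: "knot_fun (insort u ?ts) = insert_knot k u (knot_fun ?ts)"
    using knot_fun_insort by blast
  have "mono (knot_fun ?ts)" "mono (knot_fun (insort u ?ts))"
    by (rule mono_knot_fun; use * set Cons.prems in \<open>auto simp: sorted_insort set_insort_key\<close>)+
  then obtain b where "refines s (knot_fun ?ts) (length us + length ts) (knot_fun (insort u ?ts))
      (Suc (length us + length ts)) b"
    using refines_insert_knot unfolding k by blast
  from refines_trans[OF *(3) this] show ?case using * by (auto simp: sorted_insort)
qed

text \<open>The missing knots are inserted one by one; the result is sorted and has the multiset of
  \<open>ts'\<close>, which determines it.\<close>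

lemma refines_knot_fun:
  assumes "sorted ts" "sorted ts'" "mset ts \<subseteq># mset ts'" "set ts' \<subseteq> {..1}"
  shows "\<exists>a. refines s (knot_fun ts) (length ts) (knot_fun ts') (length ts') a"
proof -
  obtain us where us: "mset us = mset ts' - mset ts" using ex_mset by blast
  then have ms: "mset ts' = mset us + mset ts" using assms(3) by simp
  have "set ts' = set us \<union> set ts" using arg_cong[OF ms, of set_mset] by simp
  then have "sorted (foldr insort us ts) \<and> mset (foldr insort us ts) = mset us + mset ts \<and>
    (\<exists>a. refines s (knot_fun ts) (length ts) (knot_fun (foldr insort us ts)) (length us + length ts) a)"
    using assms by (intro refines_foldr_insort) auto
  moreover from this have "foldr insort us ts = ts'"
    using properties_for_sort[of "foldr insort us ts" ts'] properties_for_sort[of ts' ts'] assms(2) ms by simp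
  moreover have "length ts' = length us + length ts" using arg_cong[OF ms, of size] by simp
  ultimately show ?thesis by auto
qed

section \<open>Right derivatives\<close>

text \<open>With right-continuous B-splines the derivative formula holds for the right derivative at
  every point, also at knots. Right derivatives are unique, so they can be compared as functions
  without exceptional sets.\<close>

definition has_rd :: "(real \<Rightarrow> real) \<Rightarrow> (real \<Rightarrow> real) \<Rightarrow> bool" where
  "has_rd f g \<longleftrightarrow> (\<forall>x. (f has_real_derivative g x) (at_right x))"

lemma has_rd_zero: "has_rd (\<lambda>x. 0) (\<lambda>x. 0)"
  by (simp add: has_rd_def)

lemma has_rd_add: "has_rd f f' \<Longrightarrow> has_rd g g' \<Longrightarrow> has_rd (\<lambda>x. f x + g x) (\<lambda>x. f' x + g' x)"
  by (simp add: has_rd_def DERIV_add)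

lemma has_rd_diff: "has_rd f f' \<Longrightarrow> has_rd g g' \<Longrightarrow> has_rd (\<lambda>x. f x - g x) (\<lambda>x. f' x - g' x)"
  by (simp add: has_rd_def DERIV_diff)

lemma has_rd_scale: "has_rd f f' \<Longrightarrow> has_rd (\<lambda>x. c * f x) (\<lambda>x. c * f' x)"
  by (simp add: has_rd_def DERIV_cmult)

lemma has_rd_sum:
  "(\<And>i. i \<in> A \<Longrightarrow> has_rd (f i) (f' i)) \<Longrightarrow> has_rd (\<lambda>x. \<Sum>i\<in>A. f i x) (\<lambda>x. \<Sum>i\<in>A. f' i x)"
  by (simp add: has_rd_def DERIV_sum)

lemma has_rd_bsp:
  "mono t \<Longrightarrow> has_rd (bsp t (Suc q) j) (\<lambda>x. real (Suc q) * (nbsp t q j x - nbsp t q (Suc j) x))"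
  using bsp_deriv_right[of t "Suc q" j] by (simp add: has_rd_def)

lemma has_rd_uniqueD: "has_rd f g \<Longrightarrow> (f has_real_derivative d) (at_right x) \<Longrightarrow> g x = d"
  unfolding has_rd_def has_field_derivative_iff
  by (rule tendsto_unique[OF trivial_limit_at_right_real]) auto

lemma has_rd_unique: "has_rd f g \<Longrightarrow> has_rd f h \<Longrightarrow> g = h"
  by (rule ext) (auto intro: has_rd_uniqueD simp: has_rd_def[of _ h])

lemma has_rd_zero_outside:
  assumes "has_rd f g" "closed U" "\<And>x. x \<notin> U \<Longrightarrow> f x = 0" "x \<notin> U"
  shows "g x = 0"
proof -
  have "(f has_real_derivative 0) (at x)"
    by (rule has_field_derivative_transform_within_open[of "\<lambda>_. 0" _ _ "- U"]) (use assms in auto)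
  then have "(f has_real_derivative 0) (at_right x)" by (rule has_field_derivative_at_within)
  then show ?thesis by (rule has_rd_uniqueD[OF assms(1)])
qed

text \<open>Linearity is demanded on all functions and not only on splines, so an operator can be
  applied along lines to arbitrary multivariate functions without membership conditions.\<close>

definition linop :: "(('a \<Rightarrow> real) \<Rightarrow> 'b \<Rightarrow> real) \<Rightarrow> bool" where
  "linop T \<longleftrightarrow> (\<forall>f g. T (\<lambda>x. f x + g x) = (\<lambda>x. T f x + T g x)) \<and>
     (\<forall>c f. T (\<lambda>x. c * f x) = (\<lambda>x. c * T f x))"

lemma linop_add: "linop T \<Longrightarrow> T (\<lambda>x. f x + g x) = (\<lambda>x. T f x + T g x)"
  and linop_scale: "linop T \<Longrightarrow> T (\<lambda>x. c * f x) = (\<lambda>x. c * T f x)"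
  by (auto simp: linop_def)

lemma linop_zero: "linop T \<Longrightarrow> T (\<lambda>x. 0) = (\<lambda>x. 0)"
  using linop_scale[of T 0 "\<lambda>x. 0"] by simp

lemma linop_sum: "linop T \<Longrightarrow> T (\<lambda>x. \<Sum>i\<in>A. f i x) = (\<lambda>x. \<Sum>i\<in>A. T (f i) x)"
proof (induction A rule: infinite_finite_induct)
  case (insert i A)
  then show ?case using linop_add[of T "f i" "\<lambda>x. \<Sum>i\<in>A. f i x"] by simp
qed (simp_all add: linop_zero)

text \<open>Prescribing values on a basis and reading off coefficients by evaluation functionals
  yields operators that are linear on all functions.\<close>

lemma linop_evals:
  assumes "\<And>j. j \<in> A \<Longrightarrow> \<phi> j \<in> evals (X j)"
  shows "linop (\<lambda>f x. \<Sum>j\<in>A. \<phi> j f * h j x)"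
proof -
  have "(\<Sum>j\<in>A. \<phi> j (\<lambda>x. f x + g x) * h j x) = (\<Sum>j\<in>A. \<phi> j f * h j x) + (\<Sum>j\<in>A. \<phi> j g * h j x)" for f g x
    unfolding sum.distrib[symmetric]
    by (intro sum.cong refl) (simp add: evals_add[OF assms] distrib_right)
  moreover have "(\<Sum>j\<in>A. \<phi> j (\<lambda>x. c * f x) * h j x) = c * (\<Sum>j\<in>A. \<phi> j f * h j x)" for c f x
    unfolding sum_distrib_left by (intro sum.cong refl) (simp add: evals_scale[OF assms] mult.assoc)
  ultimately show ?thesis by (simp add: linop_def)
qed

section \<open>The univariate spline complex\<close>

text \<open>Both spaces of the univariate complex use one knot sequence, that of degree
  \<open>Suc q\<close>. \<open>N\<close> is the dimension in degree \<open>Suc q\<close>. For degree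
  \<open>q\<close> the index 0 is degenerate and the indices from 1 to \<open>N - 1\<close> form the
  basis; \<open>t_less\<close> says that these are nondegenerate.\<close>

locale knot_seq =
  fixes q N :: nat and t :: "nat \<Rightarrow> real"
  assumes mono: "mono t"
    and t_0: "\<And>i. i \<le> Suc q \<Longrightarrow> t i = 0"
    and t_1: "\<And>i. N \<le> i \<Longrightarrow> t i = 1"
    and t_less: "\<And>j. 1 \<le> j \<Longrightarrow> j < N \<Longrightarrow> t j < t (j + Suc q)"
begin

definition splines0 :: "(real \<Rightarrow> real) set" where "splines0 = lspan (range (bsp t (Suc q)))"
definition splines1 :: "(real \<Rightarrow> real) set" where "splines1 = lspan (range (nbsp t q))"

lemma q_less_N: "Suc q < N"
  using t_0[of N] t_1[of N] by force

lemma lin_space_splines: "lin_space splines0" "lin_space splines1"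
  unfolding splines0_def splines1_def by (rule lin_space_lspan)+

lemma bsp_mem: "bsp t (Suc q) j \<in> splines0" and nbsp_mem: "nbsp t q j \<in> splines1"
  unfolding splines0_def splines1_def by (auto intro: lspan_base)

lemma bsp_zero: "N \<le> j \<Longrightarrow> bsp t (Suc q) j x = 0"
  and nbsp_zero: "N \<le> j \<or> j = 0 \<Longrightarrow> nbsp t q j x = 0"
  using t_0[of "q + 1"] t_0[of 0] t_1
  by (auto intro!: bsp_degenerate[OF mono] nbsp_degenerate[OF mono])

lemma t_range: "0 \<le> t i" "t i \<le> 1"
  using monoD[OF mono, of 0 i] monoD[OF mono, of i "max i N"] t_0[of 0] t_1 by auto

lemma bsp_support: "bsp t s j x \<noteq> 0 \<Longrightarrow> 0 \<le> x \<and> x < 1"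
  using bsp_nonzeroD[OF mono, of s j x] t_range[of j] t_range[of "j + s + 1"] by auto

lemma sum_bsp: "(\<Sum>j<N. bsp t (Suc q) j x) = of_bool (0 \<le> x \<and> x < 1)"
proof (cases "0 \<le> x \<and> x < 1")
  case True
  define \<mu> where "\<mu> = Max {i. i \<le> N \<and> t i \<le> x}"
  have fin: "finite {i. i \<le> N \<and> t i \<le> x}" by simp
  have \<mu>: "\<mu> \<in> {i. i \<le> N \<and> t i \<le> x}"
    unfolding \<mu>_def by (rule Max_in[OF fin]) (use True t_0[of 0] in \<open>auto intro: exI[of _ 0]\<close>)
  have "\<mu> < N" using \<mu> True t_1[of N] by (cases "\<mu> = N") auto
  have "x < t (Suc \<mu>)"
  proof (rule ccontr)
    assume "\<not> x < t (Suc \<mu>)"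
    then have "Suc \<mu> \<le> \<mu>" using \<open>\<mu> < N\<close> unfolding \<mu>_def by (intro Max_ge[OF fin]) (auto simp: \<mu>_def)
    then show False by simp
  qed
  have "Suc q \<le> \<mu>" unfolding \<mu>_def by (rule Max_ge[OF fin]) (use True t_0 q_less_N in auto)
  have "(\<Sum>j<N. bsp t (Suc q) j x) = (\<Sum>j\<le>\<mu>. bsp t (Suc q) j x)"
  proof (rule sum.mono_neutral_right)
    show "\<forall>i\<in>{..<N} - {..\<mu>}. bsp t (Suc q) i x = 0"
    proof
      fix i assume "i \<in> {..<N} - {..\<mu>}"
      then have "t (Suc \<mu>) \<le> t i" by (intro monoD[OF mono]) auto
      then show "bsp t (Suc q) i x = 0" using bsp_nonzeroD(1)[OF mono, of "Suc q" i x] \<open>x < t (Suc \<mu>)\<close> by force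
    qed
  qed (use \<open>\<mu> < N\<close> in auto)
  also have "\<dots> = 1"
    by (rule bsp_partition_of_unity[OF mono]) (use \<mu> \<open>x < t (Suc \<mu>)\<close> \<open>Suc q \<le> \<mu>\<close> in auto)
  finally show ?thesis using True by simp
qed (use bsp_support[of "Suc q" _ x] in \<open>auto intro!: sum.neutral\<close>)

lemma splines0_expand:
  assumes "f \<in> splines0" obtains c where "f = (\<lambda>x. \<Sum>j<N. c j * bsp t (Suc q) j x)"
  by (rule lspan_range_lessThan[OF bsp_zero assms[unfolded splines0_def]]) (use that in auto)

lemma splines1_expand:
  assumes "f \<in> splines1" obtains c where "f = (\<lambda>x. \<Sum>j<N. c j * nbsp t q j x)"
  by (rule lspan_range_lessThan[OF nbsp_zero assms[unfolded splines1_def]]) (use that in auto)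

lemma splines_support:
  assumes "f \<in> splines0 \<or> f \<in> splines1" "x < 0 \<or> 1 \<le> x"
  shows "f x = 0"
proof -
  have "lin_space {f. f x = 0}" by (auto simp: lin_space_def)
  moreover have "bsp t s j x = 0" for s j using bsp_support[of s j x] assms(2) by linarith
  then have "range (bsp t (Suc q)) \<subseteq> {f. f x = 0}" "range (nbsp t q) \<subseteq> {f. f x = 0}"
    by (auto simp: nbsp_def)
  ultimately have "splines0 \<subseteq> {f. f x = 0}" "splines1 \<subseteq> {f. f x = 0}"
    unfolding splines0_def splines1_def by (simp_all add: lspan_minimal)
  then show ?thesis using assms(1) by blast
qed

lemma dual0: "j < N \<Longrightarrow> \<exists>\<phi>\<in>evals UNIV. \<forall>k. \<phi> (bsp t (Suc q) k) = of_bool (k = j)"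
proof -
  assume j: "j < N"
  have "t j < t (j + Suc q + 1)"
  proof (cases "j = 0")
    case True
    have "t 1 < t (1 + Suc q)" using q_less_N by (intro t_less) auto
    then show ?thesis using True t_0[of 0] t_0[of 1] by simp
  next
    case False
    then show ?thesis using t_less[of j] j monoD[OF mono, of "j + Suc q" "j + Suc q + 1"] by auto
  qed
  then have "\<exists>\<phi>\<in>evals {t j<..<t j + 1}. \<forall>k. \<phi> (bsp t (Suc q) k) = of_bool (k = j)"
    using t_0[of "Suc q"] t_range(1)[of j] by (intro bsp_local_dual[OF mono]) auto
  then show ?thesis using evals_mono[of "{t j<..<t j + 1}" UNIV] by blast
qed

text \<open>The point \<open>x\<close> is free in the support: this is what later locates the
  support of a B-spline that carries a nonzero coefficient.\<close>

lemma dual1: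
  assumes "1 \<le> j" "j < N" "t j \<le> x" "x < t (j + Suc q)" "0 < \<epsilon>"
  shows "\<exists>\<phi>\<in>evals {x<..<x + \<epsilon>}. \<forall>k. \<phi> (nbsp t q k) = of_bool (k = j)"
proof -
  obtain \<phi> where \<phi>: "\<phi> \<in> evals {x<..<x + \<epsilon>}" "\<And>k. \<phi> (bsp t q k) = of_bool (k = j)"
  proof -
    have "\<exists>\<phi>\<in>evals {x<..<x + \<epsilon>}. \<forall>k. \<phi> (bsp t q k) = of_bool (k = j)"
      using t_0[of q] t_range(1)[of j] assms by (intro bsp_local_dual[OF mono]) auto
    then show ?thesis using that by blast
  qed
  define \<psi> where "\<psi> f = (t (j + q + 1) - t j) * \<phi> f" for f
  have "\<psi> \<in> evals {x<..<x + \<epsilon>}"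
    unfolding \<psi>_def[abs_def] using \<phi>(1) unfolding evals_def by (intro lin_space_scale lin_space_lspan)
  moreover have "\<psi> (nbsp t q k) = of_bool (k = j)" for k
  proof -
    have "nbsp t q k = (\<lambda>x. (1 / (t (k + q + 1) - t k)) * bsp t q k x)" by (auto simp: nbsp_def)
    then have "\<phi> (nbsp t q k) = (1 / (t (k + q + 1) - t k)) * of_bool (k = j)"
      by (simp only: evals_scale[OF \<phi>(1)] \<phi>(2))
    then show ?thesis using t_less[OF assms(1,2)] by (auto simp: \<psi>_def)
  qed
  ultimately show ?thesis by blast
qed

lemma has_rd_splines0:
  assumes "f \<in> splines0" shows "\<exists>g\<in>splines1. has_rd f g"
  using assms unfolding splines0_def
proof induction
  case zero
  then show ?case using has_rd_zero lin_space_zero[OF lin_space_splines(2)] by blast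
next
  case (step f g c)
  then obtain g' j where *: "g' \<in> splines1" "has_rd g g'" "f = bsp t (Suc q) j" by blast
  let ?f' = "\<lambda>x. real (Suc q) * (nbsp t q j x - nbsp t q (Suc j) x)"
  have f': "?f' \<in> splines1"
    by (rule lin_space_scale[OF _ lin_space_diff]) (auto intro: nbsp_mem lin_space_splines)
  have "(\<lambda>x. c * ?f' x + g' x) \<in> splines1"
    by (rule lin_space_add[OF lin_space_splines(2) lin_space_scale[OF lin_space_splines(2) f'] *(1)])
  moreover have "has_rd (\<lambda>x. c * f x + g x) (\<lambda>x. c * ?f' x + g' x)"
    unfolding *(3) by (intro has_rd_add has_rd_scale has_rd_bsp mono *)
  ultimately show ?case by blast
qed

text \<open>A primitive of \<open>nbsp t q a - nbsp t q b\<close>: the derivatives of the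
  consecutive B-splines telescope. It vanishes outside the hull of the two supports, reflecting the
  equality of the two integrals.\<close>

definition telescope :: "nat \<Rightarrow> nat \<Rightarrow> real \<Rightarrow> real" where
  "telescope a b x = 1 / real (Suc q) * (\<Sum>r=a..<b. bsp t (Suc q) r x)"

lemma telescope_mem: "telescope a b \<in> splines0"
  unfolding telescope_def[abs_def] by (intro lin_space_scale lin_space_sum bsp_mem lin_space_splines)

lemma has_rd_telescope:
  assumes "a \<le> b"
  shows "has_rd (telescope a b) (\<lambda>x. nbsp t q a x - nbsp t q b x)"
proof -
  have "has_rd (telescope a b) (\<lambda>x. 1 / real (Suc q) *
      (\<Sum>r=a..<b. real (Suc q) * (nbsp t q r x - nbsp t q (Suc r) x)))"
    unfolding telescope_def[abs_def] by (intro has_rd_scale has_rd_sum has_rd_bsp mono)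
  also have "(\<lambda>x. 1 / real (Suc q) * (\<Sum>r=a..<b. real (Suc q) * (nbsp t q r x - nbsp t q (Suc r) x))) =
      (\<lambda>x. nbsp t q a x - nbsp t q b x)"
  proof
    fix x
    have "(\<Sum>r=a..<b. nbsp t q r x - nbsp t q (Suc r) x) = nbsp t q a x - nbsp t q b x"
      using sum_Suc_diff'[OF assms, of "\<lambda>r. - nbsp t q r x"] by simp
    then show "1 / real (Suc q) * (\<Sum>r=a..<b. real (Suc q) * (nbsp t q r x - nbsp t q (Suc r) x)) =
      nbsp t q a x - nbsp t q b x"
      by (simp only: flip: sum_distrib_left) simp
  qed
  finally show ?thesis .
qed

lemma telescope_nonzeroD: "telescope a b x \<noteq> 0 \<Longrightarrow> t a \<le> x \<and> x < t (b + Suc q)"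
proof -
  assume "telescope a b x \<noteq> 0"
  then have "(\<Sum>r=a..<b. bsp t (Suc q) r x) \<noteq> 0" by (auto simp: telescope_def)
  then obtain r where r: "r \<in> {a..<b}" "bsp t (Suc q) r x \<noteq> 0"
    by (rule sum.not_neutral_contains_not_neutral)
  then show ?thesis
    using bsp_nonzeroD[OF mono r(2)] monoD[OF mono, of a r] monoD[OF mono, of "r + Suc q + 1" "b + Suc q"]
    by auto
qed

lemma antiderivative:
  assumes "g \<in> splines1" shows "\<exists>f\<in>splines0. has_rd f g"
  using assms unfolding splines1_def
proof induction
  case zero
  then show ?case using has_rd_zero lin_space_zero[OF lin_space_splines(1)] by blast
next
  case (step g h c)
  then obtain f j where *: "f \<in> splines0" "has_rd f h" "g = nbsp t q j" by blast
  \<comment> \<open>From index \<open>N\<close> on \<open>nbsp\<close> vanishes, so this telescoping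
    sum is a primitive of the single B-spline.\<close>
  have "has_rd (telescope j (max j N)) g"
    using has_rd_telescope[of j "max j N"] * by (simp add: nbsp_zero)
  then have "has_rd (\<lambda>x. c * telescope j (max j N) x + f x) (\<lambda>x. c * g x + h x)"
    by (intro has_rd_add has_rd_scale *)
  moreover have "(\<lambda>x. c * telescope j (max j N) x + f x) \<in> splines0"
    by (intro lin_space_scale lin_space_add * telescope_mem lin_space_splines)
  ultimately show ?case by blast
qed

text \<open>The derivative has the coefficient differences as coefficients; dual functionals show
  that these vanish, so all coefficients agree, and the sum of all B-splines is the indicator
  function.\<close>

lemma has_rd_zeroD:
  assumes "f \<in> splines0" "has_rd f (\<lambda>x. 0)"
  shows "\<exists>c. f = (\<lambda>x. c * of_bool (0 \<le> x \<and> x < 1))"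
proof -
  obtain c where c: "f = (\<lambda>x. \<Sum>j<N. c j * bsp t (Suc q) j x)" using assms(1) by (rule splines0_expand)
  define d where "d j = c j - (if j = 0 then 0 else c (j - 1))" for j
  obtain n where n: "N = Suc n" using q_less_N by (cases N) auto
  have "has_rd f (\<lambda>x. \<Sum>j<N. c j * (real (Suc q) * (nbsp t q j x - nbsp t q (Suc j) x)))"
    unfolding c by (intro has_rd_sum has_rd_scale has_rd_bsp mono)
  from has_rd_unique[OF this assms(2)]
  have "(\<Sum>j<N. c j * (real (Suc q) * (nbsp t q j x - nbsp t q (Suc j) x))) = 0" for x by meson
  then have "real (Suc q) * (\<Sum>j<N. c j * (nbsp t q j x - nbsp t q (Suc j) x)) = 0" for x
    by (simp add: sum_distrib_left mult_ac del: of_nat_Suc)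
  then have "(\<Sum>j<N. c j * (nbsp t q j x - nbsp t q (Suc j) x)) = 0" for x by auto
  then have d0: "(\<lambda>x. \<Sum>j<N. d j * nbsp t q j x) = (\<lambda>x. 0)"
    using sum_diff_by_parts[of c "\<lambda>j. nbsp t q j _" n] nbsp_zero[of N] n
    by (simp add: d_def lessThan_Suc_atMost)
  have dj: "d j = 0" if j: "1 \<le> j" "j < N" for j
  proof -
    obtain \<phi> where \<phi>: "\<phi> \<in> evals {t j<..<t j + 1}" "\<And>k. \<phi> (nbsp t q k) = of_bool (k = j)"
      using dual1[OF j order_refl t_less[OF j] zero_less_one] by blast
    have "0 = \<phi> (\<lambda>x. \<Sum>j<N. d j * nbsp t q j x)" unfolding d0 by (simp add: evals_zero[OF \<phi>(1)])
    also have "\<dots> = (\<Sum>i<N. d i * of_bool (i = j))" by (simp add: evals_sum[OF \<phi>(1)] \<phi>(2))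
    also have "\<dots> = d j" using j by (simp add: of_bool_def if_distrib cong: if_cong)
    finally show ?thesis by simp
  qed
  have "c j = c 0" if "j < N" for j
    using that
  proof (induction j)
    case (Suc j)
    then show ?case using dj[of "Suc j"] by (simp add: d_def)
  qed simp
  then have "f = (\<lambda>x. c 0 * (\<Sum>j<N. bsp t (Suc q) j x))"
    unfolding c sum_distrib_left by (intro ext sum.cong refl) (metis lessThan_iff)
  then show ?thesis unfolding sum_bsp by blast
qed

text \<open>Differentiation of splines is extended to an operator that is linear on all functions,
  by way of the dual functionals. It is a derivative on \<open>splines0\<close> only.\<close>

lemma derivative_operator:
  "\<exists>D. linop D \<and> (\<forall>f\<in>splines0. has_rd f (D f) \<and>
     (\<forall>x. x \<notin> range t \<longrightarrow> (f has_real_derivative D f x) (at x)))"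
proof -
  obtain \<phi> where \<phi>: "\<And>j. j < N \<Longrightarrow> \<phi> j \<in> evals UNIV"
    "\<And>j k. j < N \<Longrightarrow> \<phi> j (bsp t (Suc q) k) = of_bool (k = j)"
    using dual0 by metis
  define b' where "b' j x = real (Suc q) * (nbsp t q j x - nbsp t q (Suc j) x)" for j x
  define D where "D f x = (\<Sum>j<N. \<phi> j f * b' j x)" for f x
  have "linop D" unfolding D_def[abs_def] by (rule linop_evals[of _ _ "\<lambda>_. UNIV"]) (use \<phi> in auto)
  moreover have "has_rd f (D f) \<and> (\<forall>x. x \<notin> range t \<longrightarrow> (f has_real_derivative D f x) (at x))"
    if f: "f \<in> splines0" for f
  proof -
    obtain c where c: "f = (\<lambda>x. \<Sum>j<N. c j * bsp t (Suc q) j x)" using f by (rule splines0_expand)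
    have "\<phi> j f = c j" if j: "j < N" for j
    proof -
      have "\<phi> j f = (\<Sum>i<N. c i * of_bool (i = j))"
        unfolding c by (simp add: evals_sum[OF \<phi>(1)[OF j]] \<phi>(2)[OF j])
      then show ?thesis using j by (simp add: of_bool_def if_distrib cong: if_cong)
    qed
    then have D: "D f = (\<lambda>x. \<Sum>j<N. c j * b' j x)" by (simp add: D_def[abs_def])
    have "has_rd f (D f)"
      unfolding D unfolding c b'_def by (intro has_rd_sum has_rd_scale has_rd_bsp mono)
    moreover have "(f has_real_derivative D f x) (at x)" if x: "x \<notin> range t" for x
      unfolding D unfolding c b'_def
      using bsp_deriv_at[OF mono x, of "Suc q"] by (intro DERIV_sum DERIV_cmult) simp
    ultimately show ?thesis by blast
  qed
  ultimately show ?thesis by blast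
qed

text \<open>\<open>K\<close> sends the \<open>j\<close>-th normalized B-spline to
  \<open>k j\<close>, and \<open>C\<close> contains the defects \<open>g - (K g)'\<close>. By local
  linear independence a function vanishing outside \<open>U\<close> involves only B-splines
  supported in \<open>U\<close>, so the support of \<open>K g\<close> need only be controlled for
  the \<open>k j\<close> of these.\<close>

lemma homotopy_operator:
  assumes "\<And>j. 1 \<le> j \<Longrightarrow> j < N \<Longrightarrow> k j \<in> splines0 \<and> c j \<in> C \<and> has_rd (k j) (\<lambda>x. nbsp t q j x - c j x)"
    and "lin_space C"
  shows "\<exists>K. linop K \<and> (\<forall>g\<in>splines1. K g \<in> splines0 \<and> (\<exists>c\<in>C. has_rd (K g) (\<lambda>x. g x - c x)) \<and>
    (\<forall>U. closed U \<longrightarrow> (\<forall>x. x \<notin> U \<longrightarrow> g x = 0) \<longrightarrow>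
       (\<forall>j. 1 \<le> j \<longrightarrow> j < N \<longrightarrow> {t j..<t (j + Suc q)} \<subseteq> U \<longrightarrow> (\<forall>x. x \<notin> U \<longrightarrow> k j x = 0)) \<longrightarrow>
       (\<forall>x. x \<notin> U \<longrightarrow> K g x = 0)))"
proof -
  have "\<exists>\<phi>\<in>evals UNIV. \<forall>k. \<phi> (nbsp t q k) = of_bool (k = j)" if "j \<in> {1..<N}" for j
  proof -
    have "\<exists>\<phi>\<in>evals {t j<..<t j + 1}. \<forall>k. \<phi> (nbsp t q k) = of_bool (k = j)"
      using t_less[of j] that by (intro dual1) auto
    then show ?thesis using evals_mono[of "{t j<..<t j + 1}" UNIV] by blast
  qed
  then obtain \<phi> where \<phi>: "\<And>j. j \<in> {1..<N} \<Longrightarrow> \<phi> j \<in> evals UNIV"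
    "\<And>j k. j \<in> {1..<N} \<Longrightarrow> \<phi> j (nbsp t q k) = of_bool (k = j)"
    by metis
  define K where "K f x = (\<Sum>j=1..<N. \<phi> j f * k j x)" for f x
  have "linop K" unfolding K_def[abs_def] by (rule linop_evals[of _ _ "\<lambda>_. UNIV"]) (use \<phi> in auto)
  moreover have "K g \<in> splines0 \<and> (\<exists>c\<in>C. has_rd (K g) (\<lambda>x. g x - c x)) \<and>
    (\<forall>U. closed U \<longrightarrow> (\<forall>x. x \<notin> U \<longrightarrow> g x = 0) \<longrightarrow>
       (\<forall>j. 1 \<le> j \<longrightarrow> j < N \<longrightarrow> {t j..<t (j + Suc q)} \<subseteq> U \<longrightarrow> (\<forall>x. x \<notin> U \<longrightarrow> k j x = 0)) \<longrightarrow>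
       (\<forall>x. x \<notin> U \<longrightarrow> K g x = 0))" if g: "g \<in> splines1" for g
  proof -
    obtain a where a0: "g = (\<lambda>x. \<Sum>j<N. a j * nbsp t q j x)" using g by (rule splines1_expand)
    have a: "g = (\<lambda>x. \<Sum>j=1..<N. a j * nbsp t q j x)"
      unfolding a0
    proof
      fix x
      show "(\<Sum>j<N. a j * nbsp t q j x) = (\<Sum>j=1..<N. a j * nbsp t q j x)"
        by (rule sum.mono_neutral_right) (use nbsp_zero[of 0 x] in \<open>auto simp: not_le\<close>)
    qed
    \<comment> \<open>Every dual functional yields the same coefficient. The fixed
      \<open>\<phi> j\<close> define \<open>K\<close>, whereas the support claim chooses a
      functional near a given point.\<close>
    have coeff: "\<psi> g = a j" if "j \<in> {1..<N}" "\<psi> \<in> evals X" "\<And>k. \<psi> (nbsp t q k) = of_bool (k = j)" for \<psi> j X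
    proof -
      have "\<psi> g = (\<Sum>i=1..<N. a i * of_bool (i = j))" unfolding a by (simp add: evals_sum[OF that(2)] that(3))
      then show ?thesis using that(1) by (simp add: of_bool_def if_distrib cong: if_cong)
    qed
    have K: "K g = (\<lambda>x. \<Sum>j=1..<N. a j * k j x)"
      using coeff[OF _ \<phi>] by (simp add: K_def[abs_def])
    have "K g \<in> splines0"
      unfolding K using assms(1) by (intro lin_space_sum lin_space_scale lin_space_splines) auto
    moreover have "\<exists>c\<in>C. has_rd (K g) (\<lambda>x. g x - c x)"
    proof
      show "(\<lambda>x. \<Sum>j=1..<N. a j * c j x) \<in> C"
        using assms(1) by (intro lin_space_sum lin_space_scale assms) auto
      have "has_rd (K g) (\<lambda>x. \<Sum>j=1..<N. a j * (nbsp t q j x - c j x))"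
        unfolding K using assms(1) by (intro has_rd_sum has_rd_scale) auto
      then show "has_rd (K g) (\<lambda>x. g x - (\<Sum>j=1..<N. a j * c j x))"
        unfolding a by (simp add: sum_subtractf right_diff_distrib)
    qed
    moreover have "K g x = 0"
      if U: "closed U" "\<forall>x. x \<notin> U \<longrightarrow> g x = 0" "x \<notin> U"
        "\<forall>j. 1 \<le> j \<longrightarrow> j < N \<longrightarrow> {t j..<t (j + Suc q)} \<subseteq> U \<longrightarrow> (\<forall>x. x \<notin> U \<longrightarrow> k j x = 0)" for U x
    proof -
      have "a j * k j x = 0" if j: "j \<in> {1..<N}" for j
      proof (cases "a j = 0")
        case False
        \<comment> \<open>Near a point of the support outside the closed set \<open>U\<close> there
          is a dual functional that sees only zeros of \<open>g\<close>, and it would force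
          \<open>a j = 0\<close>.\<close>
        have "{t j..<t (j + Suc q)} \<subseteq> U"
        proof
          fix y assume y: "y \<in> {t j..<t (j + Suc q)}"
          show "y \<in> U"
          proof (rule ccontr)
            assume "y \<notin> U"
            then obtain \<epsilon> where \<epsilon>: "\<epsilon> > 0" "ball y \<epsilon> \<subseteq> - U"
              using \<open>closed U\<close> by (metis Compl_iff open_Compl openE)
            obtain \<psi> where \<psi>: "\<psi> \<in> evals {y<..<y + \<epsilon>}" "\<And>k. \<psi> (nbsp t q k) = of_bool (k = j)"
              using dual1[of j y \<epsilon>] j y \<epsilon> by (meson atLeastLessThan_iff)
            have "{y<..<y + \<epsilon>} \<subseteq> ball y \<epsilon>" by (auto simp: dist_real_def)
            then have "\<psi> g = 0" using U(2) \<epsilon> by (intro evals_zero[OF \<psi>(1)]) blast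
            then show False using coeff[OF j \<psi>] False by simp
          qed
        qed
        then show ?thesis using U j by auto
      qed simp
      then show ?thesis unfolding K by (intro sum.neutral) auto
    qed
    ultimately show ?thesis by blast
  qed
  ultimately show ?thesis by blast
qed

end

text \<open>The refinement matrices are indexed by positions in knot lists and may exceed the
  dimensions; the surplus coarse B-splines are 0.\<close>

locale knot_refinement = coarse: knot_seq q N t + fine: knot_seq q N' t'
  for q N t N' t' +
  fixes n0 n1 n0' n1' and a0 a1 :: "nat \<Rightarrow> nat \<Rightarrow> real"
  assumes refines0: "refines (Suc q) t n0 t' n0' a0" "N \<le> n0"
    and refines1: "refines q t n1 t' n1' a1" "N \<le> n1"
begin

lemma splines0_subset: "coarse.splines0 \<subseteq> fine.splines0"
  unfolding coarse.splines0_def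
proof (rule lspan_minimal[OF fine.lin_space_splines(1)], safe)
  fix j
  show "bsp t (Suc q) j \<in> fine.splines0"
  proof (cases "j < N \<and> t j < t (j + Suc q + 1)")
    case True
    then have "nbsp t (Suc q) j = (\<lambda>x. \<Sum>i<n0'. a0 j i * nbsp t' (Suc q) i x)"
      using refines0 unfolding refines_def by auto
    moreover have "nbsp t' (Suc q) i = (\<lambda>x. 1 / (t' (i + Suc q + 1) - t' i) * bsp t' (Suc q) i x)" for i
      by (auto simp: nbsp_def)
    then have "nbsp t' (Suc q) i \<in> fine.splines0" for i
      by (simp only: lin_space_scale[OF fine.lin_space_splines(1) fine.bsp_mem])
    ultimately have *: "nbsp t (Suc q) j \<in> fine.splines0"
      by (simp add: lin_space_sum lin_space_scale fine.lin_space_splines)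
    have "bsp t (Suc q) j = (\<lambda>x. (t (j + Suc q + 1) - t j) * nbsp t (Suc q) j x)"
      by (rule ext) (rule bsp_eq_nbsp[OF coarse.mono])
    then show ?thesis using lin_space_scale[OF fine.lin_space_splines(1) *] by simp
  next
    case False
    then have "bsp t (Suc q) j = (\<lambda>x. 0)"
      using coarse.bsp_zero[of j] bsp_degenerate[OF coarse.mono, of j "Suc q"] by (auto simp: not_less)
    then show ?thesis by (simp add: lin_space_zero fine.lin_space_splines)
  qed
qed

lemma splines1_subset: "coarse.splines1 \<subseteq> fine.splines1"
  unfolding coarse.splines1_def
proof (rule lspan_minimal[OF fine.lin_space_splines(2)], safe)
  fix j
  show "nbsp t q j \<in> fine.splines1"
  proof (cases "j < N \<and> t j < t (j + q + 1)")
    case True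
    then have "nbsp t q j = (\<lambda>x. \<Sum>i<n1'. a1 j i * nbsp t' q i x)"
      using refines1 unfolding refines_def by auto
    then show ?thesis
      using lin_space_sum[OF fine.lin_space_splines(2) lin_space_scale[OF fine.lin_space_splines(2) fine.nbsp_mem]]
      by simp
  next
    case False
    then have "nbsp t q j = (\<lambda>x. 0)"
      using coarse.nbsp_zero[of j] nbsp_degenerate[OF coarse.mono, of j q] by (auto simp: not_less)
    then show ?thesis by (simp add: lin_space_zero fine.lin_space_splines)
  qed
qed

text \<open>\<open>g\<close> also has a coarse primitive. The two primitives differ by a constant on
  the unit interval, which is coarse by the partition of unity.\<close>

lemma coarse_if_deriv_coarse:
  assumes "f \<in> fine.splines0" "has_rd f g" "g \<in> coarse.splines1"
  shows "f \<in> coarse.splines0"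
proof -
  obtain h where h: "h \<in> coarse.splines0" "has_rd h g" using coarse.antiderivative[OF assms(3)] by blast
  have "(\<lambda>x. f x - h x) \<in> fine.splines0"
    using h splines0_subset assms by (intro lin_space_diff fine.lin_space_splines) auto
  moreover have "has_rd (\<lambda>x. f x - h x) (\<lambda>x. 0)" using has_rd_diff[OF assms(2) h(2)] by simp
  ultimately obtain c where c: "(\<lambda>x. f x - h x) = (\<lambda>x. c * of_bool (0 \<le> x \<and> x < 1))"
    using fine.has_rd_zeroD by blast
  have "(\<lambda>x. c * (\<Sum>j<N. bsp t (Suc q) j x)) \<in> coarse.splines0"
    by (rule lin_space_scale[OF coarse.lin_space_splines(1)
          lin_space_sum[OF coarse.lin_space_splines(1) coarse.bsp_mem]])
  then have "(\<lambda>x. h x + (f x - h x)) \<in> coarse.splines0"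
    using lin_space_add[OF coarse.lin_space_splines(1) h(1), of "\<lambda>x. f x - h x"]
    unfolding c coarse.sum_bsp by simp
  then show ?thesis by simp
qed

text \<open>\<open>\<kappa> j\<close> selects the coarse B-spline that is subtracted from the
  \<open>j\<close>-th fine one. The condition on \<open>U\<close> asks that the hull of both
  supports stay in \<open>U\<close> whenever the fine support does.\<close>

lemma two_level_homotopy:
  assumes \<kappa>: "\<And>j. 1 \<le> j \<Longrightarrow> j < N' \<Longrightarrow> 1 \<le> \<kappa> j \<and> \<kappa> j < N"
  shows "\<exists>K. linop K \<and> (\<forall>g\<in>fine.splines1. K g \<in> fine.splines0 \<and>
    (\<exists>c\<in>coarse.splines1. has_rd (K g) (\<lambda>x. g x - c x)) \<and>
    (\<forall>U. closed U \<longrightarrow> (\<forall>x. x \<notin> U \<longrightarrow> g x = 0) \<longrightarrow>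
       (\<forall>j. 1 \<le> j \<longrightarrow> j < N' \<longrightarrow> {t' j..<t' (j + Suc q)} \<subseteq> U \<longrightarrow>
          {min (t' j) (t (\<kappa> j))..<max (t' (j + Suc q)) (t (\<kappa> j + Suc q))} \<subseteq> U) \<longrightarrow>
       (\<forall>x. x \<notin> U \<longrightarrow> K g x = 0)))"
proof -
  \<comment> \<open>A primitive of the difference of the fine B-splines \<open>j\<close> and
    \<open>i\<close>, in whichever order the indices come.\<close>
  define E where "E j i = (if j \<le> i then fine.telescope j i else (\<lambda>x. - 1 * fine.telescope i j x))" for j i
  have E_mem: "E j i \<in> fine.splines0" for j i
    using fine.telescope_mem lin_space_scale[OF fine.lin_space_splines(1) fine.telescope_mem, of "- 1"]
    by (auto simp: E_def)
  have E_rd: "has_rd (E j i) (\<lambda>x. nbsp t' q j x - nbsp t' q i x)" for j i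
  proof (cases "j \<le> i")
    case False
    then have "i \<le> j" by simp
    from has_rd_scale[OF fine.has_rd_telescope[OF this], of "- 1"] show ?thesis
      using False by (simp add: E_def)
  qed (simp add: E_def fine.has_rd_telescope)
  have E_supp: "min (t' j) (t' i) \<le> x \<and> x < max (t' (j + Suc q)) (t' (i + Suc q))"
    if "E j i x \<noteq> 0" for i j x
    using that fine.telescope_nonzeroD[of j i x] fine.telescope_nonzeroD[of i j x]
    by (auto simp: E_def split: if_splits)
  \<comment> \<open>As the weights sum to 1, averaging the differences of fine B-splines gives the
    fine B-spline minus the coarse one: conservation of the integral makes this primitive
    local.\<close>
  define k where "k j x = (\<Sum>i<n1'. a1 (\<kappa> j) i * E j i x)" for j x
  have ref: "(\<forall>x. nbsp t q (\<kappa> j) x = (\<Sum>i<n1'. a1 (\<kappa> j) i * nbsp t' q i x)) \<and> (\<Sum>i<n1'. a1 (\<kappa> j) i) = 1 \<and>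
       (\<forall>i<n1'. a1 (\<kappa> j) i \<noteq> 0 \<longrightarrow> t (\<kappa> j) \<le> t' i \<and> t' (i + q + 1) \<le> t (\<kappa> j + q + 1))"
    if "1 \<le> j" "j < N'" for j
  proof -
    have "t (\<kappa> j) < t (\<kappa> j + q + 1)" using coarse.t_less[of "\<kappa> j"] \<kappa>[OF that] by simp
    then show ?thesis using refines1 \<kappa>[OF that] unfolding refines_def by auto
  qed
  have k: "k j \<in> fine.splines0 \<and> nbsp t q (\<kappa> j) \<in> coarse.splines1 \<and>
     has_rd (k j) (\<lambda>x. nbsp t' q j x - nbsp t q (\<kappa> j) x)" if j: "1 \<le> j" "j < N'" for j
  proof (intro conjI)
    show "k j \<in> fine.splines0"
      unfolding k_def[abs_def]
      by (rule lin_space_sum[OF fine.lin_space_splines(1) lin_space_scale[OF fine.lin_space_splines(1) E_mem]])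
    show "nbsp t q (\<kappa> j) \<in> coarse.splines1" by (rule coarse.nbsp_mem)
    have "has_rd (k j) (\<lambda>x. \<Sum>i<n1'. a1 (\<kappa> j) i * (nbsp t' q j x - nbsp t' q i x))"
      unfolding k_def[abs_def] by (intro has_rd_sum has_rd_scale E_rd)
    also have "(\<lambda>x. \<Sum>i<n1'. a1 (\<kappa> j) i * (nbsp t' q j x - nbsp t' q i x)) =
        (\<lambda>x. nbsp t' q j x - nbsp t q (\<kappa> j) x)"
      using ref[OF j] by (simp add: right_diff_distrib sum_subtractf flip: sum_distrib_right)
    finally show "has_rd (k j) (\<lambda>x. nbsp t' q j x - nbsp t q (\<kappa> j) x)" .
  qed
  have supp: "k j x = 0"
    if j: "1 \<le> j" "j < N'"
      and x: "x \<notin> {min (t' j) (t (\<kappa> j))..<max (t' (j + Suc q)) (t (\<kappa> j + Suc q))}" for j x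
    unfolding k_def
  proof (intro sum.neutral ballI)
    fix i assume "i \<in> {..<n1'}"
    then show "a1 (\<kappa> j) i * E j i x = 0"
      using ref[OF j] E_supp[of j i x] x by (cases "a1 (\<kappa> j) i = 0") fastforce+
  qed
  obtain K where K: "linop K"
    "\<forall>g\<in>fine.splines1. K g \<in> fine.splines0 \<and> (\<exists>c\<in>coarse.splines1. has_rd (K g) (\<lambda>x. g x - c x)) \<and>
    (\<forall>U. closed U \<longrightarrow> (\<forall>x. x \<notin> U \<longrightarrow> g x = 0) \<longrightarrow>
       (\<forall>j. 1 \<le> j \<longrightarrow> j < N' \<longrightarrow> {t' j..<t' (j + Suc q)} \<subseteq> U \<longrightarrow> (\<forall>x. x \<notin> U \<longrightarrow> k j x = 0)) \<longrightarrow>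
       (\<forall>x. x \<notin> U \<longrightarrow> K g x = 0))"
    using fine.homotopy_operator[of k "\<lambda>j. nbsp t q (\<kappa> j)", OF k coarse.lin_space_splines(2)] by blast
  show ?thesis
  proof (intro exI[of _ K] conjI ballI allI impI)
    fix g U x
    assume *: "g \<in> fine.splines1" "closed U" "\<forall>x. x \<notin> U \<longrightarrow> g x = 0" "x \<notin> U"
      "\<forall>j. 1 \<le> j \<longrightarrow> j < N' \<longrightarrow> {t' j..<t' (j + Suc q)} \<subseteq> U \<longrightarrow>
          {min (t' j) (t (\<kappa> j))..<max (t' (j + Suc q)) (t (\<kappa> j + Suc q))} \<subseteq> U"
    have "\<forall>j. 1 \<le> j \<longrightarrow> j < N' \<longrightarrow> {t' j..<t' (j + Suc q)} \<subseteq> U \<longrightarrow> (\<forall>x. x \<notin> U \<longrightarrow> k j x = 0)"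
      using supp *(5) by blast
    then show "K g x = 0" using K(2) * by blast
  qed (use K in blast)+
qed

end

context knot_seq
begin

text \<open>Nothing is subtracted here, so primitives may run up to the right end; therefore only
  the empty set and the whole interval are respected as supports.\<close>

lemma one_level_homotopy:
  "\<exists>K. linop K \<and> (\<forall>g\<in>splines1. K g \<in> splines0 \<and> has_rd (K g) g \<and>
    (\<forall>U. U = {} \<or> U = {0..1} \<longrightarrow> (\<forall>x. x \<notin> U \<longrightarrow> g x = 0) \<longrightarrow> (\<forall>x. x \<notin> U \<longrightarrow> K g x = 0)))"
proof -
  have k: "telescope j N \<in> splines0 \<and> (\<lambda>x. 0) \<in> {\<lambda>x. 0 :: real} \<and>
    has_rd (telescope j N) (\<lambda>x. nbsp t q j x - (\<lambda>x. 0) x)" if "1 \<le> j" "j < N" for j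
    using telescope_mem has_rd_telescope[of j N] that by (simp add: nbsp_zero)
  have "lin_space {\<lambda>x. 0 :: real}" by (auto simp: lin_space_def)
  from homotopy_operator[of "\<lambda>j. telescope j N" "\<lambda>j x. 0", OF k this] obtain K where K: "linop K"
    "\<forall>g\<in>splines1. K g \<in> splines0 \<and> (\<exists>c\<in>{\<lambda>x. 0}. has_rd (K g) (\<lambda>x. g x - c x)) \<and>
    (\<forall>U. closed U \<longrightarrow> (\<forall>x. x \<notin> U \<longrightarrow> g x = 0) \<longrightarrow>
       (\<forall>j. 1 \<le> j \<longrightarrow> j < N \<longrightarrow> {t j..<t (j + Suc q)} \<subseteq> U \<longrightarrow> (\<forall>x. x \<notin> U \<longrightarrow> telescope j N x = 0)) \<longrightarrow>
       (\<forall>x. x \<notin> U \<longrightarrow> K g x = 0))" by blast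
  have KS: "K g x = 0" if "g \<in> splines1" "closed U" "\<forall>x. x \<notin> U \<longrightarrow> g x = 0"
    "\<And>j. 1 \<le> j \<Longrightarrow> j < N \<Longrightarrow> {t j..<t (j + Suc q)} \<subseteq> U \<Longrightarrow> \<forall>x. x \<notin> U \<longrightarrow> telescope j N x = 0"
    "x \<notin> U" for g U x
    using K(2) that by blast
  have supp: "\<forall>x. x \<notin> U \<longrightarrow> telescope j N x = 0"
    if "U = {} \<or> U = {0..1}" "1 \<le> j" "j < N" "{t j..<t (j + Suc q)} \<subseteq> U" for U j
    using that t_less[of j] splines_support[of "telescope j N"] telescope_mem[of j N] by force
  show ?thesis
  proof (intro exI[of _ K] conjI ballI allI impI)
    fix g and U :: "real set" and x
    assume *: "g \<in> splines1" "U = {} \<or> U = {0..1}" "\<forall>x. x \<notin> U \<longrightarrow> g x = 0" "x \<notin> U"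
    then have "closed U" by auto
    from KS[OF *(1) this *(3) supp *(4)] show "K g x = 0" using *(2) by blast
  qed (use K in \<open>simp_all\<close>)
qed

end

section \<open>Open knot vectors of a mesh\<close>

lemma length_concat_replicate: "length (concat (map (replicate m) zs)) = m * length zs"
  by (induction zs) auto

lemma nth_concat_replicate:
  assumes "i < m * length zs"
  shows "concat (map (replicate m) zs) ! i = zs ! (i div m)"
  using assms
proof (induction zs arbitrary: i)
  case (Cons z zs)
  show ?case
  proof (cases "i < m")
    case False
    moreover have "0 < m" using Cons.prems by (cases m) auto
    ultimately have "i div m = Suc ((i - m) div m)" using le_div_geq by simp
    then show ?thesis using False Cons by (simp add: nth_append)
  qed (simp add: nth_append)
qed simp

lemma count_concat_replicate:
  "count (mset (concat (map (replicate m) zs))) v = m * count (mset zs) v"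
  by (induction zs) auto

lemma sorted_concat_replicate: "sorted zs \<Longrightarrow> sorted (concat (map (replicate m) zs))"
  by (induction zs) (auto simp: sorted_append)

lemma breakpoint_seqD:
  assumes "breakpoint_seq \<eta> xs"
  obtains zs where "xs = 0 # zs @ [1]" "sorted_wrt (<) xs"
proof -
  have *: "2 \<le> length xs" "hd xs = 0" "last xs = 1" "sorted_wrt (<) xs"
    using assms by (auto simp: breakpoint_seq_def)
  then obtain y ys where "xs = y # ys" by (cases xs) auto
  moreover from this * have "ys \<noteq> []" by auto
  ultimately have "xs = 0 # butlast ys @ [1]" using * by (metis append_butlast_last_id last_ConsR list.sel(1))
  then show ?thesis using that * by blast
qed

locale breakpoints =
  fixes xs zs :: "real list"
  assumes xs: "xs = 0 # zs @ [1]" and strict: "sorted_wrt (<) xs"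
begin

lemma zs_range: "z \<in> set zs \<Longrightarrow> 0 < z \<and> z < 1"
  using strict by (auto simp: xs sorted_wrt_append)

lemma sorted_zs: "sorted_wrt (<) zs"
  using strict by (auto simp: xs sorted_wrt_append)

lemma knots_eq: "knots s m xs = replicate (s + 1) 0 @ concat (map (replicate m) zs) @ replicate (s + 1) 1"
  by (simp add: knots_def xs)

lemma length_knots: "length (knots s m xs) = 2 * (s + 1) + m * length zs"
  by (simp add: knots_eq length_concat_replicate)

lemma sorted_knots: "sorted (knots s m xs)"
  using zs_range sorted_concat_replicate[OF strict_sorted_imp_sorted[OF sorted_zs]]
  by (auto simp: knots_eq sorted_append less_imp_le)

lemma set_knots: "set (knots s m xs) \<subseteq> {..1}"
  using zs_range by (force simp: knots_eq)

lemma knot_fun_knots: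
  assumes "0 < m"
  shows "knot_fun (knots s m xs) i =
    (if i < s + 1 then 0 else if i < s + 1 + m * length zs then zs ! ((i - (s + 1)) div m) else 1)"
  using assms
  by (auto simp: knot_fun_def length_knots)
    (auto simp: knots_eq nth_append length_concat_replicate nth_concat_replicate simp del: replicate_Suc)

text \<open>The condition \<open>m \<le> Suc q\<close> is what makes \<open>Suc q\<close> steps in
  the knot vector leave any interior breakpoint.\<close>

lemma knot_seq_knots:
  assumes "1 \<le> m" "m \<le> Suc q"
  shows "knot_seq q (length (knots (Suc q) m xs) - (Suc q + 1)) (knot_fun (knots (Suc q) m xs))"
proof -
  let ?t = "knot_fun (knots (Suc q) m xs)"
  have m: "0 < m" using assms by simp
  note T = knot_fun_knots[OF m, of "Suc q"]
  have N: "length (knots (Suc q) m xs) - (Suc q + 1) = Suc q + 1 + m * length zs"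
    by (simp add: length_knots)
  have zs_mem: "zs ! k \<in> set zs" if "k < length zs" for k using that by simp
  show ?thesis unfolding N
  proof
    show "mono ?t" by (rule mono_knot_fun[OF sorted_knots set_knots])
    fix j assume j: "1 \<le> j" "j < Suc q + 1 + m * length zs"
    have k: "(i - (Suc q + 1)) div m < length zs" if "\<not> i < Suc q + 1" "i < Suc q + 1 + m * length zs" for i
      using that m by (simp add: less_mult_imp_div_less mult.commute)
    show "?t j < ?t (j + Suc q)"
    proof (cases "j < Suc q + 1")
      case True
      have "0 < ?t (j + Suc q)"
        using j zs_range[OF zs_mem[OF k[of "j + Suc q"]]] unfolding T by auto
      then show ?thesis using True by (simp add: T)
    next
      case False
      note kj = k[OF this j(2)]
      show ?thesis
      proof (cases "j + Suc q < Suc q + 1 + m * length zs")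
        case True
        have "(j - (Suc q + 1)) div m < (j - (Suc q + 1) + m) div m" using m by simp
        also have "\<dots> \<le> (j + Suc q - (Suc q + 1)) div m" using assms False by (intro div_le_mono) simp
        finally have "zs ! ((j - (Suc q + 1)) div m) < zs ! ((j + Suc q - (Suc q + 1)) div m)"
          using k[OF _ True] False by (intro sorted_wrt_nth_less[OF sorted_zs]) auto
        then show ?thesis using False True j by (simp add: T)
      next
        case False
        then show ?thesis using zs_range[OF zs_mem[OF kj]] \<open>\<not> j < Suc q + 1\<close> j by (simp add: T)
      qed
    qed
  qed (auto simp: T)
qed

text \<open>The two equations together identify \<open>s + m * k\<close> as the index of the last
  knot equal to the breakpoint \<open>xs ! k\<close>.\<close>

lemma knot_at_breakpoint:
  assumes "1 \<le> m" "k < length xs - 1"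
  shows "knot_fun (knots s m xs) (s + m * k) = xs ! k"
    and "knot_fun (knots s m xs) (Suc (s + m * k)) = xs ! Suc k"
proof -
  have m: "0 < m" using assms by simp
  note T = knot_fun_knots[OF m, of s]
  have k: "k \<le> length zs" using assms by (simp add: xs)
  show "knot_fun (knots s m xs) (s + m * k) = xs ! k"
  proof (cases k)
    case (Suc j)
    have "(m * k - 1) div m = j"
      using m Suc by (intro div_nat_eqI) (auto simp: algebra_simps)
    moreover have "m * k \<ge> 1" using m Suc by simp
    moreover have "m * k < Suc (m * length zs)" using k by (simp add: less_Suc_eq_le)
    moreover have "xs ! k = zs ! j" using Suc k by (simp add: xs nth_append)
    ultimately show ?thesis
      using m unfolding T by auto
  qed (use m in \<open>simp add: T, simp add: xs\<close>)
  show "knot_fun (knots s m xs) (Suc (s + m * k)) = xs ! Suc k"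
    using k m unfolding T by (auto simp: xs nth_append)
qed

end

text \<open>Bisection only adds breakpoints and all interior multiplicities are \<open>m\<close>, so
  the knots are included as multisets. The degrees \<open>s\<close> and \<open>r\<close> are
  separate because degree \<open>q\<close> is also treated on the knots of degree
  \<open>Suc q\<close>.\<close>

lemma refines_bisected:
  assumes "breakpoint_seq \<eta> xs" "breakpoint_seq \<eta> ys" "bisected xs ys"
  shows "\<exists>a. refines s (knot_fun (knots r m xs)) (length (knots r m xs))
    (knot_fun (knots r m ys)) (length (knots r m ys)) a"
proof -
  obtain zs where zs: "xs = 0 # zs @ [1]" "sorted_wrt (<) xs" using breakpoint_seqD[OF assms(1)] .
  obtain ws where ws: "ys = 0 # ws @ [1]" "sorted_wrt (<) ys" using breakpoint_seqD[OF assms(2)] .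
  interpret X: breakpoints xs zs by unfold_locales (use zs in auto)
  interpret Y: breakpoints ys ws by unfold_locales (use ws in auto)
  have "set zs \<subseteq> set ws"
  proof
    fix z assume z: "z \<in> set zs"
    then obtain k where k: "k < length xs" "xs ! k = z" using in_set_conv_nth[of z xs] zs by auto
    then have "ys ! (2 * k) = z" "2 * k < length ys" using assms(3) by (auto simp: bisected_def)
    then have "z \<in> set ys" by (metis nth_mem)
    then show "z \<in> set ws" using X.zs_range[OF z] ws by auto
  qed
  moreover have "distinct zs" "distinct ws"
    using X.sorted_zs Y.sorted_zs by (auto simp: strict_sorted_iff)
  ultimately have "mset zs \<subseteq># mset ws"
    by (intro mset_subset_eqI) (auto simp: distinct_count_atmost_1)
  then have "mset (concat (map (replicate m) zs)) \<subseteq># mset (concat (map (replicate m) ws))"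
    by (intro mset_subset_eqI) (simp add: count_concat_replicate mset_subset_eq_count)
  then have "mset (knots r m xs) \<subseteq># mset (knots r m ys)"
    unfolding X.knots_eq Y.knots_eq by simp
  then show ?thesis
    using refines_knot_fun X.sorted_knots Y.sorted_knots Y.set_knots by blast
qed

definition sum_space :: "('a \<Rightarrow> real) set \<Rightarrow> ('a \<Rightarrow> real) set \<Rightarrow> ('a \<Rightarrow> real) set" where
  "sum_space V W = {\<lambda>x. f x + g x | f g. f \<in> V \<and> g \<in> W}"

lemma sum_spaceI: "f \<in> V \<Longrightarrow> g \<in> W \<Longrightarrow> (\<lambda>x. f x + g x) \<in> sum_space V W"
  by (auto simp: sum_space_def)

lemma sum_spaceE:
  assumes "h \<in> sum_space V W"
  obtains f g where "f \<in> V" "g \<in> W" "h = (\<lambda>x. f x + g x)"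
  using assms by (auto simp: sum_space_def)

lemma lin_space_sum_space:
  assumes "lin_space V" "lin_space W"
  shows "lin_space (sum_space V W)"
  unfolding lin_space_def
proof (intro conjI ballI allI)
  show "(\<lambda>x. 0) \<in> sum_space V W"
    using sum_spaceI[OF lin_space_zero[OF assms(1)] lin_space_zero[OF assms(2)]] by simp
next
  fix h h' assume "h \<in> sum_space V W" "h' \<in> sum_space V W"
  then obtain f g f' g' where *: "f \<in> V" "g \<in> W" "f' \<in> V" "g' \<in> W"
    "h = (\<lambda>x. f x + g x)" "h' = (\<lambda>x. f' x + g' x)" by (elim sum_spaceE) blast
  have "(\<lambda>x. h x + h' x) = (\<lambda>x. (f x + f' x) + (g x + g' x))" by (simp add: * algebra_simps)
  then show "(\<lambda>x. h x + h' x) \<in> sum_space V W"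
    using sum_spaceI[OF lin_space_add[OF assms(1) *(1,3)] lin_space_add[OF assms(2) *(2,4)]] by simp
next
  fix c h assume "h \<in> sum_space V W"
  then obtain f g where *: "f \<in> V" "g \<in> W" "h = (\<lambda>x. f x + g x)" by (elim sum_spaceE) blast
  have "(\<lambda>x. c * h x) = (\<lambda>x. c * f x + c * g x)" by (simp add: * algebra_simps)
  then show "(\<lambda>x. c * h x) \<in> sum_space V W"
    using sum_spaceI[OF lin_space_scale[OF assms(1) *(1)] lin_space_scale[OF assms(2) *(2)]] by simp
qed

lemma subset_sum_space:
  assumes "lin_space V" "lin_space W"
  shows "V \<subseteq> sum_space V W" "W \<subseteq> sum_space V W"
  using sum_spaceI[OF _ lin_space_zero[OF assms(2)]] sum_spaceI[OF lin_space_zero[OF assms(1)]] by auto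

lemma sum_space_minimal:
  assumes "lin_space U" "V \<subseteq> U" "W \<subseteq> U"
  shows "sum_space V W \<subseteq> U"
  using assms by (auto elim!: sum_spaceE intro!: lin_space_add)

section \<open>Tensor products and partial operators\<close>

definition upd :: "real ^ 'n \<Rightarrow> 'n \<Rightarrow> real \<Rightarrow> real ^ 'n" where
  "upd x i t = (\<chi> j. if j = i then t else x $ j)"

definition tensor :: "('n::finite \<Rightarrow> real \<Rightarrow> real) \<Rightarrow> real ^ 'n \<Rightarrow> real" where
  "tensor f x = (\<Prod>i\<in>UNIV. f i (x $ i))"

definition tensor_space :: "('n::finite \<Rightarrow> (real \<Rightarrow> real) set) \<Rightarrow> (real ^ 'n \<Rightarrow> real) set" where
  "tensor_space W = lspan {tensor f | f. \<forall>i. f i \<in> W i}"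

definition lift_op ::
  "((real \<Rightarrow> real) \<Rightarrow> real \<Rightarrow> real) \<Rightarrow> 'n \<Rightarrow> (real ^ 'n \<Rightarrow> real) \<Rightarrow> real ^ 'n \<Rightarrow> real" where
  "lift_op T i F x = T (\<lambda>t. F (upd x i t)) (x $ i)"

lemma upd_nth [simp]: "upd x i t $ j = (if j = i then t else x $ j)"
  by (simp add: upd_def)

lemma upd_upd [simp]: "upd (upd x i t) i u = upd x i u"
  by (simp add: vec_eq_iff)

lemma upd_self [simp]: "upd x i (x $ i) = x"
  by (simp add: vec_eq_iff)

lemma tensor_upd: "tensor f (upd x i t) = (\<Prod>j\<in>UNIV - {i}. f j (x $ j)) * f i t"
  by (simp add: tensor_def prod.remove[of UNIV i] mult.commute)

lemma lin_space_tensor_space: "lin_space (tensor_space W)"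
  unfolding tensor_space_def by (rule lin_space_lspan)

lemma tensor_space_mono: "(\<And>i. W i \<subseteq> W' i) \<Longrightarrow> tensor_space W \<subseteq> tensor_space W'"
  unfolding tensor_space_def by (rule lspan_subset) (blast intro: lspan_base)

lemma tensor_space_UNIV: "F \<in> tensor_space W \<Longrightarrow> F \<in> tensor_space (\<lambda>_. UNIV)"
  using tensor_space_mono[of W "\<lambda>_. UNIV"] by blast

lemma linop_lincomb:
  "linop T \<Longrightarrow> T (\<lambda>x. \<Sum>i\<in>A. c i * f i x) = (\<lambda>x. \<Sum>i\<in>A. c i * T (f i) x)"
  using linop_sum[of T "\<lambda>i x. c i * f i x" A] by (simp add: linop_scale)

lemma linop_step: "linop T \<Longrightarrow> T (\<lambda>x. c * f x + g x) = (\<lambda>x. c * T f x + T g x)"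
  using linop_add[of T "\<lambda>x. c * f x" g] by (simp add: linop_scale)

lemma linop_lift_op: "linop T \<Longrightarrow> linop (lift_op T i)"
  unfolding linop_def lift_op_def by simp

lemma lift_op_tensor:
  assumes "linop T"
  shows "lift_op T i (tensor f) = tensor (f(i := T (f i)))"
proof
  fix x
  have "lift_op T i (tensor f) x = (\<Prod>j\<in>UNIV - {i}. f j (x $ j)) * T (f i) (x $ i)"
    unfolding lift_op_def tensor_upd by (simp add: linop_scale[OF assms])
  also have "\<dots> = tensor (f(i := T (f i))) x"
    by (simp add: tensor_def prod.remove[of UNIV i] mult.commute)
  finally show "lift_op T i (tensor f) x = tensor (f(i := T (f i))) x" .
qed

lemma lift_op_mem:
  assumes T: "linop T" and F: "F \<in> tensor_space W"
    and "\<And>f. f \<in> W i \<Longrightarrow> T f \<in> W' i" "\<And>j. j \<noteq> i \<Longrightarrow> W j \<subseteq> W' j"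
  shows "lift_op T i F \<in> tensor_space W'"
  using F unfolding tensor_space_def
proof induction
  case zero
  then show ?case by (simp add: linop_zero[OF linop_lift_op[OF T]] lspan.zero)
next
  case (step f g c)
  then obtain h where h: "f = tensor h" "\<And>i. h i \<in> W i" by blast
  have "\<forall>j. (h(i := T (h i))) j \<in> W' j" using assms h by auto
  then have "lift_op T i f \<in> {tensor f |f. \<forall>i. f i \<in> W' i}"
    unfolding h lift_op_tensor[OF T] by blast
  then show ?case
    unfolding linop_step[OF linop_lift_op[OF T]] using step by (intro lspan.step)
qed

lemma slice_mem:
  assumes "F \<in> tensor_space W" "lin_space (W i)"
  shows "(\<lambda>t. F (upd x i t)) \<in> W i"
  using assms(1) unfolding tensor_space_def
proof induction
  case (step f g c)
  then obtain h where "f = tensor h" "\<And>i. h i \<in> W i" by blast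
  then have "(\<lambda>t. f (upd x i t)) \<in> W i"
    unfolding tensor_upd by (simp add: lin_space_scale[OF assms(2)] tensor_upd)
  then show ?case using step by (intro lin_space_add lin_space_scale assms(2))
qed (simp add: lin_space_zero assms(2))

text \<open>On a tensor product the operators act on different factors; linearity extends this to
  the span. Tensor structure is essential here, since linearity alone does not make operators on
  different variables commute.\<close>

lemma lift_op_commute:
  assumes "linop T" "linop S" "i \<noteq> j" "F \<in> tensor_space W"
  shows "lift_op T i (lift_op S j F) = lift_op S j (lift_op T i F)"
  using assms(4) unfolding tensor_space_def
proof induction
  case (step f g c)
  then obtain h where h: "f = tensor h" by blast
  have "lift_op T i (lift_op S j f) = lift_op S j (lift_op T i f)"
    unfolding h lift_op_tensor[OF assms(1)] lift_op_tensor[OF assms(2)]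
    using assms(3) by (simp add: fun_upd_twist)
  then show ?case using step
    by (simp add: linop_step[OF linop_lift_op[OF assms(1)]] linop_step[OF linop_lift_op[OF assms(2)]])
qed (use assms in \<open>simp add: linop_zero linop_lift_op\<close>)

lemma lift_op_lift_op: "lift_op T i (lift_op S i F) = lift_op (\<lambda>f. T (S f)) i F"
  by (simp add: lift_op_def fun_eq_iff)

text \<open>\<open>lift_op\<close> acts on each line parallel to an axis separately, so a support
  condition in space reduces to one for univariate functions on the slices of
  \<open>A\<close>.\<close>

lemma lift_op_support:
  assumes "F \<in> tensor_space W" "lin_space (W i)" "\<And>x. x \<notin> A \<Longrightarrow> F x = 0"
    and "\<And>f x t. f \<in> W i \<Longrightarrow> (\<And>t. upd x i t \<notin> A \<Longrightarrow> f t = 0) \<Longrightarrow> upd x i t \<notin> A \<Longrightarrow> T f t = 0"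
    and "x \<notin> A"
  shows "lift_op T i F x = 0"
  unfolding lift_op_def
  by (rule assms(4)[of _ x]) (use slice_mem[OF assms(1,2)] assms(3,5) in auto)

section \<open>Exterior calculus with partial operators\<close>

definition sgnc :: "'n::linorder \<Rightarrow> 'n set \<Rightarrow> real" where
  "sgnc i J = (-1) ^ card {j\<in>J. j < i}"

lemma sgnc_square: "sgnc i J * sgnc i J = 1"
  by (simp add: sgnc_def flip: power_mult_distrib)

lemma sgnc_insert_self: "sgnc i (insert i J) = sgnc i J"
proof -
  have "{j \<in> insert i J. j < i} = {j \<in> J. j < i}" by auto
  then show ?thesis by (simp add: sgnc_def)
qed

lemma sgnc_insert:
  fixes J :: "'n::{finite,linorder} set"
  assumes "j \<notin> J"
  shows "sgnc i (insert j J) = (if j < i then - sgnc i J else sgnc i J)"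
proof (cases "j < i")
  case True
  then have "{k \<in> insert j J. k < i} = insert j {k \<in> J. k < i}" by auto
  then show ?thesis using True assms by (simp add: sgnc_def)
next
  case False
  then have "{k \<in> insert j J. k < i} = {k \<in> J. k < i}" by auto
  then show ?thesis using False by (simp add: sgnc_def)
qed

lemma sgnc_swap:
  fixes J :: "'n::{finite,linorder} set"
  assumes "i \<noteq> j" "i \<notin> J" "j \<notin> J"
  shows "sgnc i (insert i (insert j J)) * sgnc j (insert j J) =
    - (sgnc j (insert i (insert j J)) * sgnc i (insert i J))"
  using assms by (auto simp: sgnc_insert)

definition ext_d ::
  "('n \<Rightarrow> (real \<Rightarrow> real) \<Rightarrow> real \<Rightarrow> real) \<Rightarrow> 'n::{finite,linorder} form \<Rightarrow> 'n form" where
  "ext_d D \<omega> J x = (\<Sum>i\<in>J. sgnc i J * lift_op (D i) i (\<omega> (J - {i})) x)"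

text \<open>Interior product with the \<open>i\<close>-th coordinate vector, followed by
  \<open>T\<close> along that direction: a Poincare homotopy in a single variable when
  \<open>T\<close> is a primitive.\<close>

definition contract ::
  "((real \<Rightarrow> real) \<Rightarrow> real \<Rightarrow> real) \<Rightarrow> 'n \<Rightarrow> 'n::{finite,linorder} form \<Rightarrow> 'n form" where
  "contract T i \<omega> J x = (if i \<in> J then 0 else sgnc i J * lift_op T i (\<omega> (insert i J)) x)"

definition forms :: "('n set \<Rightarrow> (real ^ 'n \<Rightarrow> real) set) \<Rightarrow> nat \<Rightarrow> 'n form set" where
  "forms P k = {\<omega>. (\<forall>I. card I = k \<longrightarrow> \<omega> I \<in> P I) \<and> (\<forall>I. card I \<noteq> k \<longrightarrow> \<omega> I = (\<lambda>x. 0))}"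

lemma forms_mem: "\<omega> \<in> forms P k \<Longrightarrow> (\<And>I. lin_space (P I)) \<Longrightarrow> \<omega> I \<in> P I"
  by (cases "card I = k") (auto simp: forms_def lin_space_zero)

lemma formsI:
  "(\<And>I. card I = k \<Longrightarrow> \<omega> I \<in> P I) \<Longrightarrow> (\<And>I x. card I \<noteq> k \<Longrightarrow> \<omega> I x = 0) \<Longrightarrow> \<omega> \<in> forms P k"
  by (auto simp: forms_def)

lemma forms_zero: "\<omega> \<in> forms P k \<Longrightarrow> card I \<noteq> k \<Longrightarrow> \<omega> I = (\<lambda>x. 0)"
  by (simp add: forms_def)

lemma forms_add:
  assumes "\<And>I. lin_space (P I)" "\<omega> \<in> forms P k" "\<eta> \<in> forms P k"
  shows "(\<lambda>I x. \<omega> I x + \<eta> I x) \<in> forms P k"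
  using assms(2,3) by (auto simp: forms_def intro: lin_space_add[OF assms(1)])

lemma forms_mono: "(\<And>I. P I \<subseteq> Q I) \<Longrightarrow> forms P k \<subseteq> forms Q k"
  by (auto simp: forms_def)

locale derivations =
  fixes D :: "'n::{finite,linorder} \<Rightarrow> (real \<Rightarrow> real) \<Rightarrow> real \<Rightarrow> real"
  assumes linop_D: "linop (D i)"
begin

abbreviation "d \<equiv> ext_d D"

lemma d_add: "d (\<lambda>I x. \<omega> I x + \<eta> I x) = (\<lambda>I x. d \<omega> I x + d \<eta> I x)"
  unfolding ext_d_def[abs_def]
  by (simp add: linop_add[OF linop_lift_op[OF linop_D]] distrib_left sum.distrib)

lemma d_forms:
  assumes "\<omega> \<in> forms P k" and P: "\<And>I. lin_space (P I)"
    and D: "\<And>I i F. i \<notin> I \<Longrightarrow> F \<in> P I \<Longrightarrow> lift_op (D i) i F \<in> P (insert i I)"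
  shows "d \<omega> \<in> forms P (Suc k)"
proof (rule formsI)
  fix J :: "'n set"
  have "lift_op (D i) i (\<omega> (J - {i})) \<in> P J" if "i \<in> J" for i
    using D[of i "J - {i}"] forms_mem[OF assms(1) P] that by (simp add: insert_absorb)
  then show "d \<omega> J \<in> P J"
    unfolding ext_d_def[abs_def] by (intro lin_space_sum[OF P] lin_space_scale[OF P])
next
  fix J :: "'n set" and x assume J: "card J \<noteq> Suc k"
  have "\<omega> (J - {i}) = (\<lambda>x. 0)" if "i \<in> J" for i
    using J that card_Suc_Diff1[of J i] by (intro forms_zero[OF assms(1)]) auto
  then show "d \<omega> J x = 0"
    by (simp add: ext_d_def linop_zero[OF linop_lift_op[OF linop_D]])
qed

lemma lift_op_d:
  assumes "linop T"
  shows "lift_op T i (d \<omega> J) = (\<lambda>x. \<Sum>j\<in>J. sgnc j J * lift_op T i (lift_op (D j) j (\<omega> (J - {j}))) x)"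
  unfolding ext_d_def[abs_def] by (rule linop_lincomb[OF linop_lift_op[OF assms]])

lemma d_d:
  assumes "\<And>I. \<omega> I \<in> tensor_space (\<lambda>_. UNIV)"
  shows "d (d \<omega>) = (\<lambda>I x. 0)"
proof (intro ext)
  fix J x
  \<comment> \<open>Zeros on the diagonal complete the double sum to all of \<open>J\<close> times
    \<open>J\<close>, where \<open>b\<close> is antisymmetric.\<close>
  define b where "b i j = (if i = j then 0 else sgnc i J * (sgnc j (J - {i}) *
    lift_op (D i) i (lift_op (D j) j (\<omega> (J - {i} - {j}))) x))" for i j
  have "d (d \<omega>) J x = (\<Sum>i\<in>J. \<Sum>j\<in>J - {i}. b i j)"
    unfolding ext_d_def[of D "d \<omega>"] lift_op_d[OF linop_D] sum_distrib_left
    by (intro sum.cong) (auto simp: b_def)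
  also have "\<dots> = (\<Sum>i\<in>J. \<Sum>j\<in>J. b i j)"
    by (intro sum.cong sum.mono_neutral_left) (auto simp: b_def)
  finally have S: "d (d \<omega>) J x = (\<Sum>i\<in>J. \<Sum>j\<in>J. b i j)" .
  have anti: "b i j = - b j i" if ij: "i \<in> J" "j \<in> J" for i j
  proof (cases "i = j")
    case False
    define I where "I = J - {i} - {j}"
    have I: "J = insert i (insert j I)" "J - {i} = insert j I" "J - {j} = insert i I" "J - {j} - {i} = I"
      "i \<notin> I" "j \<notin> I"
      using ij False by (auto simp: I_def)
    have "lift_op (D i) i (lift_op (D j) j (\<omega> I)) = lift_op (D j) j (lift_op (D i) i (\<omega> I))"
      by (rule lift_op_commute[OF linop_D linop_D False assms])
    moreover have "sgnc i J * sgnc j (J - {i}) = - (sgnc j J * sgnc i (J - {j}))"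
      unfolding I(2,3) by (subst (1 2) I(1)) (rule sgnc_swap[OF False I(5,6)])
    moreover have "b i j = sgnc i J * sgnc j (J - {i}) * lift_op (D i) i (lift_op (D j) j (\<omega> I)) x"
      unfolding b_def if_not_P[OF False] I_def mult.assoc ..
    moreover have "b j i = sgnc j J * sgnc i (J - {j}) * lift_op (D j) j (lift_op (D i) i (\<omega> I)) x"
      unfolding b_def if_not_P[OF False[symmetric]] I(4) mult.assoc ..
    ultimately show ?thesis by simp
  qed (simp add: b_def)
  have "(\<Sum>i\<in>J. \<Sum>j\<in>J. b i j) = - (\<Sum>i\<in>J. \<Sum>j\<in>J. b j i)"
    unfolding sum_negf[symmetric] by (intro sum.cong refl anti)
  also have "(\<Sum>i\<in>J. \<Sum>j\<in>J. b j i) = (\<Sum>i\<in>J. \<Sum>j\<in>J. b i j)" by (rule sum.swap)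
  finally show "d (d \<omega>) J x = 0" unfolding S by simp
qed

text \<open>The Cartan-type homotopy formula on components without \<open>dx\<close> of direction
  \<open>i\<close>: for \<open>j \<noteq> i\<close> the operators commute and the signs are
  opposite, so only the derivative in direction \<open>i\<close> survives.\<close>

lemma contract_homotopy_notin:
  assumes T: "linop T" and \<omega>: "\<And>I. \<omega> I \<in> tensor_space (\<lambda>_. UNIV)" and "i \<notin> J"
  shows "d (contract T i \<omega>) J x + sgnc i J * lift_op T i (d \<omega> (insert i J)) x =
    lift_op (\<lambda>f. T (D i f)) i (\<omega> J) x"
proof -
  have "d (contract T i \<omega>) J x =
      (\<Sum>j\<in>J. - (sgnc i J * (sgnc j (insert i J) * lift_op T i (lift_op (D j) j (\<omega> (insert i J - {j}))) x)))"
    unfolding ext_d_def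
  proof (rule sum.cong[OF refl])
    fix j assume j: "j \<in> J"
    define I where "I = J - {j}"
    have I: "J = insert j I" "j \<notin> I" "i \<notin> I" "i \<noteq> j" "insert i J - {j} = insert i I"
      using j assms(3) by (auto simp: I_def)
    have con: "contract T i \<omega> I = (\<lambda>x. sgnc i I * lift_op T i (\<omega> (insert i I)) x)"
      using I by (simp add: contract_def fun_eq_iff)
    have 1: "lift_op (D j) j (contract T i \<omega> I) x =
        sgnc i I * lift_op T i (lift_op (D j) j (\<omega> (insert i I))) x"
    proof -
      have "lift_op (D j) j (lift_op T i (\<omega> (insert i I))) = lift_op T i (lift_op (D j) j (\<omega> (insert i I)))"
        by (rule lift_op_commute[OF linop_D T _ \<omega>]) (use I(4) in simp)
      then show ?thesis
        unfolding con by (simp add: linop_scale[OF linop_lift_op[OF linop_D]])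
    qed
    have "sgnc j J * sgnc i I = - (sgnc i J * sgnc j (insert i J))"
      using I(2-4) by (subst (1 2 3) I(1)) (auto simp: sgnc_insert sgnc_insert_self)
    then show "sgnc j J * lift_op (D j) j (contract T i \<omega> (J - {j})) x =
      - (sgnc i J * (sgnc j (insert i J) * lift_op T i (lift_op (D j) j (\<omega> (insert i J - {j}))) x))"
      unfolding I_def[symmetric] 1 I(5) by (simp add: mult.assoc[symmetric])
  qed
  also have "\<dots> = - (sgnc i J * (\<Sum>j\<in>J. sgnc j (insert i J) * lift_op T i (lift_op (D j) j (\<omega> (insert i J - {j}))) x))"
    by (simp add: sum_negf sum_distrib_left)
  finally have 1: "d (contract T i \<omega>) J x = \<dots>" .
  have "lift_op T i (d \<omega> (insert i J)) x = sgnc i J * lift_op T i (lift_op (D i) i (\<omega> J)) x +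
      (\<Sum>j\<in>J. sgnc j (insert i J) * lift_op T i (lift_op (D j) j (\<omega> (insert i J - {j}))) x)"
    unfolding lift_op_d[OF T] using assms(3) by (simp add: sgnc_insert_self)
  then show ?thesis
    unfolding 1 by (simp add: distrib_left mult.assoc[symmetric] sgnc_square lift_op_lift_op)
qed

text \<open>The companion case: the contracted form has no component containing \<open>i\<close>, so
  only the derivative in direction \<open>i\<close> contributes.\<close>

lemma contract_homotopy_in:
  assumes T: "linop T" and "i \<in> J"
  shows "d (contract T i \<omega>) J x = lift_op (\<lambda>f. D i (T f)) i (\<omega> J) x"
proof -
  have "contract T i \<omega> (J - {j}) = (\<lambda>x. 0)" if "j \<noteq> i" for j
    using assms(2) that by (simp add: contract_def fun_eq_iff)
  then have "d (contract T i \<omega>) J x = (\<Sum>j\<in>J. if j = i then sgnc i J * lift_op (D i) i (contract T i \<omega> (J - {i})) x else 0)"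
    unfolding ext_d_def
    by (intro sum.cong) (auto simp: linop_zero[OF linop_lift_op[OF linop_D]])
  also have "\<dots> = sgnc i J * lift_op (D i) i (contract T i \<omega> (J - {i})) x" using assms(2) by simp
  also have "contract T i \<omega> (J - {i}) = (\<lambda>x. sgnc i J * lift_op T i (\<omega> J) x)"
    using assms(2) sgnc_insert_self[of i "J - {i}"] by (simp add: contract_def fun_eq_iff insert_absorb)
  finally show ?thesis
    by (simp add: linop_scale[OF linop_lift_op[OF linop_D]] mult.assoc[symmetric] sgnc_square lift_op_lift_op)
qed

end

text \<open>The abstract setting of the induction over levels. \<open>V l i False\<close> and
  \<open>V l i True\<close> are the two univariate spaces of level \<open>l\<close> in direction
  \<open>i\<close>, before and after differentiation; \<open>D\<close> is common to all levels, and
  \<open>K l i\<close> relates level \<open>l\<close> to level \<open>Suc l\<close>.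
  \<open>D_K\<close> and \<open>K_D\<close> say that the two homotopy defects are coarse. Support
  conditions are imposed on lines only, matching \<open>lift_op\<close>.\<close>

locale spline_hierarchy = derivations D for D :: "'n::{finite,linorder} \<Rightarrow> (real \<Rightarrow> real) \<Rightarrow> real \<Rightarrow> real" +
  fixes L :: nat and V :: "nat \<Rightarrow> 'n::{finite,linorder} \<Rightarrow> bool \<Rightarrow> (real \<Rightarrow> real) set"
    and K :: "nat \<Rightarrow> 'n::{finite,linorder} \<Rightarrow> (real \<Rightarrow> real) \<Rightarrow> real \<Rightarrow> real" and \<Omega> :: "nat \<Rightarrow> (real ^ 'n::{finite,linorder}) set"
  assumes lin_space_V: "l \<le> L \<Longrightarrow> lin_space (V l i b)"
    and V_mono: "l < L \<Longrightarrow> V l i b \<subseteq> V (Suc l) i b"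
    and V_0: "V 0 i True = {\<lambda>x. 0}"
    and linop_K: "l < L \<Longrightarrow> linop (K l i)"
    and D_mem: "l \<le> L \<Longrightarrow> f \<in> V l i False \<Longrightarrow> D i f \<in> V l i True"
    and K_fine: "l < L \<Longrightarrow> f \<in> V (Suc l) i True \<Longrightarrow> K l i f \<in> V (Suc l) i False"
    and K_coarse: "l < L \<Longrightarrow> f \<in> V l i True \<Longrightarrow> K l i f \<in> V l i False"
    and D_K: "l < L \<Longrightarrow> f \<in> V (Suc l) i True \<Longrightarrow> (\<lambda>t. f t - D i (K l i f) t) \<in> V l i True"
    and K_D: "l < L \<Longrightarrow> f \<in> V (Suc l) i False \<Longrightarrow> (\<lambda>t. f t - K l i (D i f) t) \<in> V l i False"
    and \<Omega>_mono: "l < L \<Longrightarrow> \<Omega> (Suc l) \<subseteq> \<Omega> l"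
    and D_support: "l \<le> L \<Longrightarrow> k \<le> L \<Longrightarrow> f \<in> V k i False \<Longrightarrow> (\<And>t. upd x i t \<notin> \<Omega> l \<Longrightarrow> f t = 0) \<Longrightarrow>
      upd x i t \<notin> \<Omega> l \<Longrightarrow> D i f t = 0"
    and K_support: "l < L \<Longrightarrow> f \<in> V (Suc l) i True \<Longrightarrow> (\<And>t. upd x i t \<notin> \<Omega> (Suc l) \<Longrightarrow> f t = 0) \<Longrightarrow>
      upd x i t \<notin> \<Omega> (Suc l) \<Longrightarrow> K l i f t = 0"
begin

definition supported :: "nat \<Rightarrow> (real ^ 'n::{finite,linorder} \<Rightarrow> real) set" where
  "supported l = {F. \<forall>x. x \<notin> \<Omega> l \<longrightarrow> F x = 0}"

text \<open>Splines that are already coarse in the directions of \<open>A\<close> and still fine in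
  the others, the intermediate stages of coarsening.\<close>

definition mixed :: "nat \<Rightarrow> 'n set \<Rightarrow> 'n set \<Rightarrow> (real ^ 'n::{finite,linorder} \<Rightarrow> real) set" where
  "mixed l A I = tensor_space (\<lambda>i. V (if i \<in> A then l else Suc l) i (i \<in> I))"

definition level :: "nat \<Rightarrow> 'n set \<Rightarrow> (real ^ 'n::{finite,linorder} \<Rightarrow> real) set" where
  "level l I = tensor_space (\<lambda>i. V l i (i \<in> I))"

fun hier :: "nat \<Rightarrow> 'n set \<Rightarrow> (real ^ 'n::{finite,linorder} \<Rightarrow> real) set" where
  "hier 0 I = level 0 I"
| "hier (Suc l) I = sum_space (hier l I) (level (Suc l) I \<inter> supported (Suc l))"

lemma lin_space_Int: "lin_space A \<Longrightarrow> lin_space B \<Longrightarrow> lin_space (A \<inter> B)"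
  by (simp add: lin_space_def)

lemma lin_space_supported: "lin_space (supported l)"
  by (auto simp: lin_space_def supported_def)

lemma lin_space_mixed: "lin_space (mixed l A I)" and lin_space_level: "lin_space (level l I)"
  unfolding mixed_def level_def by (rule lin_space_tensor_space)+

lemma lin_space_hier: "lin_space (hier l I)"
proof (induction l)
  case (Suc l)
  then show ?case
    unfolding hier.simps
    by (intro lin_space_sum_space lin_space_Int lin_space_level lin_space_supported)
qed (simp add: lin_space_level)

lemma level_mono: "l < L \<Longrightarrow> level l I \<subseteq> level (Suc l) I"
  unfolding level_def by (intro tensor_space_mono V_mono)

lemma mixed_mono: "l < L \<Longrightarrow> mixed l A I \<subseteq> mixed l {} I"
  unfolding mixed_def using V_mono by (intro tensor_space_mono) auto

lemma hier_level: "l \<le> L \<Longrightarrow> hier l I \<subseteq> level l I"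
proof (induction l)
  case (Suc l)
  then have "hier l I \<subseteq> level (Suc l) I" using level_mono[of l I] by simp
  then show ?case
    unfolding hier.simps by (intro sum_space_minimal lin_space_level) auto
qed simp

lemma hier_mono: "hier l I \<subseteq> hier (Suc l) I"
  and level_subset_hier: "level (Suc l) I \<inter> supported (Suc l) \<subseteq> hier (Suc l) I"
  using subset_sum_space[OF lin_space_hier lin_space_Int[OF lin_space_level lin_space_supported]]
  by simp_all

text \<open>This absorbs the coarsened part: a spline of level \<open>l\<close> vanishing outside
  the smaller domain also vanishes outside the domain of its own level.\<close>

lemma level_supported_hier: "l < L \<Longrightarrow> level l I \<inter> supported (Suc l) \<subseteq> hier l I"
proof (cases l)
  case (Suc k)
  assume "l < L"
  then have "supported (Suc l) \<subseteq> supported l" using \<Omega>_mono by (auto simp: supported_def)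
  then show ?thesis using level_subset_hier[of k I] unfolding Suc by blast
qed auto

lemma D_supported:
  assumes "l \<le> L" "F \<in> tensor_space (\<lambda>j. V (k j) j (j \<in> I))" "k i \<le> L" "i \<notin> I" "F \<in> supported l"
  shows "lift_op (D i) i F \<in> supported l"
  unfolding supported_def
proof safe
  fix x assume "x \<notin> \<Omega> l"
  then show "lift_op (D i) i F x = 0"
  proof (intro lift_op_support[OF assms(2) lin_space_V[OF assms(3)], where A = "\<Omega> l"])
    fix f y t
    assume "f \<in> V (k i) i (i \<in> I)" "\<And>t. upd y i t \<notin> \<Omega> l \<Longrightarrow> f t = 0" "upd y i t \<notin> \<Omega> l"
    then show "D i f t = 0" using assms(4) by (intro D_support[OF assms(1,3), of f i y t]) auto
  qed (use assms(5) in \<open>auto simp: supported_def\<close>)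
qed

lemma D_tensor:
  assumes "F \<in> tensor_space (\<lambda>j. V (k j) j (j \<in> I))" "k i \<le> L" "i \<notin> I"
  shows "lift_op (D i) i F \<in> tensor_space (\<lambda>j. V (k j) j (j \<in> insert i I))"
  by (rule lift_op_mem[OF linop_D assms(1)]) (use assms D_mem[of "k i"] in auto)

lemma D_hier:
  assumes "l \<le> L" "i \<notin> I" "F \<in> hier l I"
  shows "lift_op (D i) i F \<in> hier l (insert i I)"
  using assms(1,3)
proof (induction l arbitrary: F)
  case 0
  then show ?case using D_tensor[of F "\<lambda>_. 0"] assms(2) by (simp add: level_def)
next
  case (Suc l)
  then obtain A B where *: "A \<in> hier l I" "B \<in> level (Suc l) I \<inter> supported (Suc l)"
      "F = (\<lambda>x. A x + B x)" by (auto elim: sum_spaceE)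
  have "lift_op (D i) i B \<in> level (Suc l) (insert i I) \<inter> supported (Suc l)"
    using * D_tensor[of B "\<lambda>_. Suc l"] D_supported[of "Suc l" B "\<lambda>_. Suc l"] assms(2) Suc.prems
    by (auto simp: level_def)
  then show ?case
    using sum_spaceI[OF Suc.IH[OF _ *(1)]] Suc.prems unfolding *(3) linop_add[OF linop_lift_op[OF linop_D]]
    by simp
qed

text \<open>Directions are made coarse one at a time by subtracting \<open>d\<close> of a
  contraction with \<open>K\<close>. The induction over \<open>A\<close> keeps the directions
  treated before coarse, because \<open>K\<close> acts on direction \<open>i\<close> only and
  \<open>d v\<close> remains equal to \<open>d w\<close>.\<close>

lemma two_level_exact:
  assumes l: "l < L" and k: "1 \<le> k"
    and w: "w \<in> forms (\<lambda>I. mixed l {} I \<inter> supported (Suc l)) k"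
    and dw: "\<And>I. d w I \<in> mixed l UNIV I \<inter> supported (Suc l)"
  shows "\<exists>v\<in>forms (\<lambda>I. mixed l A I \<inter> supported (Suc l)) k.
    \<exists>\<beta>\<in>forms (\<lambda>I. mixed l {} I \<inter> supported (Suc l)) (k - 1). w = (\<lambda>I x. v I x + d \<beta> I x)"
proof -
  have "finite A" by simp
  then show ?thesis
  proof (induction A)
    case empty
    have "d (\<lambda>I x. 0) = (\<lambda>I x. 0)"
      by (simp add: ext_d_def[abs_def] linop_zero[OF linop_lift_op[OF linop_D]])
    moreover have "(\<lambda>I x. 0) \<in> forms (\<lambda>I. mixed l {} I \<inter> supported (Suc l)) (k - 1)"
      by (intro formsI) (auto intro: lin_space_zero lin_space_mixed lin_space_supported)
    ultimately show ?case using w by (intro bexI[of _ w] bexI[of _ "\<lambda>I x. 0"]) auto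
  next
    case (insert i A)
    then obtain v \<beta> where v: "v \<in> forms (\<lambda>I. mixed l A I \<inter> supported (Suc l)) k"
      and \<beta>: "\<beta> \<in> forms (\<lambda>I. mixed l {} I \<inter> supported (Suc l)) (k - 1)"
      and w_eq: "w = (\<lambda>I x. v I x + d \<beta> I x)" by blast
    have ls: "lin_space (mixed l A I \<inter> supported (Suc l))" for A I
      by (intro lin_space_Int lin_space_mixed lin_space_supported)
    note K = linop_K[OF l, of i]
    note v_mem = forms_mem[OF v ls] and \<beta>_mem = forms_mem[OF \<beta> ls]
    have tens: "v I \<in> tensor_space (\<lambda>_. UNIV)" "\<beta> I \<in> tensor_space (\<lambda>_. UNIV)" for I
      using v_mem[of I] \<beta>_mem[of I] tensor_space_UNIV unfolding mixed_def by blast+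
    have K_supp: "lift_op (K l i) i F \<in> supported (Suc l)"
      if F: "F \<in> mixed l A I \<inter> supported (Suc l)" and "i \<in> I" for F I A
      unfolding supported_def
    proof safe
      fix x assume x: "x \<notin> \<Omega> (Suc l)"
      from F have F': "F \<in> tensor_space (\<lambda>i. V (if i \<in> A then l else Suc l) i (i \<in> I))"
        by (simp add: mixed_def)
      have "V (if i \<in> A then l else Suc l) i (i \<in> I) \<subseteq> V (Suc l) i True"
        using V_mono[OF l] \<open>i \<in> I\<close> by auto
      moreover have "(if i \<in> A then l else Suc l) \<le> L" using l by simp
      ultimately show "lift_op (K l i) i F x = 0"
      proof (intro lift_op_support[OF F' lin_space_V, where A = "\<Omega> (Suc l)"])
        fix f y t
        assume "V (if i \<in> A then l else Suc l) i (i \<in> I) \<subseteq> V (Suc l) i True"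
          "f \<in> V (if i \<in> A then l else Suc l) i (i \<in> I)" "\<And>t. upd y i t \<notin> \<Omega> (Suc l) \<Longrightarrow> f t = 0"
          "upd y i t \<notin> \<Omega> (Suc l)"
        then show "K l i f t = 0" by (intro K_support[OF l, of f i y t]) auto
      qed (use F x in \<open>auto simp: supported_def split: if_splits\<close>)
    qed
    have D_supp: "lift_op (D i) i F \<in> supported (Suc l)"
      if F: "F \<in> mixed l A I \<inter> supported (Suc l)" and "i \<notin> I" for F I A
      using D_supported[of "Suc l" F "\<lambda>i. if i \<in> A then l else Suc l" I i] F that l
      by (auto simp: mixed_def)
    \<comment> \<open>Coarse in the directions of \<open>A\<close> like \<open>v\<close>, but in
      direction \<open>i\<close> only of the fine level; hence \<open>\<gamma>\<close> is collected
      into the fine potential.\<close>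
    define \<gamma> where "\<gamma> = contract (K l i) i v"
    define v' where "v' = (\<lambda>I x. v I x - d \<gamma> I x)"
    have \<gamma>_A: "\<gamma> \<in> forms (\<lambda>I. mixed l A I \<inter> supported (Suc l)) (k - 1)"
    proof (rule formsI)
      fix J :: "'n set" assume J: "card J = k - 1"
      show "\<gamma> J \<in> mixed l A J \<inter> supported (Suc l)"
      proof (cases "i \<in> J")
        case False
        have "lift_op (K l i) i (v (insert i J)) \<in> mixed l A J"
          using v_mem[of "insert i J"] unfolding mixed_def
          by (intro lift_op_mem[OF K, of _ "\<lambda>j. V (if j \<in> A then l else Suc l) j (j \<in> insert i J)"])
            (use K_fine[OF l] insert.hyps False in auto)
        moreover have "lift_op (K l i) i (v (insert i J)) \<in> supported (Suc l)"
          by (rule K_supp[OF v_mem]) simp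
        ultimately have *: "lift_op (K l i) i (v (insert i J)) \<in> mixed l A J \<inter> supported (Suc l)" by blast
        have "\<gamma> J = (\<lambda>x. sgnc i J * lift_op (K l i) i (v (insert i J)) x)"
          using False by (simp add: \<gamma>_def contract_def fun_eq_iff)
        then show ?thesis using lin_space_scale[OF ls *] by simp
      next
        case True
        then have "\<gamma> J = (\<lambda>x. 0)" by (simp add: \<gamma>_def contract_def fun_eq_iff)
        then show ?thesis using lin_space_zero[OF ls] by simp
      qed
    next
      fix J :: "'n set" and x assume J: "card J \<noteq> k - 1"
      have "v (insert i J) = (\<lambda>x. 0)" if "i \<notin> J"
        using J k that by (intro forms_zero[OF v]) auto
      then show "\<gamma> J x = 0"
        by (simp add: \<gamma>_def contract_def linop_zero[OF linop_lift_op[OF K]])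
    qed
    then have \<gamma>: "\<gamma> \<in> forms (\<lambda>I. mixed l {} I \<inter> supported (Suc l)) (k - 1)"
      using forms_mono[of "\<lambda>I. mixed l A I \<inter> supported (Suc l)" "\<lambda>I. mixed l {} I \<inter> supported (Suc l)"]
        mixed_mono[OF l] by blast
    \<comment> \<open>Only exact forms have been removed from \<open>w\<close>, so the coarseness of
      \<open>d w\<close> in all directions remains available.\<close>
    have dv: "d v = d w"
      unfolding w_eq d_add d_d[OF tens(2)] by simp
    have d\<gamma>: "d \<gamma> \<in> forms (\<lambda>I. mixed l A I \<inter> supported (Suc l)) (Suc (k - 1))"
    proof (rule d_forms[OF \<gamma>_A ls])
      fix I j F assume "j \<notin> I" "F \<in> mixed l A I \<inter> supported (Suc l)"
      then show "lift_op (D j) j F \<in> mixed l A (insert j I) \<inter> supported (Suc l)"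
        using l D_tensor[of F "\<lambda>i. if i \<in> A then l else Suc l" I j]
          D_supported[of "Suc l" F "\<lambda>i. if i \<in> A then l else Suc l" I j]
        by (auto simp: mixed_def)
    qed
    have v': "v' \<in> forms (\<lambda>I. mixed l (insert i A) I \<inter> supported (Suc l)) k"
    proof (rule formsI)
      fix J :: "'n set" and x assume "card J \<noteq> k"
      then show "v' J x = 0" using forms_zero[OF v] forms_zero[OF d\<gamma>] k by (simp add: v'_def)
    next
      fix J :: "'n set" assume "card J = k"
      have "v' J \<in> supported (Suc l)"
        unfolding v'_def using v_mem[of J] forms_mem[OF d\<gamma> ls, of J]
        by (intro lin_space_diff[OF lin_space_supported]) auto
      moreover have "v' J \<in> mixed l (insert i A) J"
      proof (cases "i \<in> J")
        case True
        have "v' J = lift_op (\<lambda>f t. f t - D i (K l i f) t) i (v J)"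
          using contract_homotopy_in[OF K True, of v]
          by (simp add: v'_def \<gamma>_def fun_eq_iff lift_op_def)
        also have "\<dots> \<in> mixed l (insert i A) J"
          using v_mem[of J] True D_K[OF l] insert.hyps unfolding mixed_def
          by (intro lift_op_mem[of _ _ "\<lambda>j. V (if j \<in> A then l else Suc l) j (j \<in> J)"])
            (auto simp: linop_def linop_add[OF K] linop_add[OF linop_D] linop_scale[OF K] linop_scale[OF linop_D] algebra_simps)
        finally show ?thesis .
      next
        case False
        \<comment> \<open>The first term is coarse in direction \<open>i\<close> by
          \<open>K_D\<close>. The second involves \<open>d v\<close>, which is coarse in every
          direction, and \<open>K_coarse\<close> keeps it so.\<close>
        have 1: "v' J = (\<lambda>x. lift_op (\<lambda>f t. f t - K l i (D i f) t) i (v J) x +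
            sgnc i J * lift_op (K l i) i (d v (insert i J)) x)"
          using contract_homotopy_notin[OF K tens(1) False]
          by (simp add: v'_def \<gamma>_def fun_eq_iff lift_op_def algebra_simps)
        have "lift_op (\<lambda>f t. f t - K l i (D i f) t) i (v J) \<in> mixed l (insert i A) J"
          using v_mem[of J] False K_D[OF l] insert.hyps unfolding mixed_def
          by (intro lift_op_mem[of _ _ "\<lambda>j. V (if j \<in> A then l else Suc l) j (j \<in> J)"])
            (auto simp: linop_def linop_add[OF K] linop_add[OF linop_D] linop_scale[OF K] linop_scale[OF linop_D] algebra_simps)
        moreover have "lift_op (K l i) i (d v (insert i J)) \<in> mixed l (insert i A) J"
          using dw[of "insert i J"] K_coarse[OF l] V_mono[OF l] False unfolding dv mixed_def
          by (intro lift_op_mem[OF K, of _ "\<lambda>j. V l j (j \<in> insert i J)"]) auto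
        ultimately show ?thesis
          unfolding 1 by (intro lin_space_add lin_space_scale lin_space_mixed)
      qed
      ultimately show "v' J \<in> mixed l (insert i A) J \<inter> supported (Suc l)" by blast
    qed
    have "w = (\<lambda>I x. v' I x + d (\<lambda>I x. \<beta> I x + \<gamma> I x) I x)"
      unfolding d_add v'_def w_eq by (simp add: algebra_simps)
    moreover have "(\<lambda>I x. \<beta> I x + \<gamma> I x) \<in> forms (\<lambda>I. mixed l {} I \<inter> supported (Suc l)) (k - 1)"
      by (rule forms_add[OF ls \<beta> \<gamma>])
    ultimately show ?case using v' by blast
  qed
qed

theorem hier_exact:
  assumes "l \<le> L" "1 \<le> k" "\<omega> \<in> forms (hier l) k" "d \<omega> = (\<lambda>I x. 0)"
  shows "\<exists>\<sigma>\<in>forms (hier l) (k - 1). \<omega> = d \<sigma>"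
  using assms(1,3,4)
proof (induction l arbitrary: \<omega>)
  case 0
  \<comment> \<open>On level 0 a form of positive degree has a factor from a zero space in each
    tensor product.\<close>
  have "\<omega> I = (\<lambda>x. 0)" for I
  proof (cases "card I = k")
    case True
    then obtain i where i: "i \<in> I" using assms(2) by force
    have "\<omega> I \<in> level 0 I" using forms_mem[OF "0.prems"(2) lin_space_hier, of I] by simp
    moreover have "level 0 I \<subseteq> lspan {\<lambda>x. 0}"
      unfolding level_def tensor_space_def
    proof (rule lspan_subset, safe)
      fix f assume "\<forall>j. f j \<in> V 0 j (j \<in> I)"
      then have "f i = (\<lambda>x. 0)" using i V_0[of i] by (metis (full_types) singletonD)
      then have "tensor f x = 0" for x unfolding tensor_def by (intro prod_zero) (auto intro!: exI[of _ i])
      then have "tensor f = (\<lambda>x. 0)" by blast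
      then show "tensor f \<in> lspan {\<lambda>x. 0}" by (simp add: lspan.zero)
    qed
    moreover have "lspan {\<lambda>x::real^'n::{finite,linorder}. 0 :: real} \<subseteq> {\<lambda>x. 0}"
      by (rule lspan_minimal) (auto simp: lin_space_def)
    ultimately show ?thesis by blast
  qed (use "0.prems"(2) in \<open>auto simp: forms_def\<close>)
  then have "\<omega> = (\<lambda>I x. 0)" by (intro ext) simp
  moreover have "d (\<lambda>I x. 0) = (\<lambda>I x. 0)"
    by (simp add: ext_d_def[abs_def] linop_zero[OF linop_lift_op[OF linop_D]])
  moreover have "(\<lambda>I x. 0) \<in> forms (hier 0) (k - 1)"
    by (intro formsI) (auto intro: lin_space_zero lin_space_hier simp del: hier.simps)
  ultimately show ?case by metis
next
  case (Suc l)
  then have l: "l < L" by simp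
  have ls: "lin_space (level l' I \<inter> supported (Suc l))" for l' I
    by (intro lin_space_Int lin_space_level lin_space_supported)
  have "\<forall>I. \<exists>F G. F \<in> hier l I \<and> G \<in> level (Suc l) I \<inter> supported (Suc l) \<and> \<omega> I = (\<lambda>x. F x + G x)"
    using forms_mem[OF Suc.prems(2) lin_space_hier] unfolding hier.simps by (meson sum_spaceE)
  then obtain a0 w0 where aw0: "\<And>I. a0 I \<in> hier l I" "\<And>I. w0 I \<in> level (Suc l) I \<inter> supported (Suc l)"
    "\<And>I. \<omega> I = (\<lambda>x. a0 I x + w0 I x)" by metis
  \<comment> \<open>The decomposition was chosen for each component separately and may be a
    nontrivial splitting of 0 in other degrees; cutting off makes both parts
    \<open>k\<close>-forms.\<close>
  define a where "a I x = (if card I = k then a0 I x else 0)" for I x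
  define w where "w I x = (if card I = k then w0 I x else 0)" for I x
  have a: "a \<in> forms (hier l) k"
    by (rule formsI) (use aw0 in \<open>simp_all add: a_def[abs_def]\<close>)
  have w: "w \<in> forms (\<lambda>I. level (Suc l) I \<inter> supported (Suc l)) k"
    by (rule formsI) (use aw0 in \<open>simp_all add: w_def[abs_def]\<close>)
  have \<omega>: "\<omega> = (\<lambda>I x. a I x + w I x)"
  proof (intro ext)
    fix I x
    show "\<omega> I x = a I x + w I x"
    proof (cases "card I = k")
      case True
      then show ?thesis using fun_cong[OF aw0(3)[of I], of x] by (simp add: a_def w_def)
    next
      case False
      then show ?thesis using fun_cong[OF forms_zero[OF Suc.prems(2) False], of x] by (simp add: a_def w_def)
    qed
  qed
  have da: "d a \<in> forms (hier l) (Suc k)"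
    by (rule d_forms[OF a lin_space_hier]) (use D_hier l in auto)
  have dw: "d w \<in> forms (\<lambda>I. level (Suc l) I \<inter> supported (Suc l)) (Suc k)"
  proof (rule d_forms[OF w ls])
    fix I i F assume "i \<notin> I" "F \<in> level (Suc l) I \<inter> supported (Suc l)"
    then show "lift_op (D i) i F \<in> level (Suc l) (insert i I) \<inter> supported (Suc l)"
      using l D_tensor[of F "\<lambda>_. Suc l" I i] D_supported[of "Suc l" F "\<lambda>_. Suc l" I i]
      by (auto simp: level_def)
  qed
  have sum0: "d a I x + d w I x = 0" for I x
    using Suc.prems(3) unfolding \<omega> d_add by (metis (no_types))
  \<comment> \<open>The coarse level comes from \<open>- d a\<close>, the support condition from
    \<open>d w\<close> itself.\<close>
  have dw_l: "d w I \<in> mixed l UNIV I \<inter> supported (Suc l)" for I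
  proof -
    have "d w I = (\<lambda>x. (- 1) * d a I x)" using sum0 by (simp add: fun_eq_iff eq_neg_iff_add_eq_0 add.commute)
    moreover have "(\<lambda>x. (- 1) * d a I x) \<in> level l I"
      using forms_mem[OF da lin_space_hier, of I] hier_level[of l I] l
      by (intro lin_space_scale lin_space_level) auto
    ultimately have "d w I \<in> level l I" by simp
    then show ?thesis using forms_mem[OF dw ls, of I] by (simp add: mixed_def level_def)
  qed
  have "w \<in> forms (\<lambda>I. mixed l {} I \<inter> supported (Suc l)) k"
    using w by (simp add: mixed_def level_def)
  from two_level_exact[OF l assms(2) this dw_l, of UNIV] obtain v \<beta>
    where v: "v \<in> forms (\<lambda>I. level l I \<inter> supported (Suc l)) k"
      and \<beta>: "\<beta> \<in> forms (\<lambda>I. level (Suc l) I \<inter> supported (Suc l)) (k - 1)"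
      and w_eq: "w = (\<lambda>I x. v I x + d \<beta> I x)" by (auto simp: mixed_def level_def)
  have "(\<lambda>I x. a I x + v I x) \<in> forms (hier l) k"
    using forms_add[OF lin_space_hier a] v level_supported_hier[OF l]
      forms_mono[of "\<lambda>I. level l I \<inter> supported (Suc l)" "hier l" k] by blast
  moreover have "d (\<lambda>I x. a I x + v I x) = (\<lambda>I x. 0)"
  proof -
    have "\<beta> I \<in> tensor_space (\<lambda>_. UNIV)" for I
      using forms_mem[OF \<beta> ls, of I] tensor_space_UNIV unfolding level_def by blast
    then have "d w = d v" unfolding w_eq d_add by (simp add: d_d)
    then show ?thesis using sum0 by (simp add: d_add)
  qed
  ultimately obtain \<alpha> where \<alpha>: "\<alpha> \<in> forms (hier l) (k - 1)" "(\<lambda>I x. a I x + v I x) = d \<alpha>"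
    using Suc.IH l by auto
  have "\<omega> = d (\<lambda>I x. \<alpha> I x + \<beta> I x)"
    unfolding d_add \<alpha>(2)[symmetric] \<omega> w_eq by (simp add: add.assoc)
  moreover have "(\<lambda>I x. \<alpha> I x + \<beta> I x) \<in> forms (hier (Suc l)) (k - 1)"
  proof (rule forms_add[OF lin_space_hier])
    show "\<alpha> \<in> forms (hier (Suc l)) (k - 1)"
      using \<alpha>(1) forms_mono[of "hier l" "hier (Suc l)"] hier_mono by blast
    show "\<beta> \<in> forms (hier (Suc l)) (k - 1)"
      using \<beta> forms_mono[of "\<lambda>I. level (Suc l) I \<inter> supported (Suc l)" "hier (Suc l)"] level_subset_hier by blast
  qed
  ultimately show ?case by blast
qed

end

section \<open>Right continuity and local duality of tensor-product B-splines\<close>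

definition orthant :: "real ^ 'n \<Rightarrow> real \<Rightarrow> (real ^ 'n) set" where
  "orthant x \<epsilon> = {y. \<forall>i. x $ i < y $ i \<and> y $ i < x $ i + \<epsilon>}"

text \<open>Continuity from the closed positive orthant, which tensor products inherit from
  right-continuous factors. A nonzero value then persists on a small open cube having the point as
  its lower corner.\<close>

definition right_cont :: "(real ^ 'n::finite \<Rightarrow> real) \<Rightarrow> bool" where
  "right_cont F \<longleftrightarrow> (\<forall>x. continuous (at x within {y. \<forall>i. x $ i \<le> y $ i}) F)"

lemma orthant_eq_box: "orthant x \<epsilon> = box x (\<chi> i. x $ i + \<epsilon>)" for x :: "real ^ 'n::finite"
  by (auto simp: orthant_def mem_box_cart)

lemma open_orthant: "open (orthant x \<epsilon>)" for x :: "real ^ 'n::finite"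
  by (simp add: orthant_eq_box open_box)

lemma orthant_nonempty: "0 < \<epsilon> \<Longrightarrow> orthant x \<epsilon> \<noteq> {}" for x :: "real ^ 'n::finite"
  unfolding orthant_eq_box by (auto simp: interval_ne_empty_cart)

lemma closure_orthant: "0 < \<epsilon> \<Longrightarrow> x \<in> closure (orthant x \<epsilon>)" for x :: "real ^ 'n::finite"
  using closure_box[of x "\<chi> i. x $ i + \<epsilon>"] orthant_nonempty[of \<epsilon> x]
  unfolding orthant_eq_box by (auto simp: mem_box_cart)

lemma orthant_subset_ball:
  fixes x :: "real ^ 'n::finite"
  assumes "0 < e" shows "\<exists>\<epsilon>>0. orthant x \<epsilon> \<subseteq> ball x e"
proof (intro exI[of _ "e / CARD('n)"] conjI subsetI)
  show "0 < e / CARD('n)" using assms by simp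
  fix y assume y: "y \<in> orthant x (e / CARD('n))"
  have "norm (y - x) \<le> (\<Sum>i\<in>UNIV. \<bar>(y - x) $ i\<bar>)" by (rule norm_le_l1_cart)
  also have "\<dots> < (\<Sum>i\<in>(UNIV :: 'n set). e / CARD('n))"
  proof (intro sum_strict_mono)
    fix i
    have "x $ i < y $ i \<and> y $ i < x $ i + e / CARD('n)" using y by (simp add: orthant_def)
    then show "\<bar>(y - x) $ i\<bar> < e / CARD('n)" by simp
  qed auto
  also have "\<dots> = e" by simp
  finally show "y \<in> ball x e" by (simp add: dist_norm norm_minus_commute)
qed

lemma lin_space_right_cont: "lin_space {F. right_cont F}"
  by (auto simp: lin_space_def right_cont_def intro!: continuous_intros)

lemma right_cont_nonzero:
  assumes "right_cont F" "F x \<noteq> 0"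
  shows "\<exists>\<epsilon>>0. \<forall>y\<in>orthant x \<epsilon>. F y \<noteq> 0"
proof -
  have "continuous (at x within {y. \<forall>i. x $ i \<le> y $ i}) F" using assms(1) by (simp add: right_cont_def)
  then have "\<forall>\<^sub>F y in at x within {y. \<forall>i. x $ i \<le> y $ i}. F y \<noteq> 0"
    unfolding continuous_within by (rule tendsto_imp_eventually_ne) (use assms(2) in simp)
  then obtain e where e: "e > 0" "\<And>y. \<forall>i. x $ i \<le> y $ i \<Longrightarrow> y \<noteq> x \<Longrightarrow> dist y x < e \<Longrightarrow> F y \<noteq> 0"
    unfolding eventually_at by blast
  obtain \<epsilon> where \<epsilon>: "\<epsilon> > 0" "orthant x \<epsilon> \<subseteq> ball x e" using orthant_subset_ball[OF e(1)] by blast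
  have "F y \<noteq> 0" if "y \<in> orthant x \<epsilon>" for y
    using e(2)[of y] \<epsilon>(2) that assms(2) by (cases "y = x") (auto simp: orthant_def dist_commute less_imp_le)
  then show ?thesis using \<epsilon> by blast
qed

lemma right_cont_tensor:
  fixes f :: "'n::finite \<Rightarrow> real \<Rightarrow> real"
  assumes "\<And>i x. continuous (at_right x) (f i)"
  shows "right_cont (tensor f)"
  unfolding right_cont_def tensor_def
proof (intro allI continuous_prod)
  fix x :: "real ^ 'n" and i
  have "continuous (at (x $ i) within {x $ i..}) (f i)"
    using assms by (simp add: at_within_Ici_at_right)
  then have "continuous (at (x $ i) within (\<lambda>y. y $ i) ` {y. \<forall>i. x $ i \<le> y $ i}) (f i)"
    by (rule continuous_within_subset) auto
  then show "continuous (at x within {y. \<forall>i. x $ i \<le> y $ i}) (\<lambda>y. f i (y $ i))"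
    by (intro continuous_within_compose2[of _ _ "\<lambda>y. y $ i" "f i"]) (auto intro!: continuous_intros)
qed

text \<open>A nonzero value at \<open>x\<close> persists on an open cube with corner
  \<open>x\<close>; the cube lies in the open support and its closure contains \<open>x\<close>.
  This turns the support condition into vanishing at every point.\<close>

lemma open_supp_subset_iff:
  assumes "right_cont F" "closed A"
  shows "open_supp F \<subseteq> A \<longleftrightarrow> (\<forall>x. x \<notin> A \<longrightarrow> F x = 0)"
proof
  assume A: "open_supp F \<subseteq> A"
  show "\<forall>x. x \<notin> A \<longrightarrow> F x = 0"
  proof (intro allI impI, rule ccontr)
    fix x assume x: "x \<notin> A" "F x \<noteq> 0"
    obtain \<epsilon> where \<epsilon>: "\<epsilon> > 0" "\<forall>y\<in>orthant x \<epsilon>. F y \<noteq> 0" using right_cont_nonzero[OF assms(1) x(2)] by blast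
    then have "orthant x \<epsilon> \<subseteq> open_supp F"
      unfolding open_supp_def by (intro interior_maximal open_orthant) (use closure_subset in fastforce)
    then have "closure (orthant x \<epsilon>) \<subseteq> A" using A assms(2) by (intro closure_minimal) auto
    then show False using closure_orthant[OF \<epsilon>(1), of x] x by blast
  qed
next
  assume "\<forall>x. x \<notin> A \<longrightarrow> F x = 0"
  then have "closure {x. F x \<noteq> 0} \<subseteq> A" using assms(2) by (intro closure_minimal) auto
  then show "open_supp F \<subseteq> A" unfolding open_supp_def using interior_subset by blast
qed

text \<open>Here almost-everywhere information becomes pointwise: a nonzero value would persist on
  an open cube inside the unit cube, which has positive measure.\<close>

lemma zero_if_AE_zero:
  assumes "right_cont F" "\<And>x i. x $ i < 0 \<or> 1 \<le> x $ i \<Longrightarrow> F x = 0"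
    and "AE x in lebesgue. x \<in> box 0 1 \<longrightarrow> F x = 0"
  shows "F = (\<lambda>x. 0)"
proof (rule ext, rule ccontr)
  fix x assume x: "F x \<noteq> 0"
  then have x01: "0 \<le> x $ i \<and> x $ i < 1" for i using assms(2)[of x i] by linarith
  obtain e where e: "e > 0" "\<forall>y\<in>orthant x e. F y \<noteq> 0" using right_cont_nonzero[OF assms(1) x] by blast
  \<comment> \<open>Shrunk so that the cube with lower corner \<open>x\<close> does not leave the
    unit cube.\<close>
  define \<epsilon> where "\<epsilon> = Min (insert e ((\<lambda>i. 1 - x $ i) ` UNIV))"
  have "\<epsilon> \<in> insert e ((\<lambda>i. 1 - x $ i) ` UNIV)" unfolding \<epsilon>_def by (rule Min_in) auto
  then have \<epsilon>: "\<epsilon> > 0" "\<epsilon> \<le> e" "\<And>i. \<epsilon> \<le> 1 - x $ i"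
    using e(1) x01 by (auto simp: \<epsilon>_def intro: Min_le simp del: Min_insert)
  have sub: "orthant x \<epsilon> \<subseteq> {x. x \<in> box 0 1 \<and> F x \<noteq> 0}"
  proof safe
    fix y assume y: "y \<in> orthant x \<epsilon>"
    have "0 < y $ i \<and> y $ i < 1" for i
      using y x01[of i] \<epsilon>(3)[of i] unfolding orthant_def by (auto dest!: spec[of _ i])
    then show "y \<in> box 0 1" by (simp add: mem_box_cart)
    have "x $ i < y $ i \<and> y $ i < x $ i + e" for i
      using y \<epsilon>(2) unfolding orthant_def by (auto dest!: spec[of _ i])
    then have "y \<in> orthant x e" by (simp add: orthant_def)
    then show "F y = 0 \<Longrightarrow> False" using e(2) by blast
  qed
  have "{x. x \<in> box 0 1 \<and> F x \<noteq> 0} \<in> null_sets lebesgue"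
    using assms(3) unfolding completion.AE_iff_null_sets by simp
  then have "negligible (orthant x \<epsilon>)"
    using sub negligible_iff_null_sets negligible_subset by blast
  then show False
    using open_not_negligible[OF open_orthant orthant_nonempty] \<epsilon>(1) by blast
qed

text \<open>The product functional evaluates on the grid of all combinations of the univariate
  points, with the products of the weights.\<close>

lemma tensor_evals:
  fixes x :: "real ^ 'n::finite"
  assumes "\<And>i. \<phi> i \<in> evals {x $ i<..<x $ i + \<epsilon>}"
  shows "\<exists>\<Phi>\<in>evals (orthant x \<epsilon>). \<forall>f. \<Phi> (tensor f) = (\<Prod>i\<in>UNIV. \<phi> i (f i))"
proof -
  have "\<exists>Y w. finite Y \<and> Y \<subseteq> {x $ i<..<x $ i + \<epsilon>} \<and> (\<forall>f. \<phi> i f = (\<Sum>y\<in>Y. w y * f y))" for i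
    using evals_explicit[OF assms[of i]] by metis
  then obtain Y w where Y: "\<And>i. finite (Y i)" "\<And>i. Y i \<subseteq> {x $ i<..<x $ i + \<epsilon>}"
    "\<And>i f. \<phi> i f = (\<Sum>y\<in>Y i. w i y * f y)" by metis
  define \<Phi> where "\<Phi> F = (\<Sum>y\<in>Pi\<^sub>E UNIV Y. (\<Prod>i\<in>UNIV. w i (y i)) * F (\<chi> i. y i))" for F :: "real ^ 'n \<Rightarrow> real"
  have ls: "lin_space (evals (orthant x \<epsilon>))" unfolding evals_def by (rule lin_space_lspan)
  have "\<Phi> \<in> evals (orthant x \<epsilon>)"
    unfolding \<Phi>_def[abs_def]
  proof (intro lin_space_sum[OF ls] lin_space_scale[OF ls])
    fix y assume "y \<in> Pi\<^sub>E UNIV Y"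
    then have "x $ i < y i \<and> y i < x $ i + \<epsilon>" for i using Y(2)[of i] by (auto simp: PiE_iff)
    then have "(\<chi> i. y i) \<in> orthant x \<epsilon>" by (simp add: orthant_def)
    then show "(\<lambda>F. F (\<chi> i. y i)) \<in> evals (orthant x \<epsilon>)"
      unfolding evals_def by (intro lspan_base) blast
  qed
  moreover have "\<Phi> (tensor f) = (\<Prod>i\<in>UNIV. \<phi> i (f i))" for f
    unfolding \<Phi>_def Y(3) tensor_def using Y(1) by (simp add: prod_sum_PiE prod.distrib)
  ultimately show ?thesis by blast
qed

text \<open>Local linear independence in dual form: next to any point where \<open>B\<close> is
  nonzero, and arbitrarily close to it, values of a combination determine the coefficient of
  \<open>B\<close>.\<close>

definition locally_dual :: "(real ^ 'n::finite \<Rightarrow> real) set \<Rightarrow> bool" where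
  "locally_dual S \<longleftrightarrow> finite S \<and> (\<forall>B\<in>S. right_cont B) \<and>
     (\<forall>B\<in>S. \<forall>x \<epsilon>. B x \<noteq> 0 \<longrightarrow> 0 < \<epsilon> \<longrightarrow>
        (\<exists>\<Phi>\<in>evals (orthant x \<epsilon>). \<forall>B'\<in>S. \<Phi> B' = of_bool (B' = B)))"

lemma locally_dual_right_cont: "locally_dual S \<Longrightarrow> f \<in> lspan S \<Longrightarrow> right_cont f"
  using lspan_minimal[OF lin_space_right_cont, of S] by (auto simp: locally_dual_def)

lemma lin_comb_eval:
  assumes "finite S" "\<Phi> \<in> evals A" "\<forall>B'\<in>S. \<Phi> B' = of_bool (B' = B)" "B \<in> S"
  shows "\<Phi> (lin_comb S \<tau>) = \<tau> B"
proof -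
  have "\<Phi> (lin_comb S \<tau>) = (\<Sum>B'\<in>S. \<tau> B' * of_bool (B' = B))"
    using assms(3) by (simp add: lin_comb_def evals_sum[OF assms(2)])
  then show ?thesis using assms(1,4) by (simp add: of_bool_def if_distrib cong: if_cong)
qed

lemma locally_dual_support:
  assumes S: "locally_dual S" and "closed A" "\<And>x. x \<notin> A \<Longrightarrow> lin_comb S \<tau> x = 0" "B \<in> S" "\<tau> B \<noteq> 0" "x \<notin> A"
  shows "B x = 0"
proof (rule ccontr)
  assume "B x \<noteq> 0"
  obtain e where "e > 0" "ball x e \<subseteq> - A" using \<open>closed A\<close> \<open>x \<notin> A\<close> by (metis Compl_iff open_Compl openE)
  moreover obtain \<epsilon> where \<epsilon>: "\<epsilon> > 0" "orthant x \<epsilon> \<subseteq> ball x e"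
    using orthant_subset_ball[OF \<open>e > 0\<close>] by blast
  ultimately have sub: "orthant x \<epsilon> \<subseteq> - A" by blast
  obtain \<Phi> where \<Phi>: "\<Phi> \<in> evals (orthant x \<epsilon>)" "\<forall>B'\<in>S. \<Phi> B' = of_bool (B' = B)"
    using S \<open>B \<in> S\<close> \<open>B x \<noteq> 0\<close> \<epsilon>(1) unfolding locally_dual_def by blast
  have "\<Phi> (lin_comb S \<tau>) = 0" using assms(3) sub by (intro evals_zero[OF \<Phi>(1)]) blast
  moreover have "\<Phi> (lin_comb S \<tau>) = \<tau> B"
    using S by (intro lin_comb_eval[OF _ \<Phi> \<open>B \<in> S\<close>]) (simp add: locally_dual_def)
  ultimately show False using assms(5) by simp
qed

section \<open>THB-splines as a sum of spaces of supported splines\<close>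

locale thb =
  fixes L :: nat and s m :: "'n::finite \<Rightarrow> nat" and \<xi> :: "nat \<Rightarrow> 'n \<Rightarrow> real list"
    and \<Psi> :: "nat \<Rightarrow> (real ^ 'n) set"
  assumes dual: "1 \<le> l \<Longrightarrow> l \<le> L \<Longrightarrow> locally_dual (tp_bsplines s m (\<xi> l))"
    and nested: "1 \<le> l \<Longrightarrow> l < L \<Longrightarrow> tp_bsplines s m (\<xi> l) \<subseteq> lspan (tp_bsplines s m (\<xi> (Suc l)))"
    and closed: "1 \<le> l \<Longrightarrow> l \<le> L \<Longrightarrow> closed (\<Psi> l)"
begin

abbreviation "tp l \<equiv> tp_bsplines s m (\<xi> l)"
abbreviation "tp_in l \<equiv> bsplines_in s m (\<xi> l) (\<Psi> l)"

lemma tp_in_eq: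
  assumes "1 \<le> l" "l \<le> L"
  shows "tp_in l = {B \<in> tp l. \<forall>x. x \<notin> \<Psi> l \<longrightarrow> B x = 0}"
  using dual[OF assms] open_supp_subset_iff[OF _ closed[OF assms]]
  unfolding bsplines_in_def locally_dual_def by blast

text \<open>Local duality forces the coefficient of every B-spline protruding from the domain to
  vanish, so the selected B-splines span all splines with that support.\<close>

lemma lspan_tp_in:
  assumes "1 \<le> l" "l \<le> L"
  shows "lspan (tp_in l) = {f \<in> lspan (tp l). \<forall>x. x \<notin> \<Psi> l \<longrightarrow> f x = 0}"
proof
  have "lin_space {f \<in> lspan (tp l). \<forall>x. x \<notin> \<Psi> l \<longrightarrow> f x = 0}"
    using lin_space_lspan[of "tp l"] by (auto simp: lin_space_def)
  moreover have "tp_in l \<subseteq> {f \<in> lspan (tp l). \<forall>x. x \<notin> \<Psi> l \<longrightarrow> f x = 0}"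
    unfolding tp_in_eq[OF assms] using lspan_base by blast
  ultimately show "lspan (tp_in l) \<subseteq> {f \<in> lspan (tp l). \<forall>x. x \<notin> \<Psi> l \<longrightarrow> f x = 0}"
    by (rule lspan_minimal)
  show "{f \<in> lspan (tp l). \<forall>x. x \<notin> \<Psi> l \<longrightarrow> f x = 0} \<subseteq> lspan (tp_in l)"
  proof safe
    fix f assume f: "f \<in> lspan (tp l)" "\<forall>x. x \<notin> \<Psi> l \<longrightarrow> f x = 0"
    have fin: "finite (tp l)" using dual[OF assms] by (simp add: locally_dual_def)
    then obtain \<tau> where \<tau>: "f = lin_comb (tp l) \<tau>" using f(1) lspan_eq_lin_comb by blast
    have "\<tau> B = 0 \<or> B \<in> tp_in l" if "B \<in> tp l" for B
      using locally_dual_support[OF dual[OF assms] closed[OF assms], of \<tau> B] f(2) that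
      unfolding tp_in_eq[OF assms] \<tau> by blast
    then have "f = lin_comb (tp_in l) \<tau>"
      unfolding \<tau> lin_comb_def using fin
      by (intro ext sum.mono_neutral_right) (auto simp: bsplines_in_def)
    then show "f \<in> lspan (tp_in l)" using lin_comb_in_lspan by blast
  qed
qed

lemma trunc_diff:
  assumes l: "1 \<le> l" "l \<le> L" and T: "T \<in> lspan (tp l)"
  shows "(\<lambda>x. T x - trunc s m (\<xi> l) (\<Psi> l) T x) \<in> lspan (tp_in l)"
proof -
  have fin: "finite (tp l)" using dual[OF l] by (simp add: locally_dual_def)
  obtain \<tau> where \<tau>: "T = lin_comb (tp l) \<tau>" using T lspan_eq_lin_comb[OF fin] by blast
  have "trunc s m (\<xi> l) (\<Psi> l) T = lin_comb (tp l - tp_in l) \<tau>"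
    unfolding trunc_def
  proof (rule the_equality)
    show "\<exists>\<tau>'. T = lin_comb (tp l) \<tau>' \<and> lin_comb (tp l - tp_in l) \<tau> = lin_comb (tp l - tp_in l) \<tau>'"
      using \<tau> by blast
    fix g assume "\<exists>\<tau>'. T = lin_comb (tp l) \<tau>' \<and> g = lin_comb (tp l - tp_in l) \<tau>'"
    then obtain \<tau>' where \<tau>': "T = lin_comb (tp l) \<tau>'" "g = lin_comb (tp l - tp_in l) \<tau>'" by blast
    \<comment> \<open>A B-spline outside the selection is nonzero somewhere, so a dual functional
      fixes its coefficient; this makes the definite description in \<open>trunc\<close>
      unique.\<close>
    have "\<tau>' B = \<tau> B" if B: "B \<in> tp l - tp_in l" for B
    proof -
      obtain x where "B x \<noteq> 0" using B unfolding tp_in_eq[OF l] by blast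
      then obtain \<Phi> where \<Phi>: "\<Phi> \<in> evals (orthant x 1)" "\<forall>B'\<in>tp l. \<Phi> B' = of_bool (B' = B)"
        using dual[OF l] B unfolding locally_dual_def by (meson DiffD1 zero_less_one)
      show ?thesis using lin_comb_eval[OF fin \<Phi>] B \<tau> \<tau>' by (metis DiffD1)
    qed
    then show "g = lin_comb (tp l - tp_in l) \<tau>" unfolding \<tau>' lin_comb_def by simp
  qed
  then have "(\<lambda>x. T x - trunc s m (\<xi> l) (\<Psi> l) T x) = lin_comb (tp_in l) \<tau>"
    unfolding \<tau> lin_comb_def using fin
    by (auto simp: sum.subset_diff[of "tp_in l" "tp l"] bsplines_in_def)
  then show ?thesis using lin_comb_in_lspan by metis
qed

text \<open>Truncation changes a function only by an element of the span of the new B-splines, and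
  every discarded function already lies in that span. The span is therefore the same as without
  truncating or discarding.\<close>

lemma lspan_thb_basis_step:
  assumes l: "Suc (Suc l) \<le> L" and sub: "lspan (thb_basis s m \<xi> \<Psi> (Suc l)) \<subseteq> lspan (tp (Suc l))"
  shows "lspan (thb_basis s m \<xi> \<Psi> (Suc (Suc l))) =
    sum_space (lspan (thb_basis s m \<xi> \<Psi> (Suc l))) (lspan (tp_in (Suc (Suc l))))"
    (is "lspan ?T' = ?R")
proof
  let ?T = "thb_basis s m \<xi> \<Psi> (Suc l)" and ?l = "Suc (Suc l)"
  have l': "1 \<le> ?l" "?l \<le> L" using l by auto
  have T'_eq: "?T' = {trunc s m (\<xi> ?l) (\<Psi> ?l) T | T. T \<in> ?T \<and> \<not> open_supp T \<subseteq> \<Psi> ?l} \<union> tp_in ?l"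
    by simp
  have "lspan (tp (Suc l)) \<subseteq> lspan (tp ?l)" using nested[of "Suc l"] l by (intro lspan_subset) auto
  then have sub': "lspan ?T \<subseteq> lspan (tp ?l)" using sub by blast
  have T_mem: "T \<in> lspan (tp ?l)" if "T \<in> ?T" for T using sub' lspan_base[OF that] by blast
  show "lspan ?T' \<subseteq> ?R"
  proof (rule lspan_minimal[OF lin_space_sum_space[OF lin_space_lspan lin_space_lspan]], rule subsetI)
    fix f assume "f \<in> ?T'"
    then consider T where "T \<in> ?T" "f = trunc s m (\<xi> ?l) (\<Psi> ?l) T" | "f \<in> tp_in ?l"
      unfolding T'_eq by blast
    then show "f \<in> ?R"
    proof cases
      case 1
      have "(\<lambda>x. (- 1) * (T x - f x)) \<in> lspan (tp_in ?l)"
        unfolding 1(2) by (rule lin_space_scale[OF lin_space_lspan trunc_diff[OF l' T_mem[OF 1(1)]]])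
      from sum_spaceI[OF lspan_base[OF 1(1)] this] show ?thesis by simp
    next
      case 2
      then show ?thesis using subset_sum_space(2)[OF lin_space_lspan lin_space_lspan] lspan_base by blast
    qed
  qed
  have in_T': "lspan (tp_in ?l) \<subseteq> lspan ?T'"
    by (rule lspan_subset) (auto simp: T'_eq intro: lspan_base simp del: thb_basis.simps)
  have "lspan ?T \<subseteq> lspan ?T'"
  proof (rule lspan_subset, rule subsetI)
    fix T assume T: "T \<in> ?T"
    show "T \<in> lspan ?T'"
    proof (cases "open_supp T \<subseteq> \<Psi> ?l")
      case True
      have "right_cont T" by (rule locally_dual_right_cont[OF dual[OF l'] T_mem[OF T]])
      then have "\<forall>x. x \<notin> \<Psi> ?l \<longrightarrow> T x = 0" using True open_supp_subset_iff[OF _ closed[OF l']] by blast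
      then show ?thesis using in_T' T_mem[OF T] unfolding lspan_tp_in[OF l'] by blast
    next
      case False
      let ?t = "trunc s m (\<xi> ?l) (\<Psi> ?l) T"
      have "?t \<in> ?T'" unfolding T'_eq using T False by blast
      then have "?t \<in> lspan ?T'" by (rule lspan_base)
      moreover have "(\<lambda>x. T x - ?t x) \<in> lspan ?T'" using trunc_diff[OF l' T_mem[OF T]] in_T' by blast
      ultimately have "(\<lambda>x. ?t x + (T x - ?t x)) \<in> lspan ?T'" by (rule lin_space_add[OF lin_space_lspan])
      then show ?thesis by simp
    qed
  qed
  then show "?R \<subseteq> lspan ?T'" using in_T' by (rule sum_space_minimal[OF lin_space_lspan])
qed

lemma lspan_thb_basis_subset: "Suc l \<le> L \<Longrightarrow> lspan (thb_basis s m \<xi> \<Psi> (Suc l)) \<subseteq> lspan (tp (Suc l))"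
proof (induction l)
  case (Suc l)
  then have sub: "lspan (thb_basis s m \<xi> \<Psi> (Suc l)) \<subseteq> lspan (tp (Suc l))" by simp
  have "lspan (tp (Suc l)) \<subseteq> lspan (tp (Suc (Suc l)))"
    using nested[of "Suc l"] Suc.prems by (intro lspan_subset) auto
  moreover have "lspan (tp_in (Suc (Suc l))) \<subseteq> lspan (tp (Suc (Suc l)))"
    using lspan_tp_in[of "Suc (Suc l)"] Suc.prems by auto
  ultimately show ?case
    unfolding lspan_thb_basis_step[OF Suc.prems sub] using sub
    by (intro sum_space_minimal[OF lin_space_lspan]) auto
qed simp

lemma finite_thb_basis: "Suc l \<le> L \<Longrightarrow> finite (thb_basis s m \<xi> \<Psi> (Suc l))"
proof (induction l)
  case 0
  then show ?case using dual[of 1] by (simp add: locally_dual_def)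
next
  case (Suc l)
  have "finite (tp_in (Suc (Suc l)))"
    using dual[of "Suc (Suc l)"] Suc.prems by (simp add: locally_dual_def bsplines_in_def)
  then show ?case using Suc by (simp add: setcompr_eq_image)
qed

end

section \<open>B-splines on open knot vectors\<close>

context breakpoints
begin

abbreviation "kn s m \<equiv> knot_fun (knots s m xs)"
abbreviation "dimn s m \<equiv> length (knots s m xs) - (s + 1)"

lemma mono_kn: "mono (kn s m)"
  by (rule mono_knot_fun[OF sorted_knots set_knots])

lemma bspline_knots: "j < dimn s m \<Longrightarrow> bspline (knots s m xs) s j = bsp (kn s m) s j"
  by (rule ext, rule bspline_eq_bsp) (auto simp: knot_fun_def)

lemma kn_zero: "i \<le> s \<Longrightarrow> kn s m i = 0"
  by (auto simp: knot_fun_def knots_eq nth_append simp del: replicate_Suc)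

lemma kn_nonneg: "0 \<le> kn s m i"
  using monoD[OF mono_kn, of 0 i] kn_zero[of 0] by simp

lemma bspline_dual:
  assumes "j < dimn s m" "bspline (knots s m xs) s j x \<noteq> 0" "0 < \<epsilon>"
  shows "\<exists>\<phi>\<in>evals {x<..<x + \<epsilon>}. \<forall>k<dimn s m. \<phi> (bspline (knots s m xs) s k) = of_bool (k = j)"
proof -
  have "bsp (kn s m) s j x \<noteq> 0" using assms bspline_knots by simp
  from bsp_nonzeroD[OF mono_kn this] have "kn s m j \<le> x" "x < kn s m (j + s + 1)" .
  moreover have "kn s m s \<le> x" using calculation(1) kn_zero[of s] kn_nonneg[of s m j] by simp
  ultimately obtain \<phi> where "\<phi> \<in> evals {x<..<x + \<epsilon>}" "\<forall>k. \<phi> (bsp (kn s m) s k) = of_bool (k = j)"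
    using bsp_local_dual[OF mono_kn] assms(3) by blast
  then show ?thesis using bspline_knots by (intro bexI[of _ \<phi>]) auto
qed

lemma bspline_continuous_right:
  assumes "j < dimn s m"
  shows "continuous (at_right x) (bspline (knots s m xs) s j)"
  unfolding bspline_knots[OF assms]
  using bsp_deriv_right[OF mono_kn] by (rule DERIV_continuous)

lemma lspan_bspline0:
  assumes "1 \<le> m" "m \<le> Suc q"
  shows "lspan {bspline (knots (Suc q) m xs) (Suc q) j | j. j < dimn (Suc q) m} =
    knot_seq.splines0 q (kn (Suc q) m)"
proof -
  interpret knot_seq q "dimn (Suc q) m" "kn (Suc q) m" by (rule knot_seq_knots[OF assms])
  have "bsp (kn (Suc q) m) (Suc q) j \<in> lspan {bspline (knots (Suc q) m xs) (Suc q) j | j. j < dimn (Suc q) m}" for j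
  proof (cases "j < dimn (Suc q) m")
    case True
    then show ?thesis unfolding bspline_knots[OF True, symmetric] by (intro lspan_base) blast
  next
    case False
    then have "bsp (kn (Suc q) m) (Suc q) j = (\<lambda>x. 0)" using bsp_zero by auto
    then show ?thesis by (simp add: lspan.zero)
  qed
  then have "splines0 \<subseteq> lspan {bspline (knots (Suc q) m xs) (Suc q) j | j. j < dimn (Suc q) m}"
    unfolding splines0_def by (intro lspan_subset) blast
  moreover have "lspan {bspline (knots (Suc q) m xs) (Suc q) j | j. j < dimn (Suc q) m} \<subseteq> splines0"
    by (rule lspan_minimal[OF lin_space_splines(1)]) (auto simp: bspline_knots bsp_mem)
  ultimately show ?thesis by blast
qed

text \<open>The degree \<open>q\<close> knot vector is the degree \<open>Suc q\<close> one without
  its first and last knot, so indices shift by one and the index 0 of the longer vector is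
  degenerate.\<close>

lemma lspan_bspline1:
  assumes "1 \<le> m" "m \<le> Suc q"
  shows "lspan {bspline (knots q m xs) q j | j. j < dimn q m} = knot_seq.splines1 q (kn (Suc q) m)"
proof -
  interpret knot_seq q "dimn (Suc q) m" "kn (Suc q) m" by (rule knot_seq_knots[OF assms])
  have "knots (Suc q) m xs = 0 # knots q m xs @ [1]"
    by (simp add: knots_eq replicate_append_same)
  then have shift: "kn q m i = kn (Suc q) m (Suc i)" for i
    by (auto simp: knot_fun_def nth_append)
  have dimn: "dimn (Suc q) m = Suc (dimn q m)"
    by (simp add: length_knots)
  have b: "bspline (knots q m xs) q j = bsp (kn (Suc q) m) q (Suc j)" if "j < dimn q m" for j
    using bsp_cong_knots[of q "kn q m" j "kn (Suc q) m" "Suc j"] shift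
    unfolding bspline_knots[OF that] by (auto simp: fun_eq_iff)
  have "nbsp (kn (Suc q) m) q j \<in> lspan {bspline (knots q m xs) q j | j. j < dimn q m}" for j
  proof (cases "1 \<le> j \<and> j < dimn (Suc q) m")
    case True
    then obtain k where k: "j = Suc k" "k < dimn q m" using dimn by (cases j) auto
    have "bspline (knots q m xs) q k \<in> lspan {bspline (knots q m xs) q j | j. j < dimn q m}"
      by (rule lspan_base) (use k in blast)
    from lin_space_scale[OF lin_space_lspan this, of "1 / (kn (Suc q) m (j + q + 1) - kn (Suc q) m j)"]
    show ?thesis unfolding b[OF k(2)] k(1) by (simp add: nbsp_def[abs_def])
  next
    case False
    then have "j = 0 \<or> dimn (Suc q) m \<le> j" by linarith
    then have "nbsp (kn (Suc q) m) q j = (\<lambda>x. 0)" using nbsp_zero by blast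
    then show ?thesis by (simp add: lspan.zero)
  qed
  then have "splines1 \<subseteq> lspan {bspline (knots q m xs) q j | j. j < dimn q m}"
    unfolding splines1_def by (intro lspan_subset) blast
  moreover have "lspan {bspline (knots q m xs) q j | j. j < dimn q m} \<subseteq> splines1"
  proof (rule lspan_minimal[OF lin_space_splines(2)], safe)
    fix j assume j: "j < dimn q m"
    have "bsp (kn (Suc q) m) q (Suc j) =
        (\<lambda>x. (kn (Suc q) m (Suc j + q + 1) - kn (Suc q) m (Suc j)) * nbsp (kn (Suc q) m) q (Suc j) x)"
      by (rule ext) (rule bsp_eq_nbsp[OF mono])
    then show "bspline (knots q m xs) q j \<in> splines1"
      unfolding b[OF j] by (simp only: lin_space_scale[OF lin_space_splines(2) nbsp_mem])
  qed
  ultimately show ?thesis by blast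
qed

end

text \<open>By multilinearity the factors are expanded one at a time; \<open>A\<close> is the set of
  directions whose factor is still an arbitrary element of the span.\<close>

lemma tensor_space_lspan:
  fixes S :: "'n::finite \<Rightarrow> (real \<Rightarrow> real) set"
  shows "tensor_space (\<lambda>i. lspan (S i)) = lspan {tensor f | f. \<forall>i. f i \<in> S i}"
proof
  let ?T = "lspan {tensor f | f. \<forall>i. f i \<in> S i}"
  have "tensor f \<in> ?T" if "\<And>i. i \<in> A \<Longrightarrow> f i \<in> lspan (S i)" "\<And>i. i \<notin> A \<Longrightarrow> f i \<in> S i" for f A
  proof -
    have "finite A" by simp
    then show ?thesis using that
    proof (induction A arbitrary: f)
      case empty
      then show ?case by (intro lspan_base) blast
    next
      case (insert i A)
      have tens: "tensor (f(i := h)) x = h (x $ i) * (\<Prod>j\<in>UNIV - {i}. f j (x $ j))" for h x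
        by (simp add: tensor_def prod.remove[of UNIV i])
      have "tensor (f(i := h)) \<in> ?T" if "h \<in> lspan (S i)" for h
        using that
      proof induction
        case zero
        have z: "tensor (f(i := \<lambda>x. 0)) = (\<lambda>x. 0)" by (rule ext) (simp add: tens)
        show ?case unfolding z by (rule lspan.zero)
      next
        case (step g h c)
        have g: "tensor (f(i := g)) \<in> ?T"
          using insert.prems insert.hyps step.hyps by (intro insert.IH) auto
        have sum: "tensor (f(i := \<lambda>x. c * g x + h x)) =
            (\<lambda>x. c * tensor (f(i := g)) x + tensor (f(i := h)) x)"
          by (rule ext) (simp add: tens algebra_simps)
        show ?case
          unfolding sum by (rule lin_space_add[OF lin_space_lspan lin_space_scale[OF lin_space_lspan g] step.IH])
      qed
      from this[of "f i"] insert.prems show ?case by simp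
    qed
  qed
  from this[of UNIV] show "tensor_space (\<lambda>i. lspan (S i)) \<subseteq> ?T"
    unfolding tensor_space_def by (intro lspan_subset) auto
  show "?T \<subseteq> tensor_space (\<lambda>i. lspan (S i))"
    unfolding tensor_space_def by (intro lspan_subset) (blast intro: lspan_base)
qed

text \<open>With \<open>q = p - 1\<close>, blocks of \<open>q + 2\<close> intervals are the sides of
  the boxes that generate the hierarchy, and \<open>U\<close> ranges over unions of such closed
  blocks.\<close>

lemma mesh_homotopy:
  assumes "breakpoint_seq \<eta> xs" "breakpoint_seq \<eta> ys" "bisected xs ys" "1 \<le> m" "m \<le> Suc q"
    and dvd: "(q + 2) dvd (length xs - 1)"
  defines "t \<equiv> knot_fun (knots (Suc q) m xs)" and "t' \<equiv> knot_fun (knots (Suc q) m ys)"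
  shows "\<exists>K. linop K \<and> (\<forall>g\<in>knot_seq.splines1 q t'. K g \<in> knot_seq.splines0 q t' \<and>
    (\<exists>c\<in>knot_seq.splines1 q t. has_rd (K g) (\<lambda>x. g x - c x)) \<and>
    (\<forall>Q\<subseteq>{r. (r + 1) * (q + 2) \<le> length xs - 1}.
      let U = (\<Union>r\<in>Q. {xs ! (r * (q + 2))..xs ! ((r + 1) * (q + 2))}) in
       (\<forall>x. x \<notin> U \<longrightarrow> g x = 0) \<longrightarrow> (\<forall>x. x \<notin> U \<longrightarrow> K g x = 0)))"
    and "knot_seq.splines0 q t \<subseteq> knot_seq.splines0 q t'" "knot_seq.splines1 q t \<subseteq> knot_seq.splines1 q t'"
    and "\<And>f h. f \<in> knot_seq.splines0 q t' \<Longrightarrow> has_rd f h \<Longrightarrow> h \<in> knot_seq.splines1 q t \<Longrightarrow>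
      f \<in> knot_seq.splines0 q t"
proof -
  obtain zs where zs: "xs = 0 # zs @ [1]" "sorted_wrt (<) xs" using breakpoint_seqD[OF assms(1)] .
  obtain ws where ws: "ys = 0 # ws @ [1]" "sorted_wrt (<) ys" using breakpoint_seqD[OF assms(2)] .
  interpret X: breakpoints xs zs by unfold_locales (use zs in auto)
  interpret Y: breakpoints ys ws by unfold_locales (use ws in auto)
  define N where "N = length (knots (Suc q) m xs) - (Suc q + 1)"
  define N' where "N' = length (knots (Suc q) m ys) - (Suc q + 1)"
  obtain a0 a1 where a: "refines (Suc q) t (length (knots (Suc q) m xs)) t' (length (knots (Suc q) m ys)) a0"
    "refines q t (length (knots (Suc q) m xs)) t' (length (knots (Suc q) m ys)) a1"
    using refines_bisected[OF assms(1-3)] unfolding t_def t'_def by meson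
  interpret coarse: knot_seq q N t unfolding N_def t_def by (rule X.knot_seq_knots[OF assms(4,5)])
  interpret fine: knot_seq q N' t' unfolding N'_def t'_def by (rule Y.knot_seq_knots[OF assms(4,5)])
  interpret knot_refinement q N t N' t' "length (knots (Suc q) m xs)" "length (knots (Suc q) m xs)"
    "length (knots (Suc q) m ys)" "length (knots (Suc q) m ys)" a0 a1
    by unfold_locales (use a in \<open>auto simp: N_def\<close>)
  show "coarse.splines0 \<subseteq> fine.splines0" by (rule splines0_subset)
  show "coarse.splines1 \<subseteq> fine.splines1" by (rule splines1_subset)
  show "f \<in> fine.splines0 \<Longrightarrow> has_rd f h \<Longrightarrow> h \<in> coarse.splines1 \<Longrightarrow> f \<in> coarse.splines0" for f h
    by (rule coarse_if_deriv_coarse)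
  define n where "n = length xs - 1"
  obtain M where M: "n = M * (q + 2)" using dvd unfolding n_def by (metis dvd_def mult.commute)
  \<comment> \<open>The endpoints of the macro intervals; there are \<open>M\<close> of these
    intervals.\<close>
  define f where "f r = xs ! (r * (q + 2))" for r
  have f_less: "f r < f r'" if "r < r'" "r' \<le> M" for r r'
  proof -
    have "r * (q + 2) < r' * (q + 2)" "r' * (q + 2) \<le> n" using that M by (auto simp del: mult_Suc_right)
    moreover have "n < length xs" using zs by (simp add: n_def)
    ultimately show ?thesis unfolding f_def by (intro sorted_wrt_nth_less[OF zs(2)]) auto
  qed
  have f_le: "f r \<le> f r'" if "r \<le> r'" "r' \<le> M" for r r'
    using f_less[of r r'] that by (cases "r = r'") auto
  have f0: "f 0 = 0" using zs by (simp add: f_def)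
  have "f M = xs ! n" by (simp only: f_def M)
  then have fM: "f M = 1" using zs by (simp add: n_def nth_append)
  have macro: "\<exists>r<M. f r \<le> x \<and> x < f (Suc r)" if "0 \<le> x" "x < 1" for x
  proof -
    define k where "k = (LEAST k. x < f k)"
    have "x < f M" using that fM by simp
    then have k: "x < f k" "k \<le> M" unfolding k_def by (auto intro: LeastI Least_le)
    moreover have "k \<noteq> 0" using k(1) f0 that by (metis not_le)
    moreover have "\<not> x < f (k - 1)" using not_less_Least[of "k - 1" "\<lambda>k. x < f k"] \<open>k \<noteq> 0\<close> unfolding k_def by simp
    ultimately show ?thesis by (intro exI[of _ "k - 1"]) auto
  qed
  \<comment> \<open>Each fine B-spline is assigned the macro interval containing the left end of its
    support, which the support therefore meets in an interval of positive length.\<close>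
  have "\<exists>r. r < M \<and> f r \<le> t' j \<and> t' j < f (Suc r)" if "1 \<le> j" "j < N'" for j
    using macro[of "t' j"] fine.t_range(1)[of j] fine.t_range(2)[of "j + Suc q"] fine.t_less[OF that] by fastforce
  then obtain r where r: "\<And>j. 1 \<le> j \<Longrightarrow> j < N' \<Longrightarrow> r j < M \<and> f (r j) \<le> t' j \<and> t' j < f (Suc (r j))"
    by metis
  define \<kappa> where "\<kappa> j = Suc q + m * (r j * (q + 2))" for j
    \<comment> \<open>the last knot equal to \<open>f (r j)\<close>; the B-spline of degree \<open>q\<close> starting there is supported in
      the \<open>r j\<close>-th macro interval\<close>
  have \<kappa>: "1 \<le> \<kappa> j \<and> \<kappa> j < N \<and> t (\<kappa> j) = f (r j) \<and> t (\<kappa> j + Suc q) \<le> f (Suc (r j))"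
    if j: "1 \<le> j" "j < N'" for j
  proof (intro conjI)
    define k where "k = r j * (q + 2)"
    have "Suc (r j) * (q + 2) \<le> n" unfolding M using r[OF j] by (intro mult_le_mono1) simp
    then have k: "k + Suc q < n" by (simp add: k_def)
    have n: "n = Suc (length zs)" using zs by (simp add: n_def)
    have \<kappa>k: "\<kappa> j = Suc q + m * k" by (simp only: \<kappa>_def k_def)
    show "1 \<le> \<kappa> j" by (simp add: \<kappa>_def)
    have "m * k \<le> m * length zs" using k n by (intro mult_le_mono2) simp
    moreover note \<kappa>k
    moreover have "N = Suc q + 1 + m * length zs" by (simp add: N_def X.length_knots)
    ultimately show "\<kappa> j < N" by linarith
    show "t (\<kappa> j) = f (r j)"
      unfolding \<kappa>_def t_def f_def k_def[symmetric]
      by (rule X.knot_at_breakpoint(1)[OF assms(4)]) (use k in \<open>simp add: n_def\<close>)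
    \<comment> \<open>Advancing by \<open>Suc q\<close> knots passes at most \<open>Suc q\<close>
      breakpoints, because each carries at least one knot. The macro interval has
      \<open>q + 2\<close> intervals, so the coarse B-spline ends inside it.\<close>
    have "Suc q \<le> m * Suc q" using assms(4) by (cases m) auto
    then have "\<kappa> j + Suc q \<le> Suc q + m * (k + Suc q)" unfolding \<kappa>k distrib_left by linarith
    then have "t (\<kappa> j + Suc q) \<le> t (Suc q + m * (k + Suc q))" by (rule monoD[OF coarse.mono])
    also have "\<dots> = xs ! (k + Suc q)"
      unfolding t_def by (rule X.knot_at_breakpoint(1)[OF assms(4)]) (use k in \<open>simp add: n_def\<close>)
    also have "\<dots> \<le> f (Suc (r j))"
    proof -
      have "Suc (r j) * (q + 2) = k + q + 2" by (simp add: k_def)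
      then have "f (Suc (r j)) = xs ! (k + q + 2)" by (simp only: f_def)
      moreover have "xs ! (k + Suc q) < xs ! (k + q + 2)"
        by (rule sorted_wrt_nth_less[OF zs(2)]) (use k in \<open>simp_all add: n_def\<close>)
      ultimately show ?thesis by simp
    qed
    finally show "t (\<kappa> j + Suc q) \<le> f (Suc (r j))" .
  qed
  obtain K where K: "linop K" "\<forall>g\<in>fine.splines1. K g \<in> fine.splines0 \<and>
    (\<exists>c\<in>coarse.splines1. has_rd (K g) (\<lambda>x. g x - c x)) \<and>
    (\<forall>U. closed U \<longrightarrow> (\<forall>x. x \<notin> U \<longrightarrow> g x = 0) \<longrightarrow>
       (\<forall>j. 1 \<le> j \<longrightarrow> j < N' \<longrightarrow> {t' j..<t' (j + Suc q)} \<subseteq> U \<longrightarrow>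
          {min (t' j) (t (\<kappa> j))..<max (t' (j + Suc q)) (t (\<kappa> j + Suc q))} \<subseteq> U) \<longrightarrow>
       (\<forall>x. x \<notin> U \<longrightarrow> K g x = 0))"
    using two_level_homotopy[of \<kappa>] \<kappa> by blast
  have supp: "K g x = 0"
    if g: "g \<in> fine.splines1" and Q: "Q \<subseteq> {r. (r + 1) * (q + 2) \<le> length xs - 1}"
      and U: "U = (\<Union>r\<in>Q. {xs ! (r * (q + 2))..xs ! ((r + 1) * (q + 2))})"
      and zero: "\<forall>x. x \<notin> U \<longrightarrow> g x = 0" "x \<notin> U" for g Q U x
  proof -
    have QM: "r < M" if "r \<in> Q" for r
    proof -
      have "(r + 1) * (q + 2) \<le> M * (q + 2)" using Q that M unfolding n_def by auto
      then have "r + 1 \<le> M" by (subst (asm) mult_le_cancel2) simp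
      then show ?thesis by simp
    qed
    have U: "U = (\<Union>r\<in>Q. {f r..f (Suc r)})" by (simp add: U f_def)
    have "Q \<subseteq> {..<M}" using QM by blast
    then have "finite Q" by (rule finite_subset) simp
    then have "closed U" unfolding U by (intro closed_UN) auto
    moreover have "{min (t' j) (t (\<kappa> j))..<max (t' (j + Suc q)) (t (\<kappa> j + Suc q))} \<subseteq> U"
      if j: "1 \<le> j" "j < N'" and sub: "{t' j..<t' (j + Suc q)} \<subseteq> U" for j
    proof -
      note rj = r[OF j] and \<kappa>j = \<kappa>[OF j]
      \<comment> \<open>A point of the fine support strictly inside its macro interval. Strictness
        matters: neighbouring closed macro intervals share an endpoint, but only one contains
        \<open>y\<close>, so that one belongs to \<open>Q\<close>.\<close>
      obtain y where y: "t' j < y" "y < min (t' (j + Suc q)) (f (Suc (r j)))"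
        using dense[of "t' j" "min (t' (j + Suc q)) (f (Suc (r j)))"] fine.t_less[OF j] rj by auto
      then have "y \<in> U" using sub by auto
      then obtain r' where r': "r' \<in> Q" "f r' \<le> y" "y \<le> f (Suc r')" unfolding U by auto
      have "r' = r j"
      proof (rule linorder_cases)
        assume "r' < r j"
        then have "f (Suc r') \<le> f (r j)" using rj by (intro f_le) auto
        then show ?thesis using r' y rj by linarith
      next
        assume "r j < r'"
        then have "f (Suc (r j)) \<le> f r'" using QM[OF r'(1)] by (intro f_le) auto
        then show ?thesis using r' y by simp
      qed
      then have "{f (r j)..f (Suc (r j))} \<subseteq> U" using r'(1) unfolding U by blast
      moreover have "y \<in> {f (r j)..f (Suc (r j))} \<or> y \<in> {t' j..<t' (j + Suc q)}"
        if "y \<in> {min (t' j) (t (\<kappa> j))..<max (t' (j + Suc q)) (t (\<kappa> j + Suc q))}" for y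
        using that rj \<kappa>j by (auto simp: min_le_iff_disj less_max_iff_disj)
      ultimately show ?thesis using sub by blast
    qed
    ultimately show ?thesis using K(2) g zero by blast
  qed
  show "\<exists>K. linop K \<and> (\<forall>g\<in>fine.splines1. K g \<in> fine.splines0 \<and>
    (\<exists>c\<in>coarse.splines1. has_rd (K g) (\<lambda>x. g x - c x)) \<and>
    (\<forall>Q\<subseteq>{r. (r + 1) * (q + 2) \<le> length xs - 1}.
      let U = (\<Union>r\<in>Q. {xs ! (r * (q + 2))..xs ! ((r + 1) * (q + 2))}) in
       (\<forall>x. x \<notin> U \<longrightarrow> g x = 0) \<longrightarrow> (\<forall>x. x \<notin> U \<longrightarrow> K g x = 0)))"
    unfolding Let_def using K supp[OF _ _ refl] by (intro exI[of _ K]) simp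
qed

section \<open>The THB-spline complex\<close>

lemma upd_mem_cbox:
  fixes x :: "real ^ 'n::finite"
  shows "upd x i u \<in> cbox a b \<longleftrightarrow>
    (\<forall>j. j \<noteq> i \<longrightarrow> a $ j \<le> x $ j \<and> x $ j \<le> b $ j) \<and> a $ i \<le> u \<and> u \<le> b $ i"
  by (auto simp: mem_box_cart)

locale thb_setting =
  fixes L :: nat and \<eta> :: real
    and p m :: "'n::{finite,linorder} \<Rightarrow> nat"
    and \<xi> :: "nat \<Rightarrow> 'n \<Rightarrow> real list"
    and \<Psi> :: "nat \<Rightarrow> (real ^ 'n::{finite,linorder}) set"
  assumes L: "1 \<le> L" and p: "\<And>i. 1 \<le> p i" and m: "\<And>i. 1 \<le> m i" "\<And>i. m i \<le> p i"
    and mesh: "mesh_hierarchy L \<eta> p \<xi>"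
    and dom: "domain_hierarchy L p \<xi> \<Psi>"
begin

definition q :: "'n \<Rightarrow> nat" where "q i = p i - 1"

definition t :: "nat \<Rightarrow> 'n \<Rightarrow> nat \<Rightarrow> real" where
  "t l i = knot_fun (knots (Suc (q i)) (m i) (\<xi> l i))"

text \<open>Level 0 is an artificial coarsest level whose complex consists of the constants only.\<close>

definition V :: "nat \<Rightarrow> 'n \<Rightarrow> bool \<Rightarrow> (real \<Rightarrow> real) set" where
  "V l i b = (if l = 0 then if b then {\<lambda>x. 0} else lspan {\<lambda>x. of_bool (0 \<le> x \<and> x < 1)}
     else if b then knot_seq.splines1 (q i) (t l i) else knot_seq.splines0 (q i) (t l i))"

text \<open>The artificial level 0 is given the full domain, so that nestedness also holds from
  level 1 to level 0.\<close>

definition \<Omega> :: "nat \<Rightarrow> (real ^ 'n::{finite,linorder}) set" where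
  "\<Omega> l = \<Psi> (if l = 0 then 1 else l)"

lemma p_eq: "p i = Suc (q i)" and m_le: "m i \<le> Suc (q i)"
  using p[of i] m(2)[of i] by (simp_all add: q_def)

lemma bp: "1 \<le> l \<Longrightarrow> l \<le> L \<Longrightarrow> breakpoint_seq \<eta> (\<xi> l i)"
  and dvd: "1 \<le> l \<Longrightarrow> l \<le> L \<Longrightarrow> (q i + 2) dvd (length (\<xi> l i) - 1)"
  and bis: "1 \<le> l \<Longrightarrow> l < L \<Longrightarrow> bisected (\<xi> l i) (\<xi> (Suc l) i)"
  using mesh by (auto simp: mesh_hierarchy_def p_eq)

lemma breakpoints:
  assumes "1 \<le> l" "l \<le> L" shows "\<exists>zs. breakpoints (\<xi> l i) zs"
  using breakpoint_seqD[OF bp[OF assms]] by (metis breakpoints.intro)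

lemma knot_seq:
  assumes "1 \<le> l" "l \<le> L" shows "\<exists>N. knot_seq (q i) N (t l i)"
  using breakpoints[OF assms] breakpoints.knot_seq_knots[OF _ m(1) m_le] unfolding t_def by blast

lemma lin_space_V: "l \<le> L \<Longrightarrow> lin_space (V l i b)"
proof (cases "l = 0")
  case False
  assume "l \<le> L"
  then obtain N where "knot_seq (q i) N (t l i)" using knot_seq[of l i] False by auto
  then show ?thesis using False knot_seq.lin_space_splines by (simp add: V_def)
qed (auto simp: V_def lin_space_lspan, simp add: lin_space_def)

lemma has_rd_indicator: "has_rd (\<lambda>x. of_bool (0 \<le> x \<and> x < 1)) (\<lambda>x. 0)"
proof -
  \<comment> \<open>The knots 0, 1, 1, ... whose first B-spline of degree 0 is the indicator
    function.\<close>
  define u where "u i = (of_bool (i \<noteq> 0) :: real)" for i :: nat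
  have "mono u" by (auto simp: mono_def u_def)
  then have "has_rd (bsp u 0 0) (\<lambda>x. 0)" using bsp_deriv_right[of u 0 0] by (simp add: has_rd_def)
  moreover have "bsp u 0 0 = (\<lambda>x. of_bool (0 \<le> x \<and> x < 1))" by (auto simp: u_def)
  ultimately show ?thesis by simp
qed

lemma has_rd_V0: "f \<in> V 0 i False \<Longrightarrow> has_rd f (\<lambda>x. 0)"
proof -
  assume "f \<in> V 0 i False"
  then have "f \<in> lspan {\<lambda>x. of_bool (0 \<le> x \<and> x < 1)}" by (simp add: V_def)
  then show ?thesis
  proof induction
    case (step f g c)
    then have "has_rd f (\<lambda>x. 0)" using has_rd_indicator by simp
    from has_rd_add[OF has_rd_scale[OF this] step.IH] show ?case by simp
  qed (rule has_rd_zero)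
qed

lemma V_mono: "l < L \<Longrightarrow> V l i b \<subseteq> V (Suc l) i b"
proof (cases "l = 0")
  case True
  assume "l < L"
  then obtain N where "knot_seq (q i) N (t (Suc 0) i)" using knot_seq[of "Suc 0" i] by auto
  then interpret knot_seq "q i" N "t (Suc 0) i" .
  have "(\<lambda>x. of_bool (0 \<le> x \<and> x < 1)) \<in> splines0"
    unfolding sum_bsp[symmetric] by (intro lin_space_sum lin_space_splines bsp_mem)
  then have "lspan {\<lambda>x. of_bool (0 \<le> x \<and> x < 1)} \<subseteq> splines0"
    by (intro lspan_minimal lin_space_splines) simp
  then show ?thesis
    using True lin_space_zero[OF lin_space_splines(2)] unfolding V_def by simp
next
  case False
  assume "l < L"
  then show ?thesis
    using False mesh_homotopy(2,3)[OF bp[of l i] bp[of "Suc l" i] bis[of l i] m(1) m_le dvd[of l i]]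
    by (auto simp: V_def t_def)
qed

lemma V_chain: "k \<le> l \<Longrightarrow> l \<le> L \<Longrightarrow> V k i b \<subseteq> V l i b"
proof (induction l rule: dec_induct)
  case (step l)
  then show ?case using V_mono[of l i b] by auto
qed simp

lemma rd_coarse:
  assumes "l < L" "f \<in> V (Suc l) i False" "has_rd f h" "h \<in> V l i True"
  shows "f \<in> V l i False"
proof (cases "l = 0")
  case True
  then obtain N where "knot_seq (q i) N (t (Suc 0) i)" using knot_seq[of "Suc 0" i] assms(1) by auto
  from knot_seq.has_rd_zeroD[OF this, of f] obtain c where "f = (\<lambda>x. c * of_bool (0 \<le> x \<and> x < 1))"
    using assms True by (auto simp: V_def)
  moreover have "(\<lambda>x. c * of_bool (0 \<le> x \<and> x < 1)) \<in> lspan {\<lambda>x. of_bool (0 \<le> x \<and> x < 1)}"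
    by (intro lin_space_scale lin_space_lspan lspan_base) simp
  ultimately show ?thesis
    using True unfolding V_def by simp
next
  case False
  then show ?thesis
    using assms mesh_homotopy(4)[OF bp[of l i] bp[of "Suc l" i] bis[of l i] m(1) m_le dvd[of l i], of f h]
    by (simp add: V_def t_def)
qed

lemma \<Psi>_1: "\<Psi> 1 = cbox 0 1"
proof -
  have "closure (box 0 (1 :: real ^ 'n::{finite,linorder})) = cbox 0 1"
    by (rule closure_box) (simp add: interval_ne_empty_cart)
  then show ?thesis using dom by (simp add: domain_hierarchy_def)
qed

lemma closed_\<Psi>: "1 \<le> l \<Longrightarrow> l \<le> L \<Longrightarrow> closed (\<Psi> l)"
  using dom by (simp add: domain_hierarchy_def)

lemma closed_slice: "l \<le> L \<Longrightarrow> closed {u. upd x i u \<in> \<Omega> l}"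
proof -
  assume "l \<le> L"
  then have "closed (\<Omega> l)" using closed_\<Psi> L by (simp add: \<Omega>_def)
  moreover have "continuous_on UNIV (\<lambda>u. if j = i then u else x $ j)" for j
    by (cases "j = i") (auto intro: continuous_intros)
  then have "continuous_on UNIV (upd x i)"
    unfolding upd_def[abs_def] by (rule continuous_on_vec_lambda)
  ultimately have "closed (upd x i -` \<Omega> l)" by (intro closed_vimage)
  then show ?thesis by (simp add: vimage_def)
qed

text \<open>A line parallel to an axis meets a closed box in a full side of it or not at all, so the
  slices of a union of boxes are unions of macro intervals. This is where the box structure of the
  refinement enters.\<close>

lemma slice_macro:
  assumes l: "1 \<le> l" "l < L"
  shows "\<exists>Q\<subseteq>{r. (r + 1) * (q i + 2) \<le> length (\<xi> l i) - 1}.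
    {u. upd x i u \<in> \<Psi> (Suc l)} = (\<Union>r\<in>Q. {\<xi> l i ! (r * (q i + 2))..\<xi> l i ! ((r + 1) * (q i + 2))})"
proof -
  define lo where "lo \<rho> = (\<chi> i. \<xi> l i ! (\<rho> i * (q i + 2)))" for \<rho>
  define hi where "hi \<rho> = (\<chi> i. \<xi> l i ! ((\<rho> i + 1) * (q i + 2)))" for \<rho>
  define valid where "valid \<rho> \<longleftrightarrow> (\<forall>i. (\<rho> i + 1) * (q i + 2) \<le> length (\<xi> l i) - 1)" for \<rho>
  have "\<forall>l\<in>{1..<L}. \<exists>B\<subseteq>p1_boxes p (\<xi> l). \<Psi> (l + 1) = \<Union> (closure ` B)"
    using dom unfolding domain_hierarchy_def by blast
  then have "\<exists>B\<subseteq>p1_boxes p (\<xi> l). \<Psi> (l + 1) = \<Union> (closure ` B)" using l by (simp del: Suc_eq_plus1)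
  then obtain B where B: "B \<subseteq> p1_boxes p (\<xi> l)" "\<Psi> (Suc l) = \<Union> (closure ` B)" by auto
  define R where "R = {\<rho>. valid \<rho> \<and> box (lo \<rho>) (hi \<rho>) \<in> B}"
  have "p1_boxes p (\<xi> l) = {box (lo \<rho>) (hi \<rho>) | \<rho>. valid \<rho>}"
    by (simp add: p1_boxes_def lo_def hi_def valid_def p_eq)
  then have BR: "B = (\<lambda>\<rho>. box (lo \<rho>) (hi \<rho>)) ` R" using B(1) by (auto simp: R_def)
  have clo: "closure (box (lo \<rho>) (hi \<rho>)) = cbox (lo \<rho>) (hi \<rho>)" if "\<rho> \<in> R" for \<rho>
  proof -
    have "lo \<rho> $ i < hi \<rho> $ i" for i
    proof -
      have "sorted_wrt (<) (\<xi> l i)" "2 \<le> length (\<xi> l i)"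
        using bp[of l i] l by (auto simp: breakpoint_seq_def)
      moreover have "(\<rho> i + 1) * (q i + 2) \<le> length (\<xi> l i) - 1"
        using that unfolding R_def valid_def by blast
      moreover have "\<rho> i * (q i + 2) < (\<rho> i + 1) * (q i + 2)" by simp
      ultimately have "\<xi> l i ! (\<rho> i * (q i + 2)) < \<xi> l i ! ((\<rho> i + 1) * (q i + 2))"
        by (intro sorted_wrt_nth_less[of "(<)"]) linarith+
      then show ?thesis by (simp only: lo_def hi_def vec_lambda_beta)
    qed
    then show ?thesis by (intro closure_box) (simp add: interval_ne_empty_cart)
  qed
  have \<Psi>: "\<Psi> (Suc l) = (\<Union>\<rho>\<in>R. cbox (lo \<rho>) (hi \<rho>))"
    unfolding B(2) BR image_image using clo by simp
  define R' where "R' = {\<rho>\<in>R. \<forall>j. j \<noteq> i \<longrightarrow> lo \<rho> $ j \<le> x $ j \<and> x $ j \<le> hi \<rho> $ j}"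
  have "{u. upd x i u \<in> \<Psi> (Suc l)} = (\<Union>\<rho>\<in>R'. {lo \<rho> $ i..hi \<rho> $ i})"
    unfolding \<Psi> R'_def by (intro set_eqI) (simp add: upd_mem_cbox, blast)
  also have "\<dots> = (\<Union>r\<in>(\<lambda>\<rho>. \<rho> i) ` R'. {\<xi> l i ! (r * (q i + 2))..\<xi> l i ! ((r + 1) * (q i + 2))})"
    by (simp add: lo_def hi_def)
  finally show ?thesis
    by (intro exI[of _ "(\<lambda>\<rho>. \<rho> i) ` R'"]) (auto simp: R'_def R_def valid_def)
qed

text \<open>From level 0 to 1 the domain is the cube, whose slices are empty or the whole interval,
  the two supports that the one-level homotopy respects. On higher levels the slices are unions of
  macro intervals.\<close>

lemma K_exists:
  assumes "l < L"
  shows "\<exists>K. linop K \<and> (\<forall>g\<in>V (Suc l) i True. K g \<in> V (Suc l) i False \<and>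
    (\<exists>c\<in>V l i True. has_rd (K g) (\<lambda>x. g x - c x)) \<and>
    (\<forall>x. (\<forall>u. upd x i u \<notin> \<Omega> (Suc l) \<longrightarrow> g u = 0) \<longrightarrow> (\<forall>u. upd x i u \<notin> \<Omega> (Suc l) \<longrightarrow> K g u = 0)))"
proof (cases "l = 0")
  case True
  then obtain N where "knot_seq (q i) N (t (Suc 0) i)" using knot_seq[of "Suc 0" i] assms by auto
  then interpret knot_seq "q i" N "t (Suc 0) i" .
  obtain K where K: "linop K" "\<forall>g\<in>splines1. K g \<in> splines0 \<and> has_rd (K g) g \<and>
    (\<forall>U. U = {} \<or> U = {0..1} \<longrightarrow> (\<forall>x. x \<notin> U \<longrightarrow> g x = 0) \<longrightarrow> (\<forall>x. x \<notin> U \<longrightarrow> K g x = 0))"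
    using one_level_homotopy by blast
  have "\<Omega> (Suc 0) = cbox 0 1" using \<Psi>_1 by (simp add: \<Omega>_def)
  then have eq: "{u. upd x i u \<in> \<Omega> (Suc 0)} = {u. (\<forall>j. j \<noteq> i \<longrightarrow> 0 \<le> x $ j \<and> x $ j \<le> 1) \<and> u \<in> {0..1}}" for x
    by (simp add: upd_mem_cbox)
  have slice: "{u. upd x i u \<in> \<Omega> (Suc 0)} = {} \<or> {u. upd x i u \<in> \<Omega> (Suc 0)} = {0..1}" for x
    unfolding eq by (cases "\<forall>j. j \<noteq> i \<longrightarrow> 0 \<le> x $ j \<and> x $ j \<le> 1") auto
  have V: "V (Suc l) i True = splines1" "V (Suc l) i False = splines0" "V l i True = {\<lambda>x. 0}"
    using True by (simp_all add: V_def)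
  have "K g u = 0" if "g \<in> splines1" "\<forall>u. upd x i u \<notin> \<Omega> (Suc l) \<longrightarrow> g u = 0" "upd x i u \<notin> \<Omega> (Suc l)" for g x u
    using K(2)[rule_format, OF that(1), THEN conjunct2, THEN conjunct2, rule_format, OF slice, of x u] that True
    by simp
  then show ?thesis unfolding V using K by (intro exI[of _ K]) auto
next
  case False
  then have l: "1 \<le> l" "l \<le> L" "1 \<le> Suc l" "Suc l \<le> L" using assms by auto
  have V: "knot_seq.splines1 (q i) (knot_fun (knots (Suc (q i)) (m i) (\<xi> (Suc l) i))) = V (Suc l) i True"
    "knot_seq.splines0 (q i) (knot_fun (knots (Suc (q i)) (m i) (\<xi> (Suc l) i))) = V (Suc l) i False"
    "knot_seq.splines1 (q i) (knot_fun (knots (Suc (q i)) (m i) (\<xi> l i))) = V l i True"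
    using False by (simp_all add: V_def t_def)
  obtain K where K: "linop K" "\<forall>g\<in>V (Suc l) i True. K g \<in> V (Suc l) i False \<and>
    (\<exists>c\<in>V l i True. has_rd (K g) (\<lambda>x. g x - c x)) \<and>
    (\<forall>Q\<subseteq>{r. (r + 1) * (q i + 2) \<le> length (\<xi> l i) - 1}.
      let U = (\<Union>r\<in>Q. {\<xi> l i ! (r * (q i + 2))..\<xi> l i ! ((r + 1) * (q i + 2))}) in
       (\<forall>x. x \<notin> U \<longrightarrow> g x = 0) \<longrightarrow> (\<forall>x. x \<notin> U \<longrightarrow> K g x = 0))"
    using mesh_homotopy(1)[OF bp[OF l(1,2), of i] bp[OF l(3,4), of i] bis[OF l(1) assms, of i]
      m(1)[of i] m_le[of i] dvd[OF l(1,2), of i], unfolded V]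
    by (elim exE conjE) (rule that)
  have "K g u = 0" if g: "g \<in> V (Suc l) i True"
    and x: "\<forall>u. upd x i u \<notin> \<Omega> (Suc l) \<longrightarrow> g u = 0" "upd x i u \<notin> \<Omega> (Suc l)" for g x u
  proof -
    obtain Q where Q: "Q \<subseteq> {r. (r + 1) * (q i + 2) \<le> length (\<xi> l i) - 1}"
      "{u. upd x i u \<in> \<Psi> (Suc l)} = (\<Union>r\<in>Q. {\<xi> l i ! (r * (q i + 2))..\<xi> l i ! ((r + 1) * (q i + 2))})"
      using slice_macro[OF l(1) assms, where i = i and x = x] by (elim exE conjE) (rule that)
    have U: "u \<in> (\<Union>r\<in>Q. {\<xi> l i ! (r * (q i + 2))..\<xi> l i ! ((r + 1) * (q i + 2))}) \<longleftrightarrow>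
        upd x i u \<in> \<Omega> (Suc l)" for u
      unfolding Q(2)[symmetric] by (simp add: \<Omega>_def)
    have "let U = (\<Union>r\<in>Q. {\<xi> l i ! (r * (q i + 2))..\<xi> l i ! ((r + 1) * (q i + 2))}) in
       (\<forall>x. x \<notin> U \<longrightarrow> g x = 0) \<longrightarrow> (\<forall>x. x \<notin> U \<longrightarrow> K g x = 0)"
      using bspec[OF K(2) g] Q(1) by (elim conjE allE[of _ Q] impE)
    then show ?thesis using x unfolding Let_def U by blast
  qed
  then show ?thesis using K by (intro exI[of _ K] conjI ballI allI impI) blast+
qed

lemma D_exists:
  "\<exists>D. linop D \<and> (\<forall>f\<in>V L i False. has_rd f (D f) \<and>
     (\<forall>x. x \<notin> range (t L i) \<longrightarrow> (f has_real_derivative D f x) (at x)))"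
proof -
  obtain N where "knot_seq (q i) N (t L i)" using knot_seq[of L i] L by auto
  then show ?thesis using knot_seq.derivative_operator[of "q i" N "t L i"] L by (simp add: V_def)
qed

text \<open>One operator, chosen on the finest level, serves all levels: coarser splines are
  contained in the finest space and right derivatives are unique.\<close>

definition D :: "'n \<Rightarrow> (real \<Rightarrow> real) \<Rightarrow> real \<Rightarrow> real" where
  "D i = (SOME D. linop D \<and> (\<forall>f\<in>V L i False. has_rd f (D f) \<and>
     (\<forall>x. x \<notin> range (t L i) \<longrightarrow> (f has_real_derivative D f x) (at x))))"

definition K :: "nat \<Rightarrow> 'n \<Rightarrow> (real \<Rightarrow> real) \<Rightarrow> real \<Rightarrow> real" where
  "K l i = (SOME K. linop K \<and> (\<forall>g\<in>V (Suc l) i True. K g \<in> V (Suc l) i False \<and>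
    (\<exists>c\<in>V l i True. has_rd (K g) (\<lambda>x. g x - c x)) \<and>
    (\<forall>x. (\<forall>u. upd x i u \<notin> \<Omega> (Suc l) \<longrightarrow> g u = 0) \<longrightarrow> (\<forall>u. upd x i u \<notin> \<Omega> (Suc l) \<longrightarrow> K g u = 0))))"

lemma D_props: "linop (D i)" "f \<in> V L i False \<Longrightarrow> has_rd f (D i f)"
  "f \<in> V L i False \<Longrightarrow> x \<notin> range (t L i) \<Longrightarrow> (f has_real_derivative D i f x) (at x)"
  using someI_ex[OF D_exists, of i] unfolding D_def[symmetric] by blast+

lemma K_props:
  assumes "l < L"
  shows "linop (K l i)" "g \<in> V (Suc l) i True \<Longrightarrow> K l i g \<in> V (Suc l) i False"
    "g \<in> V (Suc l) i True \<Longrightarrow> \<exists>c\<in>V l i True. has_rd (K l i g) (\<lambda>x. g x - c x)"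
    "g \<in> V (Suc l) i True \<Longrightarrow> (\<And>u. upd x i u \<notin> \<Omega> (Suc l) \<Longrightarrow> g u = 0) \<Longrightarrow>
      upd x i u \<notin> \<Omega> (Suc l) \<Longrightarrow> K l i g u = 0"
  using someI_ex[OF K_exists[OF assms], of i] unfolding K_def[symmetric] by blast+

lemma D_mem:
  assumes "l \<le> L" "f \<in> V l i False"
  shows "D i f \<in> V l i True"
proof -
  have "has_rd f (D i f)" using V_chain[OF assms(1) order_refl, of i False] assms(2) D_props(2) by blast
  show ?thesis
  proof (cases "l = 0")
    case True
    then show ?thesis using has_rd_unique[OF \<open>has_rd f (D i f)\<close> has_rd_V0] assms(2) by (simp add: V_def)
  next
    case False
    then obtain N where "knot_seq (q i) N (t l i)" using knot_seq[of l i] assms(1) by auto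
    then obtain g where "g \<in> knot_seq.splines1 (q i) (t l i)" "has_rd f g"
      using knot_seq.has_rd_splines0 assms(2) False by (fastforce simp: V_def)
    then show ?thesis using has_rd_unique[OF \<open>has_rd f (D i f)\<close>] False by (simp add: V_def)
  qed
qed

end

section \<open>Tensor-product B-splines and almost-everywhere classes\<close>

lemma tp_bsplines_eq:
  "tp_bsplines s m xs = {tensor (\<lambda>i. bspline (knots (s i) (m i) (xs i)) (s i) (j i)) | j.
     \<forall>i. j i < length (knots (s i) (m i) (xs i)) - (s i + 1)}"
  by (simp add: tp_bsplines_def tensor_def[abs_def])

lemma finite_tp_bsplines: "finite (tp_bsplines s m xs)"
proof -
  have "tp_bsplines s m xs \<subseteq> (\<lambda>j. tensor (\<lambda>i. bspline (knots (s i) (m i) (xs i)) (s i) (j i))) `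
     Pi\<^sub>E UNIV (\<lambda>i. {..<length (knots (s i) (m i) (xs i)) - (s i + 1)})"
    unfolding tp_bsplines_eq by (auto simp: PiE_iff)
  then show ?thesis by (rule finite_subset) (intro finite_imageI finite_PiE; simp)
qed

text \<open>Products of the univariate dual functionals are dual to the tensor products, and they
  sample the required cube next to \<open>x\<close>.\<close>

lemma locally_dual_tp_bsplines:
  fixes s m :: "'n::finite \<Rightarrow> nat"
  assumes "\<And>i. breakpoints (xs i) (zs i)"
  shows "locally_dual (tp_bsplines s m xs)"
proof -
  define n where "n i = length (knots (s i) (m i) (xs i)) - (s i + 1)" for i
  define b where "b i = bspline (knots (s i) (m i) (xs i)) (s i)" for i
  have tp: "tp_bsplines s m xs = {tensor (\<lambda>i. b i (j i)) | j. \<forall>i. j i < n i}"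
    by (simp add: tp_bsplines_eq b_def n_def)
  have rc: "right_cont (tensor (\<lambda>i. b i (j i)))" if "\<forall>i. j i < n i" for j
    unfolding b_def by (intro right_cont_tensor breakpoints.bspline_continuous_right[OF assms])
      (use that in \<open>simp add: n_def\<close>)
  have dual: "\<exists>\<Phi>\<in>evals (orthant x \<epsilon>). \<forall>B'\<in>tp_bsplines s m xs. \<Phi> B' = of_bool (B' = tensor (\<lambda>i. b i (j i)))"
    if j: "\<forall>i. j i < n i" and x: "tensor (\<lambda>i. b i (j i)) x \<noteq> 0" and "0 < \<epsilon>" for j x \<epsilon>
  proof -
    have "b i (j i) (x $ i) \<noteq> 0" for i using x by (auto simp: tensor_def)
    then have "\<exists>\<phi>\<in>evals {x $ i<..<x $ i + \<epsilon>}. \<forall>k<n i. \<phi> (b i k) = of_bool (k = j i)" for i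
      using breakpoints.bspline_dual[OF assms, of "j i" "s i" "m i" i "x $ i" \<epsilon>] j \<open>0 < \<epsilon>\<close>
      unfolding n_def b_def by blast
    then obtain \<phi> where \<phi>: "\<And>i. \<phi> i \<in> evals {x $ i<..<x $ i + \<epsilon>}"
      "\<And>i k. k < n i \<Longrightarrow> \<phi> i (b i k) = of_bool (k = j i)" by metis
    obtain \<Phi> where \<Phi>: "\<Phi> \<in> evals (orthant x \<epsilon>)" "\<forall>f. \<Phi> (tensor f) = (\<Prod>i\<in>UNIV. \<phi> i (f i))"
      using tensor_evals[of \<phi> x \<epsilon>, OF \<phi>(1)] by blast
    have val: "\<Phi> (tensor (\<lambda>i. b i (k i))) = of_bool (k = j)" if "\<forall>i. k i < n i" for k
    proof (cases "k = j")
      case False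
      then obtain i where "k i \<noteq> j i" by blast
      then have "(\<Prod>i\<in>UNIV. \<phi> i (b i (k i))) = 0"
        using \<phi>(2) that by (intro prod_zero bexI[of _ i]) auto
      then show ?thesis using \<Phi>(2) False by simp
    qed (use \<Phi>(2) \<phi>(2) that in simp)
    have "\<Phi> B' = of_bool (B' = tensor (\<lambda>i. b i (j i)))" if B': "B' \<in> tp_bsplines s m xs" for B'
    proof -
      obtain k where k: "B' = tensor (\<lambda>i. b i (k i))" "\<forall>i. k i < n i" using B' unfolding tp by blast
      \<comment> \<open>The basis is a set of functions, so different indices must give different
        functions: the functional takes the value 1 on one and 0 on the other.\<close>
      show ?thesis using val[OF k(2)] val[OF j] unfolding k(1) by (cases "k = j") auto
    qed
    then show ?thesis using \<Phi>(1) by blast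
  qed
  have "\<forall>B\<in>tp_bsplines s m xs. right_cont B" using rc unfolding tp by blast
  moreover have "\<forall>B\<in>tp_bsplines s m xs. \<forall>x \<epsilon>. B x \<noteq> 0 \<longrightarrow> 0 < \<epsilon> \<longrightarrow>
      (\<exists>\<Phi>\<in>evals (orthant x \<epsilon>). \<forall>B'\<in>tp_bsplines s m xs. \<Phi> B' = of_bool (B' = B))"
  proof (intro ballI allI impI)
    fix B x \<epsilon> assume "B \<in> tp_bsplines s m xs" "B x \<noteq> 0" "0 < (\<epsilon> :: real)"
    moreover from this obtain j where "B = tensor (\<lambda>i. b i (j i))" "\<forall>i. j i < n i" unfolding tp by blast
    ultimately show "\<exists>\<Phi>\<in>evals (orthant x \<epsilon>). \<forall>B'\<in>tp_bsplines s m xs. \<Phi> B' = of_bool (B' = B)"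
      using dual by blast
  qed
  ultimately show ?thesis unfolding locally_dual_def using finite_tp_bsplines by blast
qed

lemma ae_class_eqI:
  assumes "\<And>I. AE x in lebesgue. x \<in> box 0 1 \<longrightarrow> \<omega> I x = \<eta> I x"
  shows "ae_class \<omega> = ae_class \<eta>"
proof -
  have "(AE x in lebesgue. x \<in> box 0 1 \<longrightarrow> \<zeta> I x = \<omega> I x) \<longleftrightarrow> (AE x in lebesgue. x \<in> box 0 1 \<longrightarrow> \<zeta> I x = \<eta> I x)"
    for \<zeta> and I
    by (rule eventually_subst) (use assms[of I] in eventually_elim, auto)
  then show ?thesis unfolding ae_class_def by auto
qed

lemma ae_class_eqD: "ae_class \<omega> = ae_class \<eta> \<Longrightarrow> AE x in lebesgue. x \<in> box 0 1 \<longrightarrow> \<omega> I x = \<eta> I x"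
proof -
  assume "ae_class \<omega> = ae_class \<eta>"
  moreover have "\<omega> \<in> ae_class \<omega>" by (simp add: ae_class_def)
  ultimately show ?thesis by (auto simp: ae_class_def)
qed

section \<open>From the abstract hierarchy to THB-spline forms\<close>

context thb_setting
begin

sublocale hierarchy: spline_hierarchy D L V K \<Omega>
proof
  fix l k i f
  show "linop (D i)" by (rule D_props(1))
  show "l \<le> L \<Longrightarrow> lin_space (V l i b)" for b by (rule lin_space_V)
  show "l < L \<Longrightarrow> V l i b \<subseteq> V (Suc l) i b" for b by (rule V_mono)
  show "V 0 i True = {\<lambda>x. 0}" by (simp add: V_def)
  show "l < L \<Longrightarrow> linop (K l i)" by (rule K_props(1))
  show "l \<le> L \<Longrightarrow> f \<in> V l i False \<Longrightarrow> D i f \<in> V l i True" by (rule D_mem)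
  show "l < L \<Longrightarrow> f \<in> V (Suc l) i True \<Longrightarrow> K l i f \<in> V (Suc l) i False" by (rule K_props(2))
  \<comment> \<open>The derivative of \<open>K l i f\<close> is \<open>f - c\<close> with both terms
    coarse, so \<open>rd_coarse\<close> applies.\<close>
  show "K l i f \<in> V l i False" if l: "l < L" and f: "f \<in> V l i True"
  proof -
    have f': "f \<in> V (Suc l) i True" using f V_mono[OF l] by blast
    obtain c where c: "c \<in> V l i True" "has_rd (K l i f) (\<lambda>x. f x - c x)" using K_props(3)[OF l f'] by blast
    show ?thesis
      by (rule rd_coarse[OF l K_props(2)[OF l f'] c(2)]) (use f c l in \<open>auto intro!: lin_space_diff lin_space_V\<close>)
  qed
  show "(\<lambda>x. f x - D i (K l i f) x) \<in> V l i True" if l: "l < L" and f: "f \<in> V (Suc l) i True"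
  proof -
    obtain c where c: "c \<in> V l i True" "has_rd (K l i f) (\<lambda>x. f x - c x)" using K_props(3)[OF l f] by blast
    have "K l i f \<in> V L i False" using K_props(2)[OF l f] V_chain[of "Suc l" L i False] l by auto
    then have "D i (K l i f) = (\<lambda>x. f x - c x)" using D_props(2) has_rd_unique c(2) by blast
    then show ?thesis using c(1) by simp
  qed
  \<comment> \<open>The derivative is \<open>D i f - (D i f - c) = c\<close>, which is
    coarse.\<close>
  show "(\<lambda>x. f x - K l i (D i f) x) \<in> V l i False" if l: "l < L" and f: "f \<in> V (Suc l) i False"
  proof -
    have Df: "D i f \<in> V (Suc l) i True" using D_mem[OF _ f] l by simp
    obtain c where c: "c \<in> V l i True" "has_rd (K l i (D i f)) (\<lambda>x. D i f x - c x)" using K_props(3)[OF l Df] by blast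
    have "has_rd f (D i f)" using V_chain[of "Suc l" L i False] l f D_props(2) by auto
    from has_rd_diff[OF this c(2)] have rd: "has_rd (\<lambda>x. f x - K l i (D i f) x) c" by simp
    show ?thesis
      by (rule rd_coarse[OF l _ rd c(1)]) (use f K_props(2)[OF l Df] l in \<open>auto intro!: lin_space_diff lin_space_V\<close>)
  qed
  show "l < L \<Longrightarrow> \<Omega> (Suc l) \<subseteq> \<Omega> l"
    using dom by (auto simp: domain_hierarchy_def \<Omega>_def)
  show "D i f u = 0" if "l \<le> L" "k \<le> L" "f \<in> V k i False" "\<And>u. upd x i u \<notin> \<Omega> l \<Longrightarrow> f u = 0"
    "upd x i u \<notin> \<Omega> l" for x u
  proof -
    have "has_rd f (D i f)" using V_chain[OF that(2) order_refl, of i False] that(3) D_props(2) by blast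
    then show ?thesis
      by (rule has_rd_zero_outside[OF _ closed_slice[OF that(1), of x i]]) (use that in auto)
  qed
  show "l < L \<Longrightarrow> f \<in> V (Suc l) i True \<Longrightarrow> (\<And>u. upd x i u \<notin> \<Omega> (Suc l) \<Longrightarrow> f u = 0) \<Longrightarrow>
      upd x i u \<notin> \<Omega> (Suc l) \<Longrightarrow> K l i f u = 0" for x u by (rule K_props(4))
qed

definition deg :: "'n set \<Rightarrow> 'n \<Rightarrow> nat" where
  "deg I i = p i - (if i \<in> I then 1 else 0)"

lemma lspan_tp_bsplines:
  assumes "1 \<le> l" "l \<le> L"
  shows "lspan (tp_bsplines (deg I) m (\<xi> l)) = hierarchy.level l I"
proof -
  define S where "S i = {bspline (knots (deg I i) (m i) (\<xi> l i)) (deg I i) j | j.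
    j < length (knots (deg I i) (m i) (\<xi> l i)) - (deg I i + 1)}" for i
  have "lspan (S i) = V l i (i \<in> I)" for i
  proof -
    obtain zs where "breakpoints (\<xi> l i) zs" using breakpoints[OF assms] by blast
    then interpret breakpoints "\<xi> l i" zs .
    show ?thesis
      using lspan_bspline0[OF m(1)[of i] m_le] lspan_bspline1[OF m(1)[of i] m_le] assms
      by (auto simp: S_def deg_def p_eq V_def t_def)
  qed
  then have "hierarchy.level l I = lspan {tensor f | f. \<forall>i. f i \<in> S i}"
    unfolding hierarchy.level_def by (simp flip: tensor_space_lspan)
  also have "{tensor f | f. \<forall>i. f i \<in> S i} = tp_bsplines (deg I) m (\<xi> l)"
  proof (intro equalityI subsetI)
    fix F assume "F \<in> {tensor f | f. \<forall>i. f i \<in> S i}"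
    then obtain f where f: "F = tensor f" "\<forall>i. f i \<in> S i" by blast
    then have "\<forall>i. \<exists>j. f i = bspline (knots (deg I i) (m i) (\<xi> l i)) (deg I i) j \<and>
      j < length (knots (deg I i) (m i) (\<xi> l i)) - (deg I i + 1)" by (simp add: S_def)
    then obtain j where j: "\<And>i. f i = bspline (knots (deg I i) (m i) (\<xi> l i)) (deg I i) (j i)"
      "\<And>i. j i < length (knots (deg I i) (m i) (\<xi> l i)) - (deg I i + 1)" by metis
    have "f = (\<lambda>i. bspline (knots (deg I i) (m i) (\<xi> l i)) (deg I i) (j i))" using j(1) by blast
    then show "F \<in> tp_bsplines (deg I) m (\<xi> l)" unfolding f(1) tp_bsplines_eq using j(2) by blast
  qed (auto simp: tp_bsplines_eq S_def)
  finally show ?thesis by simp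
qed

lemma locally_dual_tp:
  assumes "1 \<le> l" "l \<le> L"
  shows "locally_dual (tp_bsplines (deg I) m (\<xi> l))"
proof -
  obtain zs where "\<And>i. breakpoints (\<xi> l i) (zs i)" using breakpoints[OF assms] by metis
  then show ?thesis by (rule locally_dual_tp_bsplines)
qed

lemma thb_deg: "thb L (deg I) m \<xi> \<Psi>"
proof
  fix l
  show "1 \<le> l \<Longrightarrow> l \<le> L \<Longrightarrow> locally_dual (tp_bsplines (deg I) m (\<xi> l))" by (rule locally_dual_tp)
  show "1 \<le> l \<Longrightarrow> l \<le> L \<Longrightarrow> closed (\<Psi> l)" by (rule closed_\<Psi>)
  assume "1 \<le> l" "l < L"
  then show "tp_bsplines (deg I) m (\<xi> l) \<subseteq> lspan (tp_bsplines (deg I) m (\<xi> (Suc l)))"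
    using lspan_tp_bsplines[of l I] lspan_tp_bsplines[of "Suc l" I] hierarchy.level_mono[of l I]
      lspan_base[of _ "tp_bsplines (deg I) m (\<xi> l)"] by auto
qed

lemma level_right_cont: "1 \<le> l \<Longrightarrow> l \<le> L \<Longrightarrow> F \<in> hierarchy.level l I \<Longrightarrow> right_cont F"
  using locally_dual_right_cont[OF locally_dual_tp] lspan_tp_bsplines by blast

lemma level_zero_outside:
  assumes "1 \<le> l" "l \<le> L" "F \<in> hierarchy.level l I" "x $ i < 0 \<or> 1 \<le> x $ i"
  shows "F x = 0"
proof -
  have "(\<lambda>u. F (upd x i u)) \<in> V l i (i \<in> I)"
    using slice_mem[OF assms(3)[unfolded hierarchy.level_def] lin_space_V[OF assms(2)]] .
  moreover obtain N where "knot_seq (q i) N (t l i)" using knot_seq[OF assms(1,2)] by blast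
  ultimately have "(\<lambda>u. F (upd x i u)) (x $ i) = 0"
    using knot_seq.splines_support[of "q i" N "t l i" "\<lambda>u. F (upd x i u)" "x $ i"] assms(1,4)
    by (auto simp: V_def split: if_splits)
  then show ?thesis by simp
qed

text \<open>In the base case the artificial level adds nothing, since its constants are splines of
  level 1, and all splines of level 1 vanish outside the cube.\<close>

lemma lspan_thb_basis: "Suc l \<le> L \<Longrightarrow> lspan (thb_basis (deg I) m \<xi> \<Psi> (Suc l)) = hierarchy.hier (Suc l) I"
proof (induction l)
  case 0
  have "hierarchy.level 1 I \<subseteq> hierarchy.supported 1"
  proof (unfold hierarchy.supported_def, safe)
    fix F x assume F: "F \<in> hierarchy.level 1 I" and x: "x \<notin> \<Omega> 1"
    then obtain i where "x $ i < 0 \<or> 1 < x $ i" using \<Psi>_1 by (auto simp: \<Omega>_def mem_box_cart not_le)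
    then show "F x = 0" using level_zero_outside[OF _ _ F] 0 by (metis One_nat_def less_imp_le order_refl)
  qed
  then have "hierarchy.level 1 I \<inter> hierarchy.supported 1 = hierarchy.level 1 I" by blast
  moreover have "hierarchy.level 0 I \<subseteq> hierarchy.level 1 I" using hierarchy.level_mono[of 0 I] 0 by simp
  moreover from this have "sum_space (hierarchy.level 0 I) (hierarchy.level 1 I) = hierarchy.level 1 I"
    by (intro subset_antisym sum_space_minimal subset_sum_space hierarchy.lin_space_level) simp_all
  ultimately have "hierarchy.hier (Suc 0) I = hierarchy.level 1 I" by simp
  then show ?case using lspan_tp_bsplines[of 1 I] 0 by simp
next
  case (Suc l)
  interpret T: thb L "deg I" m \<xi> \<Psi> by (rule thb_deg)
  have 1: "lspan (T.tp_in (Suc (Suc l))) =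
      hierarchy.level (Suc (Suc l)) I \<inter> hierarchy.supported (Suc (Suc l))"
    using T.lspan_tp_in[of "Suc (Suc l)"] lspan_tp_bsplines[of "Suc (Suc l)" I] Suc.prems
    by (auto simp: hierarchy.supported_def \<Omega>_def)
  have "lspan (thb_basis (deg I) m \<xi> \<Psi> (Suc (Suc l))) =
      sum_space (hierarchy.hier (Suc l) I) (lspan (T.tp_in (Suc (Suc l))))"
    using T.lspan_thb_basis_step[OF Suc.prems T.lspan_thb_basis_subset] Suc by simp
  then show ?case unfolding 1 by (simp only: hierarchy.hier.simps)
qed

lemma thb_forms_eq: "thb_forms L p m \<xi> \<Psi> k = forms (hierarchy.hier L) k"
proof -
  obtain l where l: "L = Suc l" using L by (cases L) auto
  have "thb_space L (deg I) m \<xi> \<Psi> = hierarchy.hier L I" for I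
    using lspan_thb_basis[of l I] thb.finite_thb_basis[OF thb_deg, of l I] unfolding l thb_space_def
    by (simp only: lspan_eq_lin_comb order_refl)
  then show ?thesis by (simp add: thb_forms_def forms_def deg_def[abs_def])
qed

text \<open>Off the knots of direction \<open>i\<close> the slice of \<open>F\<close> is
  differentiable from both sides, and \<open>D i\<close> is its ordinary derivative there.\<close>

lemma partial_deriv_eq:
  assumes F: "F \<in> hierarchy.level L I" and "i \<notin> I" "x $ i \<notin> range (t L i)"
  shows "partial_deriv i F x = lift_op (D i) i F x"
proof -
  define f where "f u = F (upd x i u)" for u
  have "f \<in> V L i False"
    using slice_mem[where i = i and x = x, OF F[unfolded hierarchy.level_def] lin_space_V] assms(2)
    unfolding f_def[abs_def] by simp
  then have "(f has_real_derivative D i f (x $ i)) (at (0 + x $ i))" using D_props(3) assms(3) by simp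
  then have "((\<lambda>u. f (u + x $ i)) has_real_derivative D i f (x $ i)) (at 0)" by (subst (asm) DERIV_shift)
  moreover have "(\<lambda>u. f (u + x $ i)) = (\<lambda>u. F (x + u *\<^sub>R axis i 1))"
  proof
    fix u
    have "upd x i (u + x $ i) = x + u *\<^sub>R axis i 1" by (simp add: vec_eq_iff axis_def)
    then show "f (u + x $ i) = F (x + u *\<^sub>R axis i 1)" by (simp add: f_def)
  qed
  ultimately have "partial_deriv i F x = D i f (x $ i)"
    unfolding partial_deriv_def by (auto intro: DERIV_imp_deriv)
  then show ?thesis by (simp add: lift_op_def f_def[abs_def])
qed

text \<open>The exceptional points lie on the finitely many hyperplanes through knots of the finest
  level, which are negligible.\<close>

lemma ext_deriv_AE:
  assumes "\<omega> \<in> forms (hierarchy.hier L) k"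
  shows "AE x in lebesgue. ext_deriv \<omega> J x = ext_d D \<omega> J x"
proof -
  define B where "B = (\<Union>(i, c)\<in>(SIGMA i:UNIV. range (t L i)). {x :: real ^ 'n::{finite,linorder}. x $ i = c})"
  have "finite (range (t L i))" for i
  proof (rule finite_subset)
    show "range (t L i) \<subseteq> insert 1 (set (knots (Suc (q i)) (m i) (\<xi> L i)))"
      by (auto simp: t_def knot_fun_def)
  qed simp
  then have "finite (SIGMA i:UNIV. range (t L i))" by (intro finite_SigmaI) simp_all
  then have "negligible B"
    unfolding B_def by (intro negligible_Union finite_imageI)
      (auto simp: cart_eq_inner_axis intro: negligible_standard_hyperplane)
  moreover have "ext_deriv \<omega> J x = ext_d D \<omega> J x" if x: "x \<notin> B" for x
    unfolding ext_deriv_def ext_d_def sgnc_def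
  proof (rule sum.cong[OF refl])
    fix i assume "i \<in> J"
    have "\<omega> (J - {i}) \<in> hierarchy.level L (J - {i})"
      using forms_mem[OF assms hierarchy.lin_space_hier] hierarchy.hier_level[of L] by blast
    then have "partial_deriv i (\<omega> (J - {i})) x = lift_op (D i) i (\<omega> (J - {i})) x"
      by (rule partial_deriv_eq) (use x in \<open>auto simp: B_def\<close>)
    then show "(-1) ^ card {j\<in>J. j < i} * partial_deriv i (\<omega> (J - {i})) x =
      (-1) ^ card {j\<in>J. j < i} * lift_op (D i) i (\<omega> (J - {i})) x" by simp
  qed
  ultimately show ?thesis unfolding eventually_ae_filter_negligible by blast
qed

lemma ae_class_ext_deriv:
  "\<omega> \<in> forms (hierarchy.hier L) k \<Longrightarrow> ae_class (ext_deriv \<omega>) = ae_class (ext_d D \<omega>)"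
proof (rule ae_class_eqI)
  fix I assume "\<omega> \<in> forms (hierarchy.hier L) k"
  then show "AE x in lebesgue. x \<in> box 0 1 \<longrightarrow> ext_deriv \<omega> I x = ext_d D \<omega> I x"
    by (rule eventually_mono[OF ext_deriv_AE[of \<omega> k I]]) simp
qed

theorem image_eq_kernel:
  assumes "1 \<le> k"
  shows "image_d (thb_forms L p m \<xi> \<Psi> (k - 1)) = kernel_d (thb_forms L p m \<xi> \<Psi> k)"
proof -
  have ext_d_mem: "ext_d D \<omega> \<in> forms (hierarchy.hier L) (Suc j)" if "\<omega> \<in> forms (hierarchy.hier L) j" for \<omega> j
    by (rule hierarchy.d_forms[OF that hierarchy.lin_space_hier]) (rule hierarchy.D_hier; simp)
  have ext_d_ext_d: "ext_d D (ext_d D \<omega>) = (\<lambda>I x. 0)" if "\<omega> \<in> forms (hierarchy.hier L) j" for \<omega> j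
  proof (rule hierarchy.d_d)
    fix I
    have "\<omega> I \<in> hierarchy.level L I"
      using forms_mem[OF that hierarchy.lin_space_hier] hierarchy.hier_level[of L I] by blast
    then show "\<omega> I \<in> tensor_space (\<lambda>_. UNIV)"
      unfolding hierarchy.level_def by (rule tensor_space_UNIV)
  qed
  \<comment> \<open>The coefficients of \<open>ext_d D \<omega>\<close> are right-continuous
    splines, so vanishing almost everywhere in the cube means vanishing everywhere, and the
    pointwise exactness result applies to closed classes.\<close>
  have closed_iff: "ae_class (ext_deriv \<omega>) = ae_class (\<lambda>I x. 0) \<longleftrightarrow> ext_d D \<omega> = (\<lambda>I x. 0)"
    if \<omega>: "\<omega> \<in> forms (hierarchy.hier L) j" for \<omega> j
  proof
    assume "ae_class (ext_deriv \<omega>) = ae_class (\<lambda>I x. 0)"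
    then have eq: "ae_class (ext_d D \<omega>) = ae_class (\<lambda>I x. 0)" using ae_class_ext_deriv[OF \<omega>] by simp
    show "ext_d D \<omega> = (\<lambda>I x. 0)"
    proof
      fix I
      have "ext_d D \<omega> I \<in> hierarchy.level L I"
        using forms_mem[OF ext_d_mem[OF \<omega>] hierarchy.lin_space_hier] hierarchy.hier_level[of L I] by blast
      then show "ext_d D \<omega> I = (\<lambda>x. 0)"
        using level_right_cont[OF L order_refl] level_zero_outside[OF L order_refl] ae_class_eqD[OF eq, of I]
        by (intro zero_if_AE_zero) auto
    qed
  qed (simp add: ae_class_ext_deriv[OF \<omega>])
  show ?thesis
    unfolding thb_forms_eq
  proof (intro equalityI subsetI)
    fix c assume "c \<in> image_d (forms (hierarchy.hier L) (k - 1))"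
    then obtain \<sigma> where \<sigma>: "\<sigma> \<in> forms (hierarchy.hier L) (k - 1)" "c = ae_class (ext_deriv \<sigma>)"
      by (auto simp: image_d_def)
    have "ext_d D \<sigma> \<in> forms (hierarchy.hier L) k" using ext_d_mem[OF \<sigma>(1)] assms by simp
    then show "c \<in> kernel_d (forms (hierarchy.hier L) k)"
      using closed_iff[of "ext_d D \<sigma>" k] ext_d_ext_d[OF \<sigma>(1)] ae_class_ext_deriv[OF \<sigma>(1)] \<sigma>(2)
      unfolding kernel_d_def by blast
  next
    fix c assume "c \<in> kernel_d (forms (hierarchy.hier L) k)"
    then obtain \<omega> where \<omega>: "\<omega> \<in> forms (hierarchy.hier L) k" "ae_class (ext_deriv \<omega>) = ae_class (\<lambda>I x. 0)"
      "c = ae_class \<omega>" by (auto simp: kernel_d_def)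
    then obtain \<sigma> where "\<sigma> \<in> forms (hierarchy.hier L) (k - 1)" "\<omega> = ext_d D \<sigma>"
      using hierarchy.hier_exact[OF order_refl assms \<omega>(1)] closed_iff[OF \<omega>(1)] by blast
    then show "c \<in> image_d (forms (hierarchy.hier L) (k - 1))"
      using ae_class_ext_deriv \<omega>(3) unfolding image_d_def by blast
  qed
qed

end

theorem theorem5p1:
  fixes L :: nat and \<eta> :: real
    and p m :: "'n::{finite,linorder} \<Rightarrow> nat"
    and \<xi> :: "nat \<Rightarrow> 'n \<Rightarrow> real list"
    and \<Psi> :: "nat \<Rightarrow> (real ^ 'n::{finite,linorder}) set"
  assumes "1 \<le> L" and "1 \<le> \<eta>"
    and "\<forall>i. 1 \<le> p i"
    and "\<forall>i. 1 \<le> m i \<and> m i \<le> p i"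
    and "mesh_hierarchy L \<eta> p \<xi>"
    and "domain_hierarchy L p \<xi> \<Psi>"
  shows "\<forall>k. 1 \<le> k \<and> k < CARD('n) \<longrightarrow>
           image_d (thb_forms L p m \<xi> \<Psi> (k - 1)) = kernel_d (thb_forms L p m \<xi> \<Psi> k)"
proof -
  interpret thb_setting L \<eta> p m \<xi> \<Psi>
    by unfold_locales (use assms in auto)
  show ?thesis using image_eq_kernel by blast
qed

end
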